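(* Let $L>0$ and, for $T>0$, let $C_S(T,L)$ be the cost of the boundary null control at time $T$ of the 1D Schrödinger equation on $(0,L)$, and let $\beta_+=\limsup_{T\to0^+}T\log(C_S(T,L))$. Then $$\beta_+\leq\frac{\sqrt[4]{27}}{4}L^2<0.56987677\,L^2 .$$
   Context: For $T,L>0$ consider the controlled Schrödinger equation (all function spaces are complex-valued) $$\begin{cases} iy_t+y_{xx}=0 & \text{in }(0,T)\times(0,L),\\ y(0,\cdot)=y^0 & \text{in }(0,L),\\ y(\cdot,0)=u(t) & \text{in }(0,T),\\ y(\cdot,L)=0 & \text{in }(0,T),\end{cases}$$ with $y=y(t,x)$, initial condition $y^0\in H^{-1}(0,L)$ and control $u\in L^2(0,T)$. This is a well-posed linear control system with state space $H^{-1}(0,L)$ (solutions being understood in the usual weak/transposition sense), and it is null-controllable at every time $T>0$: for every $y^0\in H^{-1}(0,L)$ there is $u\in L^2(0,T)$ such that $y(T,\cdot)=0$. The cost of the control $C_S(T,L)$ is the smallest constant $C>0$ such that for every $y^0\in H^{-1}(0,L)$ there exists a control $u\in L^2(0,T)$ driving $y^0$ to $0$ at time $T$ (i.e. $y(T,\cdot)=0$) with $\|u\|_{L^2(0,T)}\leq C\|y^0\|_{H^{-1}(0,L)}$. Equivalently, it is the operator norm of the linear continuous map $y^0\mapsto u_{opt}$, where $u_{opt}$ is the unique control of minimal $L^2(0,T)$-norm bringing $y^0$ to $0$ at time $T$. *)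

theory Defs
  imports "HOL-Analysis.Analysis"
begin

definition space_L2 :: "real \<Rightarrow> real \<Rightarrow> (real \<Rightarrow> complex) set" where
  "space_L2 a b = {f. f \<in> borel_measurable (lebesgue_on {a<..<b}) \<and>
                      integrable (lebesgue_on {a<..<b}) (\<lambda>x. (cmod (f x))\<^sup>2)}"

definition norm_L2 :: "real \<Rightarrow> real \<Rightarrow> (real \<Rightarrow> complex) \<Rightarrow> real" where
  "norm_L2 a b f = sqrt (LINT x|lebesgue_on {a<..<b}. (cmod (f x))\<^sup>2)"

text \<open>\<open>H10_deriv L \<phi> g\<close> says that \<open>\<phi>\<close> belongs to \<open>H\<^sup>1\<^sub>0(0,L)\<close> with weak derivative \<open>g\<close>:
  in one dimension \<open>H\<^sup>1\<^sub>0(0,L)\<close> consists of the absolutely continuous functions on \<open>[0,L]\<close> that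
  vanish at both end points and have a square integrable derivative.  The values of \<open>\<phi>\<close>
  outside \<open>[0,L]\<close> are irrelevant.\<close>

definition H10_deriv :: "real \<Rightarrow> (real \<Rightarrow> complex) \<Rightarrow> (real \<Rightarrow> complex) \<Rightarrow> bool" where
  "H10_deriv L \<phi> g \<longleftrightarrow> g \<in> space_L2 0 L \<and>
     (\<forall>x\<in>{0..L}. \<phi> x = (LINT s|lebesgue_on {0<..<x}. g s)) \<and> \<phi> L = 0"

definition H10 :: "real \<Rightarrow> (real \<Rightarrow> complex) set" where
  "H10 L = {\<phi>. \<exists>g. H10_deriv L \<phi> g}"

text \<open>\<open>H\<^sup>-\<^sup>1(0,L)\<close> is the dual of \<open>H\<^sup>1\<^sub>0(0,L)\<close>, the latter normed by the \<open>L\<^sup>2\<close> norm of the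
  derivative.  Its elements act linearly (not antilinearly), extending the bilinear pairing
  \<open>\<integral> y \<phi> dx\<close> of distributions with test functions.  Boundedness forces the value of a
  functional at \<open>\<phi>\<close> to depend only on \<open>\<phi>\<close> restricted to \<open>[0,L]\<close>; two functionals are the same
  element when they agree on \<open>H10 L\<close>.\<close>

definition Hm1 :: "real \<Rightarrow> ((real \<Rightarrow> complex) \<Rightarrow> complex) set" where
  "Hm1 L = {F.
     (\<forall>\<phi>\<in>H10 L. \<forall>\<psi>\<in>H10 L. F (\<lambda>x. \<phi> x + \<psi> x) = F \<phi> + F \<psi>) \<and>
     (\<forall>c. \<forall>\<phi>\<in>H10 L. F (\<lambda>x. c * \<phi> x) = c * F \<phi>) \<and>
     (\<exists>C. \<forall>\<phi> g. H10_deriv L \<phi> g \<longrightarrow> cmod (F \<phi>) \<le> C * norm_L2 0 L g)}"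

definition norm_Hm1 :: "real \<Rightarrow> ((real \<Rightarrow> complex) \<Rightarrow> complex) \<Rightarrow> real" where
  "norm_Hm1 L F =
     Inf {C. 0 \<le> C \<and> (\<forall>\<phi> g. H10_deriv L \<phi> g \<longrightarrow> cmod (F \<phi>) \<le> C * norm_L2 0 L g)}"

definition continuous_Hm1 :: "real \<Rightarrow> real \<Rightarrow> (real \<Rightarrow> (real \<Rightarrow> complex) \<Rightarrow> complex) \<Rightarrow> bool" where
  "continuous_Hm1 T L y \<longleftrightarrow>
     (\<forall>t\<in>{0..T}. y t \<in> Hm1 L \<and>
        ((\<lambda>s. norm_Hm1 L (\<lambda>\<phi>. y s \<phi> - y t \<phi>)) \<longlongrightarrow> 0) (at t within {0..T}))"

text \<open>Classical solutions \<open>\<phi>\<close> on \<open>[0,\<tau>] \<times> [0,L]\<close> of the adjoint (for the bilinear pairing)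
  equation \<open>-i \<phi>\<^sub>t + \<phi>\<^sub>x\<^sub>x = 0\<close> with homogeneous Dirichlet conditions; \<open>\<phi>x\<close> is the space
  derivative of \<open>\<phi>\<close>.\<close>

definition adjoint_solution ::
  "real \<Rightarrow> real \<Rightarrow> (real \<Rightarrow> real \<Rightarrow> complex) \<Rightarrow> (real \<Rightarrow> real \<Rightarrow> complex) \<Rightarrow> bool" where
  "adjoint_solution \<tau> L \<phi> \<phi>x \<longleftrightarrow>
     (\<exists>\<phi>t \<phi>xx.
        (\<forall>f\<in>{\<phi>, \<phi>t, \<phi>x, \<phi>xx}. continuous_on ({0..\<tau>} \<times> {0..L}) (\<lambda>(t, x). f t x)) \<and>
        (\<forall>t\<in>{0..\<tau>}. \<forall>x\<in>{0..L}.
           ((\<lambda>s. \<phi> s x) has_vector_derivative \<phi>t t x) (at t within {0..\<tau>}) \<and>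
           ((\<lambda>z. \<phi> t z) has_vector_derivative \<phi>x t x) (at x within {0..L}) \<and>
           ((\<lambda>z. \<phi>x t z) has_vector_derivative \<phi>xx t x) (at x within {0..L}) \<and>
           - \<i> * \<phi>t t x + \<phi>xx t x = 0) \<and>
        (\<forall>t\<in>{0..\<tau>}. \<phi> t 0 = 0 \<and> \<phi> t L = 0))"

text \<open>Solutions by transposition in \<open>C([0,T]; H\<^sup>-\<^sup>1(0,L))\<close> of
  \<open>i y\<^sub>t + y\<^sub>x\<^sub>x = 0\<close>, \<open>y(0,\<cdot>) = y0\<close>, \<open>y(\<cdot>,0) = u\<close>, \<open>y(\<cdot>,L) = 0\<close>.  Multiplying the equation
  by an adjoint solution \<open>\<phi>\<close> and integrating by parts over \<open>(0,\<tau>) \<times> (0,L)\<close> gives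
  \<open>i \<langle>y(\<tau>),\<phi>(\<tau>)\<rangle> - i \<langle>y0,\<phi>(0)\<rangle> + \<integral>\<^sub>0\<^sup>\<tau> u(t) \<phi>\<^sub>x(t,0) dt = 0\<close>.
  Classical \<open>\<phi>\<close> suffice: their final values \<open>\<phi>(\<tau>)\<close> include all finite combinations of
  \<open>sin (n \<pi> x / L)\<close> and so are dense in \<open>H\<^sup>1\<^sub>0(0,L)\<close>.\<close>

definition schroedinger_solution ::
  "real \<Rightarrow> real \<Rightarrow> ((real \<Rightarrow> complex) \<Rightarrow> complex) \<Rightarrow> (real \<Rightarrow> complex) \<Rightarrow>
   (real \<Rightarrow> (real \<Rightarrow> complex) \<Rightarrow> complex) \<Rightarrow> bool" where
  "schroedinger_solution T L y0 u y \<longleftrightarrow>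
     continuous_Hm1 T L y \<and>
     (\<forall>\<phi>\<in>H10 L. y 0 \<phi> = y0 \<phi>) \<and>
     (\<forall>\<tau> \<phi> \<phi>x. 0 < \<tau> \<and> \<tau> \<le> T \<and> adjoint_solution \<tau> L \<phi> \<phi>x \<longrightarrow>
        \<i> * y \<tau> (\<phi> \<tau>) - \<i> * y0 (\<phi> 0) + (LINT t|lebesgue_on {0<..<\<tau>}. u t * \<phi>x t 0) = 0)"

definition null_control ::
  "real \<Rightarrow> real \<Rightarrow> ((real \<Rightarrow> complex) \<Rightarrow> complex) \<Rightarrow> (real \<Rightarrow> complex) \<Rightarrow> bool" where
  "null_control T L y0 u \<longleftrightarrow> u \<in> space_L2 0 T \<and>
     (\<exists>y. schroedinger_solution T L y0 u y \<and> (\<forall>\<phi>\<in>H10 L. y T \<phi> = 0))"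

text \<open>The system is null-controllable at every time, so the set below is nonempty.\<close>

definition control_cost :: "real \<Rightarrow> real \<Rightarrow> real" where
  "control_cost T L =
     Inf {C. 0 < C \<and>
        (\<forall>y0\<in>Hm1 L. \<exists>u. null_control T L y0 u \<and> norm_L2 0 T u \<le> C * norm_Hm1 L y0)}"

definition beta_plus :: "real \<Rightarrow> ereal" where
  "beta_plus L = Limsup (at_right 0) (\<lambda>T. ereal (T * ln (control_cost T L)))"

end

theory Submission
  imports Defs "HOL-Complex_Analysis.Complex_Analysis" "HOL-Real_Asymp.Real_Asymp"
begin

text \<open>
  Expanding in sines and rescaling time by \<open>\<omega> = (\<pi>/L)\<^sup>2\<close>, null control of \<open>y0\<close> in time \<open>T = 2\<tau>/\<omega>\<close>
  becomes the moment problem \<open>\<integral> v(t) exp(i n\<^sup>2 t) dt = c n\<close> on \<open>(-\<tau>, \<tau>)\<close> with \<open>c \<in> l\<^sup>2\<close>.  It is solved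
  with the biorthogonal family whose Fourier transforms are, up to a squared sinc,
  \<open>Phi(z) / (Phi'(m\<^sup>2) (z - m\<^sup>2)) * H(z - m\<^sup>2) / H(0)\<close>, where \<open>Phi(z) = sin(\<pi>\<surd>z) / (\<pi>\<surd>z)\<close> vanishes at the
  squares and grows like \<open>exp(\<pi>\<surd>\<bar>z\<bar>)\<close> on the negative half line only.  So the multiplier \<open>H\<close> has to
  decay on the negative half line only, and so does the transform of the purely oscillating function
  \<open>exp(2ibs / (1 - s\<^sup>2))\<close> on \<open>[-1, 1]\<close> (multiplied by \<open>1 - s\<^sup>2\<close> for continuity): deforming \<open>[-1, 1]\<close> to
  the unit semicircle turns it into \<open>exp(- b / sin x)\<close>.  Rescaled to \<open>[-\<tau>, \<tau>]\<close>, this yields the decay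
  \<open>exp(- 2\<surd>(b\<tau>\<bar>z\<bar>))\<close> at the price of \<open>H(0)\<close> being of order \<open>exp(- b)\<close>.  With \<open>b = \<pi>\<^sup>2 / (4\<tau>)\<close>
  the cost is roughly \<open>exp(\<pi>\<^sup>2 / (4\<tau>)) = exp(L\<^sup>2 / (2T))\<close>, and \<open>1/2\<close> lies below \<open>27\<^bsup>1/4\<^esup>/4\<close>, with
  room for the losses.

  All frequencies are integers, so that \<open>L\<^sup>2\<close> bounds follow from Fourier series on a period, and the
  support in \<open>[-\<tau>, \<tau>]\<close> from the residue theorem in place of a Paley--Wiener theorem.
\<close>

section \<open>Square-integrable functions\<close>

text \<open>The constant arises as follows. At a negative point z the transform rescaled to
  [-\<sigma>, \<sigma>] has on the semicircle an integrand of size exp(- b / sin x - \<sigma> |z|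
  sin x), and by the arithmetic-geometric mean inequality this exponent is at most -2 sqrt(b
  \<sigma> |z|) for every x. It has to beat exp(\<pi> sqrt|z|), so b \<sigma> = \<pi>^2 / 4, while
  the support demands \<sigma> < \<tau>. At z = 0 only exp(- b / sin x) is left, with maximum exp(-
  b) at x = \<pi>/2, so normalising at a node costs about exp(b). Two losses are accepted: \<sigma>
  = 47/50 \<tau>, the rest of \<tau> being spent on decay in frequency and on the growth of
  \<open>Phi\<close> off the real axis, and a factor 103/100 in the exponent of the lower bound at
  0. Together they give 103/100 * 50/94 L^2 < 0.548 L^2, whereas the target exceeds 0.55 L^2.

  Infinitely many moments are prescribed at once, so the norm estimates must be uniform in m,
  although 1 / Phi'(m^2) has modulus 2 m^2. This growth is compensated by the denominator z - m^2
  far from the node and by the zero of \<open>Phi\<close> close to it.\<close>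

lemma cmod_add_sq_le: "(cmod (a + b))\<^sup>2 \<le> 2 * (cmod a)\<^sup>2 + 2 * (cmod b)\<^sup>2"
proof -
  have "(cmod (a + b))\<^sup>2 \<le> (cmod a + cmod b)\<^sup>2"
    by (intro power_mono norm_triangle_ineq) simp
  also have "\<dots> \<le> 2 * (cmod a)\<^sup>2 + 2 * (cmod b)\<^sup>2"
    using sum_squares_bound[of "cmod a" "cmod b"] by (simp add: power2_sum)
  finally show ?thesis .
qed

text \<open>Stated for an arbitrary measure so that one set of facts serves time intervals, the
  space interval and all sub-intervals; over an open interval it is membership in
  \<open>space_L2\<close>.\<close>

definition sq_int :: "'a measure \<Rightarrow> ('a \<Rightarrow> complex) \<Rightarrow> bool" where
  "sq_int M f \<longleftrightarrow> f \<in> borel_measurable M \<and> integrable M (\<lambda>x. (cmod (f x))\<^sup>2)"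

definition l2norm :: "'a measure \<Rightarrow> ('a \<Rightarrow> complex) \<Rightarrow> real" where
  "l2norm M f = sqrt (LINT x|M. (cmod (f x))\<^sup>2)"

lemma l2norm_nonneg [simp]: "0 \<le> l2norm M f"
  unfolding l2norm_def by (intro real_sqrt_ge_zero integral_nonneg_AE) auto

lemma l2norm_sq: "(l2norm M f)\<^sup>2 = (LINT x|M. (cmod (f x))\<^sup>2)"
  unfolding l2norm_def by (intro real_sqrt_pow2 integral_nonneg_AE) auto

lemma sq_int_measurable [measurable_dest]: "sq_int M f \<Longrightarrow> f \<in> borel_measurable M"
  by (simp add: sq_int_def)

lemma sq_int_bound:
  assumes "sq_int M f" and [measurable]: "g \<in> borel_measurable M"
    and "\<And>x. x \<in> space M \<Longrightarrow> cmod (g x) \<le> K * cmod (f x)"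
  shows "sq_int M g"
proof -
  have "integrable M (\<lambda>x. (cmod (g x))\<^sup>2)"
  proof (rule Bochner_Integration.integrable_bound)
    show "integrable M (\<lambda>x. K\<^sup>2 * (cmod (f x))\<^sup>2)"
      using assms(1) by (auto simp: sq_int_def)
    show "AE x in M. norm ((cmod (g x))\<^sup>2) \<le> norm (K\<^sup>2 * (cmod (f x))\<^sup>2)"
    proof (rule AE_I2)
      fix x assume "x \<in> space M"
      then have "(cmod (g x))\<^sup>2 \<le> (K * cmod (f x))\<^sup>2"
        using assms(3) by (intro power_mono) auto
      then show "norm ((cmod (g x))\<^sup>2) \<le> norm (K\<^sup>2 * (cmod (f x))\<^sup>2)"
        by (simp add: power_mult_distrib)
    qed
  qed simp
  then show ?thesis by (simp add: sq_int_def)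
qed

lemma sq_int_zero [simp]: "sq_int M (\<lambda>x. 0)"
  by (simp add: sq_int_def)

lemma sq_int_add:
  assumes "sq_int M f" "sq_int M g"
  shows "sq_int M (\<lambda>x. f x + g x)"
proof -
  have [measurable]: "f \<in> borel_measurable M" "g \<in> borel_measurable M"
    using assms by (auto simp: sq_int_def)
  have "integrable M (\<lambda>x. (cmod (f x + g x))\<^sup>2)"
  proof (rule Bochner_Integration.integrable_bound)
    show "integrable M (\<lambda>x. 2 * (cmod (f x))\<^sup>2 + 2 * (cmod (g x))\<^sup>2)"
      using assms by (auto simp: sq_int_def)
    show "AE x in M. norm ((cmod (f x + g x))\<^sup>2) \<le> norm (2 * (cmod (f x))\<^sup>2 + 2 * (cmod (g x))\<^sup>2)"
      using cmod_add_sq_le[of "f _" "g _"] by (intro AE_I2) simp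
  qed simp
  then show ?thesis by (simp add: sq_int_def)
qed

lemma sq_int_cmult: "sq_int M f \<Longrightarrow> sq_int M (\<lambda>x. c * f x)"
  by (rule sq_int_bound[where K="cmod c"]) (auto simp: norm_mult sq_int_def)

lemma sq_int_uminus: "sq_int M f \<Longrightarrow> sq_int M (\<lambda>x. - f x)"
  using sq_int_cmult[of M f "-1"] by simp

lemma sq_int_diff: "sq_int M f \<Longrightarrow> sq_int M g \<Longrightarrow> sq_int M (\<lambda>x. f x - g x)"
  using sq_int_add[of M f "\<lambda>x. - g x"] sq_int_uminus[of M g] by simp

lemma sq_int_sum: "(\<And>i. i \<in> I \<Longrightarrow> sq_int M (f i)) \<Longrightarrow> sq_int M (\<lambda>x. \<Sum>i\<in>I. f i x)"
  by (induction I rule: infinite_finite_induct) (auto intro: sq_int_add)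

lemma sq_int_cnj: "sq_int M f \<Longrightarrow> sq_int M (\<lambda>x. cnj (f x))"
  by (simp add: sq_int_def borel_measurable_continuous_on[OF continuous_on_cnj[OF continuous_on_id]])

lemma sq_int_mult_integrable:
  assumes "sq_int M f" "sq_int M g"
  shows "integrable M (\<lambda>x. f x * g x)"
proof (rule Bochner_Integration.integrable_bound)
  have [measurable]: "f \<in> borel_measurable M" "g \<in> borel_measurable M"
    using assms by (auto simp: sq_int_def)
  show "(\<lambda>x. f x * g x) \<in> borel_measurable M" by simp
  show "integrable M (\<lambda>x. (cmod (f x))\<^sup>2 + (cmod (g x))\<^sup>2)"
    using assms by (auto simp: sq_int_def)
  show "AE x in M. norm (f x * g x) \<le> norm ((cmod (f x))\<^sup>2 + (cmod (g x))\<^sup>2)"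
  proof (rule AE_I2)
    fix x
    have "0 \<le> cmod (f x) * cmod (g x)" by simp
    then have "cmod (f x) * cmod (g x) \<le> (cmod (f x))\<^sup>2 + (cmod (g x))\<^sup>2"
      using sum_squares_bound[of "cmod (f x)" "cmod (g x)"] by linarith
    then show "norm (f x * g x) \<le> norm ((cmod (f x))\<^sup>2 + (cmod (g x))\<^sup>2)"
      by (simp add: norm_mult)
  qed
qed

text \<open>The pairing is bilinear, without conjugation, as in the moments and in the transposition
  identity. The proof passes to moduli, where the inequality for nonnegative integrals
  applies.\<close>

lemma l2_cauchy_schwarz:
  assumes "sq_int M f" "sq_int M g"
  shows "cmod (LINT x|M. f x * g x) \<le> l2norm M f * l2norm M g"
proof -
  have [measurable]: "f \<in> borel_measurable M" "g \<in> borel_measurable M"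
    using assms by (auto simp: sq_int_def)
  define P where "P = (LINT x|M. cmod (f x) * cmod (g x))"
  have intP: "integrable M (\<lambda>x. cmod (f x) * cmod (g x))"
    using integrable_norm[OF sq_int_mult_integrable[OF assms]] by (simp add: norm_mult)
  have le: "cmod (LINT x|M. f x * g x) \<le> P"
    unfolding P_def using integral_norm_bound[of M "\<lambda>x. f x * g x"] by (simp add: norm_mult)
  have P0: "0 \<le> P" unfolding P_def by (intro integral_nonneg_AE) auto
  have "(\<integral>\<^sup>+x. ennreal (cmod (f x)) * ennreal (cmod (g x)) \<partial>M)\<^sup>2 \<le>
      (\<integral>\<^sup>+x. (ennreal (cmod (f x)))\<^sup>2 \<partial>M) * (\<integral>\<^sup>+x. (ennreal (cmod (g x)))\<^sup>2 \<partial>M)"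
    by (rule Cauchy_Schwarz_nn_integral) auto
  also have "(\<integral>\<^sup>+x. ennreal (cmod (f x)) * ennreal (cmod (g x)) \<partial>M) = ennreal P"
    unfolding P_def ennreal_mult''[symmetric, OF norm_ge_zero]
    by (rule nn_integral_eq_integral[OF intP]) auto
  also have "(\<integral>\<^sup>+x. (ennreal (cmod (f x)))\<^sup>2 \<partial>M) = ennreal ((l2norm M f)\<^sup>2)"
    unfolding l2norm_sq ennreal_power[OF norm_ge_zero]
    using assms(1) by (intro nn_integral_eq_integral) (auto simp: sq_int_def)
  also have "(\<integral>\<^sup>+x. (ennreal (cmod (g x)))\<^sup>2 \<partial>M) = ennreal ((l2norm M g)\<^sup>2)"
    unfolding l2norm_sq ennreal_power[OF norm_ge_zero]
    using assms(2) by (intro nn_integral_eq_integral) (auto simp: sq_int_def)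
  finally have "ennreal (P\<^sup>2) \<le> ennreal ((l2norm M f)\<^sup>2 * (l2norm M g)\<^sup>2)"
    using P0 by (simp add: ennreal_power ennreal_mult)
  then have "P\<^sup>2 \<le> (l2norm M f * l2norm M g)\<^sup>2"
    by (simp add: ennreal_le_iff power_mult_distrib)
  then have "P \<le> l2norm M f * l2norm M g"
    by (rule power2_le_imp_le) simp
  with le show ?thesis by simp
qed

text \<open>With h = f + g, the squared norm of h is the sum of the pairings of f and of g with the
  conjugate of h. Cauchy-Schwarz bounds both, and one factor norm of h is divided out.\<close>

lemma l2norm_triangle:
  assumes "sq_int M f" "sq_int M g"
  shows "l2norm M (\<lambda>x. f x + g x) \<le> l2norm M f + l2norm M g"
proof -
  let ?h = "\<lambda>x. f x + g x"
  have h: "sq_int M ?h" using assms by (rule sq_int_add)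
  have "complex_of_real ((l2norm M ?h)\<^sup>2) = (LINT x|M. ?h x * cnj (?h x))"
    unfolding l2norm_sq integral_complex_of_real[symmetric] complex_norm_square ..
  also have "\<dots> = (LINT x|M. f x * cnj (?h x)) + (LINT x|M. g x * cnj (?h x))"
    unfolding distrib_right
    using assms h by (intro Bochner_Integration.integral_add sq_int_mult_integrable sq_int_cnj)
  finally have "(l2norm M ?h)\<^sup>2 \<le>
      cmod (LINT x|M. f x * cnj (?h x)) + cmod (LINT x|M. g x * cnj (?h x))"
    using norm_triangle_ineq[of "LINT x|M. f x * cnj (?h x)" "LINT x|M. g x * cnj (?h x)"]
      norm_of_real[of "(l2norm M ?h)\<^sup>2", where ?'a=complex] by (simp del: norm_of_real)
  also have "\<dots> \<le> l2norm M f * l2norm M (\<lambda>x. cnj (?h x)) + l2norm M g * l2norm M (\<lambda>x. cnj (?h x))"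
    using assms h by (intro add_mono l2_cauchy_schwarz sq_int_cnj)
  also have "l2norm M (\<lambda>x. cnj (?h x)) = l2norm M ?h"
    unfolding l2norm_def complex_mod_cnj ..
  finally have *: "l2norm M ?h * l2norm M ?h \<le> (l2norm M f + l2norm M g) * l2norm M ?h"
    by (simp add: power2_eq_square algebra_simps)
  show ?thesis
  proof (cases "l2norm M ?h = 0")
    case True then show ?thesis by simp
  next
    case False
    then have "0 < l2norm M ?h" using l2norm_nonneg[of M ?h] by linarith
    with * show ?thesis by (rule mult_right_le_imp_le)
  qed
qed

lemma l2norm_diff_commute: "l2norm M (\<lambda>x. f x - g x) = l2norm M (\<lambda>x. g x - f x)"
  by (simp add: l2norm_def norm_minus_commute)

lemma l2norm_triangle_diff:
  assumes "sq_int M f" "sq_int M g"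
  shows "l2norm M f \<le> l2norm M g + l2norm M (\<lambda>x. f x - g x)"
  using l2norm_triangle[OF assms(2) sq_int_diff[OF assms]] by simp

text \<open>Parseval for a finite orthogonal family with common squared norm r; it serves the
  exponentials in time and the sines and cosines in space.\<close>

lemma l2norm_orthogonal_sum:
  assumes F: "finite F" and e: "\<And>k. k \<in> F \<Longrightarrow> sq_int M (e k)"
    and orth: "\<And>k l. k \<in> F \<Longrightarrow> l \<in> F \<Longrightarrow> (LINT t|M. e k t * cnj (e l t)) = (if l = k then of_real r else 0)"
  shows "(l2norm M (\<lambda>t. \<Sum>k\<in>F. d k * e k t))\<^sup>2 = r * (\<Sum>k\<in>F. (cmod (d k))\<^sup>2)"
proof -
  let ?f = "\<lambda>t. \<Sum>k\<in>F. d k * e k t"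
  have i: "integrable M (\<lambda>t. e k t * cnj (e l t))" if "k \<in> F" "l \<in> F" for k l
    using that by (intro sq_int_mult_integrable sq_int_cnj e)
  have "complex_of_real ((l2norm M ?f)\<^sup>2) = (LINT t|M. ?f t * cnj (?f t))"
    unfolding l2norm_sq integral_complex_of_real[symmetric] complex_norm_square ..
  also have "\<dots> = (LINT t|M. (\<Sum>k\<in>F. \<Sum>l\<in>F. d k * cnj (d l) * (e k t * cnj (e l t))))"
    by (simp add: sum_product mult_ac)
  also have "\<dots> = (\<Sum>k\<in>F. \<Sum>l\<in>F. d k * cnj (d l) * (LINT t|M. e k t * cnj (e l t)))"
  proof -
    have "(LINT t|M. (\<Sum>k\<in>F. \<Sum>l\<in>F. d k * cnj (d l) * (e k t * cnj (e l t))))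
        = (\<Sum>k\<in>F. LINT t|M. (\<Sum>l\<in>F. d k * cnj (d l) * (e k t * cnj (e l t))))"
      by (intro Bochner_Integration.integral_sum Bochner_Integration.integrable_sum integrable_mult_right i)
    also have "\<dots> = (\<Sum>k\<in>F. \<Sum>l\<in>F. LINT t|M. d k * cnj (d l) * (e k t * cnj (e l t)))"
      by (intro sum.cong refl Bochner_Integration.integral_sum integrable_mult_right i)
    finally show ?thesis by simp
  qed
  also have "\<dots> = (\<Sum>k\<in>F. \<Sum>l\<in>F. if l = k then d k * cnj (d l) * of_real r else 0)"
    by (intro sum.cong refl) (simp add: orth)
  also have "\<dots> = (\<Sum>k\<in>F. of_real (r * (cmod (d k))\<^sup>2))"
    using F unfolding of_real_mult complex_norm_square
    by (intro sum.cong refl) (simp add: sum.delta mult_ac)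
  also have "\<dots> = of_real (r * (\<Sum>k\<in>F. (cmod (d k))\<^sup>2))"
    by (simp add: sum_distrib_left)
  finally show ?thesis by (simp only: of_real_eq_iff)
qed

text \<open>Duality: a bound P for synthesis gives the same bound for analysis, by testing u against
  the combination whose coefficients are the conjugate moments. This covers exponentials on less
  than a period, where they are no longer orthogonal.\<close>

lemma bessel_dual:
  assumes F: "finite F" and e: "\<And>k. k \<in> F \<Longrightarrow> sq_int M (e k)" and P: "0 \<le> P"
    and bd: "\<And>d. (l2norm M (\<lambda>t. \<Sum>k\<in>F. d k * e k t))\<^sup>2 \<le> P * (\<Sum>k\<in>F. (cmod (d k))\<^sup>2)"
    and u: "sq_int M u"
  shows "(\<Sum>k\<in>F. (cmod (LINT t|M. u t * e k t))\<^sup>2) \<le> P * (l2norm M u)\<^sup>2"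
proof -
  define c where "c = (\<lambda>k. LINT t|M. u t * e k t)"
  define S where "S = (\<Sum>k\<in>F. (cmod (c k))\<^sup>2)"
  have S0: "0 \<le> S" by (simp add: S_def sum_nonneg)
  let ?w = "\<lambda>t. \<Sum>k\<in>F. cnj (c k) * e k t"
  have w: "sq_int M ?w" by (intro sq_int_sum sq_int_cmult e)
  have "complex_of_real S = (\<Sum>k\<in>F. cnj (c k) * c k)"
    unfolding S_def of_real_sum complex_norm_square by (simp add: mult.commute)
  also have "\<dots> = (\<Sum>k\<in>F. (LINT t|M. cnj (c k) * (u t * e k t)))" by (simp add: c_def)
  also have "\<dots> = (LINT t|M. (\<Sum>k\<in>F. cnj (c k) * (u t * e k t)))"
    using sq_int_mult_integrable[OF u e]
    by (intro Bochner_Integration.integral_sum[symmetric] integrable_mult_right) auto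
  also have "\<dots> = (LINT t|M. u t * ?w t)" by (simp add: sum_distrib_left mult_ac)
  finally have "S = cmod (LINT t|M. u t * ?w t)" using S0 by (metis abs_of_nonneg norm_of_real)
  also have "\<dots> \<le> l2norm M u * l2norm M ?w" by (rule l2_cauchy_schwarz[OF u w])
  finally have "S\<^sup>2 \<le> (l2norm M u * l2norm M ?w)\<^sup>2" using S0 by (intro power_mono) auto
  also have "\<dots> \<le> (l2norm M u)\<^sup>2 * (P * S)"
    using bd[of "\<lambda>k. cnj (c k)"] by (simp add: power_mult_distrib S_def mult_left_mono)
  finally have *: "S * S \<le> (P * (l2norm M u)\<^sup>2) * S" by (simp add: power2_eq_square mult_ac)
  have "S \<le> P * (l2norm M u)\<^sup>2"
  proof (cases "S = 0")
    case True then show ?thesis using P by simp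
  next
    case False
    then have "0 < S" using S0 by simp
    with * show ?thesis by (rule mult_right_le_imp_le)
  qed
  then show ?thesis by (simp add: S_def c_def)
qed

text \<open>A subsequence with summable increments converges almost everywhere, and Fatou's lemma turns
  this into convergence in norm.\<close>

lemma riesz_fischer:
  assumes f: "\<And>n::nat. sq_int M (f n)"
    and cauchy: "\<And>e. 0 < e \<Longrightarrow> \<exists>N. \<forall>m\<ge>N. \<forall>n\<ge>N. l2norm M (\<lambda>x. f m x - f n x) < e"
  shows "\<exists>g. sq_int M g \<and> (\<lambda>n. l2norm M (\<lambda>x. f n x - g x)) \<longlonglongrightarrow> 0"
proof -
  have [measurable]: "\<And>n. f n \<in> borel_measurable M" using f by (simp add: sq_int_def)
  \<comment> \<open>The rate 4^-k leaves room for the weight 4^k: the weighted squared increments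
    still have a finite sum, and finiteness of that sum at a point eventually forces the increments
    there below 2^-k.\<close>
  have "\<exists>N. \<forall>m\<ge>N. \<forall>n\<ge>N. l2norm M (\<lambda>x. f m x - f n x) < (1/4)^k" for k :: nat
    by (rule cauchy) simp
  then obtain N where N: "\<And>k m n. m \<ge> N k \<Longrightarrow> n \<ge> N k \<Longrightarrow> l2norm M (\<lambda>x. f m x - f n x) < (1/4)^k"
    by metis
  define r where "r = rec_nat (N 0) (\<lambda>k p. max (Suc p) (N (Suc k)))"
  have r_Suc: "r (Suc k) = max (Suc (r k)) (N (Suc k))" for k by (simp add: r_def)
  have rN: "r k \<ge> N k" for k by (cases k) (auto simp: r_def)
  have mono: "r k \<le> r (Suc k)" for k using r_Suc[of k] by simp
  define d where "d = (\<lambda>k x. f (r (Suc k)) x - f (r k) x)"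
  have d: "sq_int M (d k)" for k unfolding d_def by (intro sq_int_diff f)
  have [measurable]: "\<And>k. d k \<in> borel_measurable M" using d by (simp add: sq_int_def)
  have dn: "l2norm M (d k) < (1/4)^k" for k
    unfolding d_def using rN[of k] mono[of k] by (intro N) auto
  have dn2: "(\<integral>\<^sup>+x. ennreal ((cmod (d k x))\<^sup>2) \<partial>M) = ennreal ((l2norm M (d k))\<^sup>2)" for k
    unfolding l2norm_sq using d[of k] by (intro nn_integral_eq_integral) (auto simp: sq_int_def)
  have "(\<integral>\<^sup>+x. (\<Sum>k. ennreal (4^k * (cmod (d k x))\<^sup>2)) \<partial>M)
      = (\<Sum>k. \<integral>\<^sup>+x. ennreal (4^k * (cmod (d k x))\<^sup>2) \<partial>M)"
    by (rule nn_integral_suminf) simp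
  also have "\<dots> = (\<Sum>k. ennreal (4^k * (l2norm M (d k))\<^sup>2))"
    by (simp add: ennreal_mult nn_integral_cmult dn2)
  also have "\<dots> \<le> (\<Sum>k. ennreal ((1/4)^k))"
  proof (intro suminf_le ennreal_leI)
    fix k
    have "(l2norm M (d k))\<^sup>2 \<le> ((1/4)^k)\<^sup>2"
      using dn[of k] by (intro power_mono) auto
    then have "4^k * (l2norm M (d k))\<^sup>2 \<le> 4^k * ((1/4)^k)\<^sup>2" by simp
    also have "(4::real)^k * ((1/4)^k)\<^sup>2 = (1/4)^k"
      by (simp add: power_one_over power2_eq_square)
    finally show "4^k * (l2norm M (d k))\<^sup>2 \<le> (1/4)^k" .
  qed auto
  also have "\<dots> < \<infinity>"
    using summable_geometric[of "1/4::real"] by (subst suminf_ennreal2) auto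
  finally have "(\<integral>\<^sup>+x. (\<Sum>k. ennreal (4^k * (cmod (d k x))\<^sup>2)) \<partial>M) \<noteq> \<infinity>" by simp
  then have "AE x in M. (\<Sum>k. ennreal (4^k * (cmod (d k x))\<^sup>2)) \<noteq> \<infinity>"
    by (intro nn_integral_PInf_AE) auto
  then have conv: "AE x in M. convergent (\<lambda>k. f (r k) x)"
  proof (rule AE_mp, intro AE_I2 impI)
    fix x assume "(\<Sum>k. ennreal (4^k * (cmod (d k x))\<^sup>2)) \<noteq> \<infinity>"
    then have s: "summable (\<lambda>k. 4^k * (cmod (d k x))\<^sup>2)"
      by (intro summable_suminf_not_top) auto
    then have "(\<lambda>k. 4^k * (cmod (d k x))\<^sup>2) \<longlonglongrightarrow> 0" by (rule summable_LIMSEQ_zero)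
    then have "eventually (\<lambda>k. 4^k * (cmod (d k x))\<^sup>2 < 1) sequentially"
      by (rule order_tendstoD) simp
    then have ev: "eventually (\<lambda>k. norm (d k x) \<le> (1/2)^k) sequentially"
    proof eventually_elim
      case (elim k)
      moreover have "((2::real)^k)\<^sup>2 = (2\<^sup>2)^k"
        by (simp only: power_mult[symmetric] mult.commute)
      ultimately have "(2^k * cmod (d k x))\<^sup>2 < 1\<^sup>2"
        by (simp add: power_mult_distrib)
      then have "2^k * cmod (d k x) < 1" by (rule power2_less_imp_less) simp
      then show ?case by (simp add: power_one_over field_simps)
    qed
    have "summable (\<lambda>k. d k x)"
      by (rule summable_comparison_test_ev[OF ev]) (simp add: summable_geometric)
    then have "convergent (\<lambda>n. \<Sum>k<n. d k x)" by (simp add: summable_iff_convergent)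
    moreover have "(\<Sum>k<n. d k x) = f (r n) x - f (r 0) x" for n
      unfolding d_def by (rule sum_lessThan_telescope)
    ultimately have "convergent (\<lambda>n. f (r n) x - f (r 0) x)" by simp
    then show "convergent (\<lambda>k. f (r k) x)"
      by (simp add: convergent_diff_const_right_iff)
  qed
  define g where "g = (\<lambda>x. lim (\<lambda>k. f (r k) x))"
  have [measurable]: "g \<in> borel_measurable M"
    unfolding g_def by (rule borel_measurable_lim_metric) simp
  have lim: "AE x in M. (\<lambda>k. f (r k) x) \<longlonglongrightarrow> g x"
    using conv by eventually_elim (simp add: g_def convergent_LIMSEQ_iff)
  \<comment> \<open>Fatou along the subsequence: for fixed n the distance to the limit is at most
    the lower limit of the distances to \<open>f (r k)\<close>.\<close>
  have key: "(\<integral>\<^sup>+x. ennreal ((cmod (f n x - g x))\<^sup>2) \<partial>M) \<le> ennreal (e\<^sup>2)"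
    if "0 < e" and n: "\<And>m. m \<ge> n \<Longrightarrow> l2norm M (\<lambda>x. f n x - f m x) \<le> e" for e n
  proof -
    have "(\<integral>\<^sup>+x. ennreal ((cmod (f n x - g x))\<^sup>2) \<partial>M)
       = (\<integral>\<^sup>+x. liminf (\<lambda>k. ennreal ((cmod (f n x - f (r k) x))\<^sup>2)) \<partial>M)"
    proof (rule nn_integral_cong_AE, use lim in eventually_elim)
      case (elim x)
      then have "(\<lambda>k. ennreal ((cmod (f n x - f (r k) x))\<^sup>2)) \<longlonglongrightarrow> ennreal ((cmod (f n x - g x))\<^sup>2)"
        by (intro tendsto_intros tendsto_ennrealI)
      then show ?case
        by (intro lim_imp_Liminf[symmetric] trivial_limit_sequentially)
    qed
    also have "\<dots> \<le> liminf (\<lambda>k. \<integral>\<^sup>+x. ennreal ((cmod (f n x - f (r k) x))\<^sup>2) \<partial>M)"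
      by (rule nn_integral_liminf) simp
    also have "\<dots> \<le> ennreal (e\<^sup>2)"
    proof (rule Liminf_le)
      have rge: "r k \<ge> k" for k
      proof (induction k)
        case (Suc k) then show ?case using r_Suc[of k] by simp
      qed simp
      show "\<forall>\<^sub>F k in sequentially. (\<integral>\<^sup>+x. ennreal ((cmod (f n x - f (r k) x))\<^sup>2) \<partial>M) \<le> ennreal (e\<^sup>2)"
      proof (rule eventually_sequentiallyI[of n])
        fix k assume "n \<le> k"
        then have "r k \<ge> n" using rge[of k] by simp
        then have "l2norm M (\<lambda>x. f n x - f (r k) x) \<le> e" by (rule n)
        moreover have "(\<integral>\<^sup>+x. ennreal ((cmod (f n x - f (r k) x))\<^sup>2) \<partial>M)
            = ennreal ((l2norm M (\<lambda>x. f n x - f (r k) x))\<^sup>2)"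
          unfolding l2norm_sq using sq_int_diff[OF f[of n] f[of "r k"]]
          by (intro nn_integral_eq_integral) (auto simp: sq_int_def)
        ultimately show "(\<integral>\<^sup>+x. ennreal ((cmod (f n x - f (r k) x))\<^sup>2) \<partial>M) \<le> ennreal (e\<^sup>2)"
          by (auto intro!: ennreal_leI power_mono)
      qed
    qed simp
    finally show ?thesis .
  qed
  have diff: "sq_int M (\<lambda>x. f n x - g x) \<and> l2norm M (\<lambda>x. f n x - g x) \<le> e"
    if "0 < e" "\<And>m. m \<ge> n \<Longrightarrow> l2norm M (\<lambda>x. f n x - f m x) \<le> e" for e n
  proof -
    have k: "(\<integral>\<^sup>+x. ennreal ((cmod (f n x - g x))\<^sup>2) \<partial>M) \<le> ennreal (e\<^sup>2)"
      using that by (rule key)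
    also have "\<dots> < \<infinity>" by simp
    finally have i: "integrable M (\<lambda>x. (cmod (f n x - g x))\<^sup>2)"
      by (intro integrableI_nonneg) auto
    moreover have "(l2norm M (\<lambda>x. f n x - g x))\<^sup>2 \<le> e\<^sup>2"
    proof -
      have "ennreal (LINT x|M. (cmod (f n x - g x))\<^sup>2) \<le> ennreal (e\<^sup>2)"
        using k nn_integral_eq_integral[OF i] by simp
      then show ?thesis unfolding l2norm_sq by (simp add: ennreal_le_iff)
    qed
    ultimately show ?thesis
      using \<open>0 < e\<close> by (auto simp: sq_int_def intro: power2_le_imp_le)
  qed
  obtain N1 where N1: "\<And>m n. m \<ge> N1 \<Longrightarrow> n \<ge> N1 \<Longrightarrow> l2norm M (\<lambda>x. f m x - f n x) < 1"
    using cauchy[of 1] by auto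
  have "\<And>m. m \<ge> N1 \<Longrightarrow> l2norm M (\<lambda>x. f N1 x - f m x) \<le> 1"
    by (rule less_imp_le, rule N1) auto
  then have "sq_int M (\<lambda>x. f N1 x - g x)"
    using diff[of 1 N1] by simp
  then have "sq_int M (\<lambda>x. f N1 x - (f N1 x - g x))"
    by (rule sq_int_diff[OF f])
  then have g: "sq_int M g" by simp
  have "(\<lambda>n. l2norm M (\<lambda>x. f n x - g x)) \<longlonglongrightarrow> 0"
  proof (rule LIMSEQ_I)
    fix e :: real assume "0 < e"
    then obtain K where K: "\<And>m n. m \<ge> K \<Longrightarrow> n \<ge> K \<Longrightarrow> l2norm M (\<lambda>x. f m x - f n x) < e/2"
      using cauchy[of "e/2"] by auto
    have "l2norm M (\<lambda>x. f n x - g x) < e" if "n \<ge> K" for n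
    proof -
      have "l2norm M (\<lambda>x. f n x - f m x) \<le> e/2" if "m \<ge> n" for m
        using K[of n m] \<open>n \<ge> K\<close> that by linarith
      then have "l2norm M (\<lambda>x. f n x - g x) \<le> e/2"
        using diff[of "e/2" n] \<open>0 < e\<close> by simp
      then show ?thesis using \<open>0 < e\<close> by simp
    qed
    then show "\<exists>no. \<forall>n\<ge>no. norm (l2norm M (\<lambda>x. f n x - g x) - 0) < e" by auto
  qed
  with g show ?thesis by blast
qed

text \<open>Increments dominated by blocks of a convergent series make the partial sums Cauchy.
  Blocks start at 1 because the modes and the moments are numbered from 1.\<close>

lemma riesz_fischer_series:
  assumes S: "\<And>n::nat. sq_int M (S n)" and a: "summable a"
    and bd: "\<And>m n. 1 \<le> m \<Longrightarrow> m \<le> n \<Longrightarrow>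
      (l2norm M (\<lambda>x. S n x - S m x))\<^sup>2 \<le> K * (\<Sum>k\<in>{m..<n}. a k)" and K: "0 < K"
  shows "\<exists>g. sq_int M g \<and> (\<lambda>n. l2norm M (\<lambda>x. S n x - g x)) \<longlonglongrightarrow> 0"
proof (rule riesz_fischer[OF S])
  fix e :: real assume e: "0 < e"
  have "0 < e\<^sup>2 / K" using e K by simp
  with a obtain N where N: "\<And>m n. N \<le> m \<Longrightarrow> norm (\<Sum>k\<in>{m..<n}. a k) < e\<^sup>2 / K"
    unfolding summable_Cauchy by blast
  have *: "l2norm M (\<lambda>x. S n x - S m x) < e" if "Suc N \<le> m" "m \<le> n" for m n
  proof -
    have "(\<Sum>k\<in>{m..<n}. a k) < e\<^sup>2 / K" using N[of m n] that by simp
    then have "K * (\<Sum>k\<in>{m..<n}. a k) < e\<^sup>2" using K by (simp add: pos_less_divide_eq mult.commute)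
    then have "(l2norm M (\<lambda>x. S n x - S m x))\<^sup>2 < e\<^sup>2" using bd[of m n] that by linarith
    then show ?thesis using e by (rule power2_less_imp_less[OF _ less_imp_le])
  qed
  have "l2norm M (\<lambda>x. S m x - S n x) < e" if "Suc N \<le> m" "Suc N \<le> n" for m n
    using *[of m n] *[of n m] that l2norm_diff_commute[of M "S m" "S n"] by (cases "m \<le> n") auto
  then show "\<exists>N. \<forall>m\<ge>N. \<forall>n\<ge>N. l2norm M (\<lambda>x. S m x - S n x) < e" by blast
qed

section \<open>The entire function vanishing at the squares\<close>

text \<open>The entire function sin(w) / w is even, so it is a power series in z = w^2; working with
  z avoids choosing a branch of the square root.\<close>

definition sinc_ser :: "complex \<Rightarrow> complex" where
  "sinc_ser z = (\<Sum>n. ((-1)^n / fact (2*n+1)) * z^n)"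

lemma sinc_ser_sums: "(\<lambda>n. ((-1)^n / fact (2*n+1)) * w^(2*n)) sums sinc_ser (w\<^sup>2)"
  and sinc_ser_sq: "w * sinc_ser (w\<^sup>2) = sin w"
proof -
  have s: "(\<lambda>n. sin_coeff n *\<^sub>R w^n) sums sin w" by (rule sin_converges)
  have sm: "strict_mono (\<lambda>n::nat. 2*n+1)" by (simp add: strict_mono_def)
  have z: "sin_coeff n *\<^sub>R w^n = 0" if "n \<notin> range (\<lambda>n. 2*n+1)" for n
  proof -
    have "even n" using that by (metis oddE rangeI)
    then show ?thesis by (simp add: sin_coeff_def)
  qed
  have s2: "(\<lambda>n. sin_coeff (2*n+1) *\<^sub>R w^(2*n+1)) sums sin w"
    using sums_mono_reindex[of "\<lambda>n. 2*n+1" "\<lambda>n. sin_coeff n *\<^sub>R w^n"] s sm z by simp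
  have eq: "sin_coeff (2*n+1) *\<^sub>R w^(2*n+1) = w * (((-1)^n / fact (2*n+1)) * w^(2*n))" for n
    by (simp add: sin_coeff_def scaleR_conv_of_real)
  have sm2: "summable (\<lambda>n. ((-1)^n / fact (2*n+1)) * w^(2*n))"
  \<comment> \<open>The sine series is w times this one, so its convergence carries over by
    cancelling w, except at w = 0.\<close>
  proof (cases "w = 0")
    case True
    then have "(\<lambda>n. ((-1)^n / fact (2*n+1)) * w^(2*n)) = (\<lambda>n. if n = 0 then 1 else 0)"
      by (auto simp: fun_eq_iff)
    then show ?thesis by (simp only:) (rule summable_single)
  next
    case False
    have "summable (\<lambda>n. w * (((-1)^n / fact (2*n+1)) * w^(2*n)))"
      using s2 unfolding eq by (rule sums_summable)
    then show ?thesis using summable_cmult_iff[of w "\<lambda>n. ((-1)^n / fact (2*n+1)) * w^(2*n)"] False by blast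
  qed
  then show sums: "(\<lambda>n. ((-1)^n / fact (2*n+1)) * w^(2*n)) sums sinc_ser (w\<^sup>2)"
    unfolding sinc_ser_def power_mult[symmetric] by (rule summable_sums)
  have "(\<lambda>n. w * (((-1)^n / fact (2*n+1)) * w^(2*n))) sums (w * sinc_ser (w\<^sup>2))"
    using sums by (rule sums_mult)
  then show "w * sinc_ser (w\<^sup>2) = sin w"
    using s2 unfolding eq by (rule sums_unique2)
qed

lemma sinc_ser_0 [simp]: "sinc_ser 0 = 1"
  using powser_zero[of "\<lambda>n. (-1)^n / fact (2*n+1) :: complex"] by (simp add: sinc_ser_def)

lemma holomorphic_sinc_ser: "sinc_ser holomorphic_on UNIV"
proof -
  have "sinc_ser holomorphic_on ball 0 r" for r
  proof (rule power_series_holomorphic)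
    fix w :: complex
    show "(\<lambda>n. ((-1)^n / fact (2*n+1)) * (w - 0)^n) sums sinc_ser w"
      using sinc_ser_sums[of "csqrt w"] by (simp add: power_mult)
  qed
  then have "sinc_ser field_differentiable at z" for z
    by (rule holomorphic_on_imp_differentiable_at[of _ "ball 0 (cmod z + 1)"]) auto
  then show ?thesis by (simp add: holomorphic_on_def field_differentiable_at_within)
qed

text \<open>Mean value inequality along the segment from 0 to z, where the derivative cos is at most
  exp|Im z| in modulus. The extra factor |z| makes the later division by z harmless near 0.\<close>

lemma norm_sin_le_norm: "cmod (sin z) \<le> cmod z * exp \<bar>Im z\<bar>"
proof -
  have "cmod (sin z - sin 0) \<le> exp \<bar>Im z\<bar> * cmod (z - 0)"
  proof (rule field_differentiable_bound[of "closed_segment 0 z" sin cos])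
    fix u assume "u \<in> closed_segment 0 z"
    then obtain t where t: "0 \<le> t" "t \<le> 1" "u = t *\<^sub>R z" by (auto simp: in_segment)
    have "cmod (cos u) \<le> exp \<bar>Im u\<bar>"
      using cmod_cos_le_exp[of 1 u] by simp
    also have "\<dots> \<le> exp \<bar>Im z\<bar>"
      using t by (simp add: abs_mult mult_left_le_one_le)
    finally show "cmod (cos u) \<le> exp \<bar>Im z\<bar>" .
  qed (auto intro!: DERIV_subset[OF DERIV_sin])
  then show ?thesis by (simp add: mult.commute)
qed

lemma norm_sinc_ser_le: "cmod (sinc_ser (w\<^sup>2)) \<le> exp \<bar>Im w\<bar>"
proof (cases "w = 0")
  case False
  have "cmod w * cmod (sinc_ser (w\<^sup>2)) \<le> cmod w * exp \<bar>Im w\<bar>"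
    using norm_sin_le_norm[of w] unfolding sinc_ser_sq[symmetric] norm_mult .
  then show ?thesis using False by simp
qed simp

text \<open>The entire function \<open>sin (\<pi> \<surd>z) / (\<pi> \<surd>z)\<close>, whose zeros are the squares.\<close>

definition Phi :: "complex \<Rightarrow> complex" where "Phi z = sinc_ser (of_real (pi\<^sup>2) * z)"

lemma Phi_sq: "of_real pi * w * Phi (w\<^sup>2) = sin (of_real pi * w)"
  using sinc_ser_sq[of "of_real pi * w"] by (simp add: Phi_def power_mult_distrib)

lemma holomorphic_Phi: "Phi holomorphic_on UNIV"
  unfolding Phi_def
  by (rule holomorphic_on_compose_gen[OF _ holomorphic_sinc_ser, unfolded comp_def])
    (auto intro!: holomorphic_intros)

text \<open>Expressed through a square root w of the argument: the bound is 1 on the nonnegative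
  half line and \<open>exp (pi * sqrt x)\<close> at the point -x.\<close>

lemma norm_Phi_le: "cmod (Phi (w\<^sup>2)) \<le> exp (pi * \<bar>Im w\<bar>)"
  using norm_sinc_ser_le[of "of_real pi * w"] by (simp add: Phi_def power_mult_distrib abs_mult)

lemma Phi_square_zero:
  assumes "m \<ge> 1" shows "Phi ((of_nat m)\<^sup>2) = 0"
proof -
  have "sin (of_real pi * of_nat m :: complex) = of_real (sin (pi * real m))"
    using sin_of_real[of "pi * real m", where ?'a=complex] by simp
  also have "\<dots> = 0" by simp
  finally show ?thesis using Phi_sq[of "of_nat m"] assms by simp
qed

text \<open>Differentiate \<pi> w Phi(w^2) = sin(\<pi> w) at w = m, where Phi(m^2) = 0.\<close>

lemma deriv_Phi_square:
  assumes "m \<ge> 1" shows "deriv Phi ((of_nat m)\<^sup>2) = (-1)^m / (2 * (of_nat m)\<^sup>2)"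
proof -
  let ?m = "of_nat m :: complex"
  have D: "(Phi has_field_derivative deriv Phi z) (at z)" for z
    using holomorphic_Phi by (simp add: holomorphic_derivI)
  have "((\<lambda>w. of_real pi * w * Phi (w\<^sup>2)) has_field_derivative
      (of_real pi * Phi (?m\<^sup>2) + of_real pi * ?m * (deriv Phi (?m\<^sup>2) * (2 * ?m)))) (at ?m)"
    by (rule derivative_eq_intros DERIV_chain2[where f=Phi, OF D] refl | simp)+
  then have "((\<lambda>w. sin (of_real pi * w)) has_field_derivative
      (of_real pi * Phi (?m\<^sup>2) + of_real pi * ?m * (deriv Phi (?m\<^sup>2) * (2 * ?m)))) (at ?m)"
    by (simp only: Phi_sq)
  moreover have "((\<lambda>w. sin (of_real pi * w)) has_field_derivative (cos (of_real pi * ?m) * of_real pi)) (at ?m)"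
    by (auto intro!: derivative_eq_intros)
  ultimately have "of_real pi * Phi (?m\<^sup>2) + of_real pi * ?m * (deriv Phi (?m\<^sup>2) * (2 * ?m))
      = cos (of_real pi * ?m) * of_real pi"
    by (rule DERIV_unique)
  moreover have "cos (of_real pi * ?m) = of_real (cos (pi * real m))"
    using cos_of_real[of "pi * real m", where ?'a=complex] by simp
  moreover have "cos (pi * real m) = (-1)^m" by (simp add: mult.commute cos_npi)
  ultimately have "of_real pi * (deriv Phi (?m\<^sup>2) * (2 * ?m\<^sup>2)) = of_real pi * (-1)^m"
    using Phi_square_zero[OF assms] by (simp add: power2_eq_square algebra_simps)
  then have "deriv Phi (?m\<^sup>2) * (2 * ?m\<^sup>2) = (-1)^m" by simp
  then show ?thesis using assms by (simp add: field_simps)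
qed

text \<open>The Lagrange interpolation factor Phi(z) / (Phi'(m^2) (z - m^2)), with 1 / Phi'(m^2)
  written out and the removable singularity filled in.\<close>

definition Phi_quot :: "nat \<Rightarrow> complex \<Rightarrow> complex" where
  "Phi_quot m z = (-1)^m * (2 * (of_nat m)\<^sup>2) *
     (if z = (of_nat m)\<^sup>2 then deriv Phi z else Phi z / (z - (of_nat m)\<^sup>2))"

lemma holomorphic_Phi_quot:
  assumes "m \<ge> 1" shows "Phi_quot m holomorphic_on UNIV"
proof -
  have "(\<lambda>z. if z = (of_nat m)\<^sup>2 then deriv Phi ((of_nat m)\<^sup>2)
      else (Phi z - Phi ((of_nat m)\<^sup>2)) / (z - (of_nat m)\<^sup>2)) holomorphic_on UNIV"
    by (rule pole_lemma[OF holomorphic_Phi]) simp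
  also have "(\<lambda>z. if z = (of_nat m)\<^sup>2 then deriv Phi ((of_nat m)\<^sup>2)
      else (Phi z - Phi ((of_nat m)\<^sup>2)) / (z - (of_nat m)\<^sup>2))
    = (\<lambda>z. if z = (of_nat m)\<^sup>2 then deriv Phi z else Phi z / (z - (of_nat m)\<^sup>2))"
    using Phi_square_zero[OF assms] by auto
  finally show ?thesis unfolding Phi_quot_def by (intro holomorphic_intros)
qed

lemma Phi_quot_square:
  assumes "m \<ge> 1" "n \<ge> 1"
  shows "Phi_quot m ((of_nat n)\<^sup>2) = (if n = m then 1 else 0)"
proof -
  have "((of_nat n :: complex)\<^sup>2 = (of_nat m)\<^sup>2) = (n = m)"
    by (metis of_nat_eq_iff of_nat_power power2_eq_iff_nonneg zero_le)
  moreover have "(-1::complex)^m * (-1)^m = 1" by (simp flip: power_mult_distrib)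
  ultimately show ?thesis
    using assms by (auto simp: Phi_quot_def deriv_Phi_square Phi_square_zero)
qed

lemma norm_Phi_quot:
  assumes "z \<noteq> (of_nat m)\<^sup>2"
  shows "cmod (Phi_quot m z) = 2 * (real m)\<^sup>2 * cmod (Phi z) / cmod (z - (of_nat m)\<^sup>2)"
  using assms by (simp add: Phi_quot_def norm_mult norm_divide norm_power)

text \<open>The bound is uniform in m although 1 / Phi'(m^2) is of order m^2. With x = j^2, either
  j^2 is at most m^2 / 2 and the denominator is at least m^2 / 2, or m is at most a constant times j
  and the zero of sin(\<pi> j) at m cancels the factor j - m of the denominator.\<close>

lemma norm_Phi_quot_nonneg:
  assumes m: "m \<ge> 1" and x: "0 \<le> (x::real)"
  shows "cmod (Phi_quot m (of_real x)) \<le> 4"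
proof (cases "x = (real m)\<^sup>2")
  case True
  then show ?thesis using Phi_quot_square[OF m m] by simp
next
  case False
  define j where "j = sqrt x"
  have j: "0 \<le> j" "x = j\<^sup>2" using x by (auto simp: j_def)
  have jm: "j \<noteq> real m" using False j by auto
  have xm: "complex_of_real x \<noteq> (of_nat m)\<^sup>2"
    using False by (metis of_real_eq_iff of_real_of_nat_eq of_real_power)
  have d: "cmod (complex_of_real x - (of_nat m)\<^sup>2) = \<bar>j - m\<bar> * (j + m)"
  proof -
    have "complex_of_real x - (of_nat m)\<^sup>2 = of_real (j\<^sup>2 - (real m)\<^sup>2)" by (simp add: j(2))
    also have "j\<^sup>2 - (real m)\<^sup>2 = (j - m) * (j + m)" by (simp add: power2_eq_square algebra_simps)
    finally show ?thesis using j(1) by (simp add: abs_mult del: of_real_mult of_real_diff)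
  qed
  have P1: "cmod (Phi (of_real x)) \<le> 1"
    using norm_Phi_le[of "of_real j"] j by simp
  have eq: "cmod (Phi_quot m (of_real x)) = 2 * (real m)\<^sup>2 * cmod (Phi (of_real x)) / (\<bar>j - m\<bar> * (j + m))"
    by (simp add: norm_Phi_quot[OF xm] d)
  have pos: "0 < \<bar>j - m\<bar> * (j + m)" using j m jm by auto
  show ?thesis
  proof (cases "2 * j\<^sup>2 \<le> (real m)\<^sup>2")
    case True
    moreover have "0 < (real m)\<^sup>2" using m by simp
    ultimately have "j\<^sup>2 < (real m)\<^sup>2" by linarith
    then have "j < m" by (rule power2_less_imp_less) simp
    then have "\<bar>j - m\<bar> * (j + m) = (real m)\<^sup>2 - j\<^sup>2" by (simp add: power2_eq_square algebra_simps)
    then have "2 * (real m)\<^sup>2 * cmod (Phi (of_real x)) \<le> 4 * (\<bar>j - m\<bar> * (j + m))"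
      using True P1 mult_left_mono[OF P1, of "2 * (real m)\<^sup>2"] by simp
    then show ?thesis unfolding eq using pos by (simp add: pos_divide_le_eq)
  next
    case False
    then have jp: "0 < j" using j(1) by (cases "j = 0") auto
    \<comment> \<open>Quantitative form of the zero at j = m: translating the sine by m \<pi>
      changes at most its sign.\<close>
    have s: "\<bar>sin (pi * j)\<bar> \<le> pi * \<bar>j - m\<bar>"
    proof -
      have "sin (pi * (j - m)) = sin (pi * j) * cos (pi * m) - cos (pi * j) * sin (pi * m)"
        by (simp add: right_diff_distrib sin_diff)
      then have "\<bar>sin (pi * j)\<bar> = \<bar>sin (pi * (j - m))\<bar>"
        by (simp add: abs_mult cos_npi2)
      also have "\<dots> \<le> \<bar>pi * (j - m)\<bar>" by (rule abs_sin_x_le_abs_x)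
      finally show ?thesis by (simp add: abs_mult)
    qed
    have "pi * j * cmod (Phi (of_real x)) = \<bar>sin (pi * j)\<bar>"
    proof -
      have "cmod (of_real pi * of_real j * Phi (of_real x)) = cmod (sin (of_real pi * of_real j))"
        using Phi_sq[of "of_real j"] j(2) by simp
      also have "sin (of_real pi * of_real j) = complex_of_real (sin (pi * j))"
        by (simp flip: sin_of_real of_real_mult)
      finally show ?thesis using jp by (simp add: norm_mult)
    qed
    with s have "pi * (j * cmod (Phi (of_real x))) \<le> pi * \<bar>j - m\<bar>"
      by (simp add: mult.assoc)
    then have "j * cmod (Phi (of_real x)) \<le> \<bar>j - m\<bar>"
      by (rule mult_left_le_imp_le) simp
    then have "j * (j * cmod (Phi (of_real x))) \<le> j * \<bar>j - m\<bar>" using jp by simp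
    moreover have "(real m)\<^sup>2 * cmod (Phi (of_real x)) \<le> 2 * j\<^sup>2 * cmod (Phi (of_real x))"
      using False by (intro mult_right_mono) auto
    ultimately have "2 * (real m)\<^sup>2 * cmod (Phi (of_real x)) \<le> 4 * (j * \<bar>j - m\<bar>)"
      by (simp add: power2_eq_square mult.assoc)
    also have "\<dots> \<le> 4 * (\<bar>j - m\<bar> * (j + m))" by (simp add: algebra_simps)
    finally show ?thesis unfolding eq using pos by (simp add: pos_divide_le_eq)
  qed
qed

text \<open>Left of 0 the distance from x to m^2 is at least m^2 and absorbs the normalising factor;
  what remains is the growth of \<open>Phi\<close>.\<close>

lemma norm_Phi_quot_neg:
  assumes m: "m \<ge> 1" and x: "x < (0::real)"
  shows "cmod (Phi_quot m (of_real x)) \<le> 2 * exp (pi * sqrt (- x))"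
proof -
  have m2: "1 \<le> (real m)\<^sup>2" using m by simp
  have e: "complex_of_real x - (of_nat m)\<^sup>2 = of_real (x - (real m)\<^sup>2)" by simp
  have xm: "complex_of_real x \<noteq> (of_nat m)\<^sup>2"
    using e x m2 by (metis diff_eq_diff_eq diff_self less_le_trans of_real_eq_0_iff not_less order.asym zero_le_power2 right_minus_eq)
  have c: "cmod (complex_of_real x - (of_nat m)\<^sup>2) = - x + (real m)\<^sup>2"
    unfolding e norm_of_real using x m2 by simp
  have "cmod (Phi (of_real x)) \<le> exp (pi * sqrt (- x))"
  proof -
    have "(\<i> * of_real (sqrt (- x)))\<^sup>2 = - complex_of_real ((sqrt (- x))\<^sup>2)"
      by (simp only: power_mult_distrib i_squared of_real_power) simp
    also have "\<dots> = of_real x" using x by simp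
    finally show ?thesis using norm_Phi_le[of "\<i> * of_real (sqrt (- x))"] x by simp
  qed
  then have "(real m)\<^sup>2 * cmod (Phi (of_real x)) \<le> (- x + (real m)\<^sup>2) * exp (pi * sqrt (- x))"
    using x m2 by (intro mult_mono) (auto intro: order_trans[of x 0])
  moreover have "0 < - x + (real m)\<^sup>2" using x m2 by simp
  ultimately show ?thesis unfolding norm_Phi_quot[OF xm] c
    by (simp add: pos_divide_le_eq algebra_simps)
qed

section \<open>An oscillating multiplier\<close>

text \<open>At t = 1 and t = -1 division by zero makes the exponential 1, but the first factor
  vanishes there, so the value is 0, the limit from the closed upper half plane.\<close>

definition osc :: "real \<Rightarrow> complex \<Rightarrow> complex" where
  "osc b t = (1 - t\<^sup>2) * exp (2 * \<i> * of_real b * t / (1 - t\<^sup>2))"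

text \<open>The map t / (1 - t^2) preserves the closed upper half plane, because Im(t cnj(1 - t^2))
  = Im t (1 + |t|^2); hence the exponential has modulus at most 1 there.\<close>

lemma norm_osc_le:
  assumes b: "0 \<le> b" and t: "0 \<le> Im t"
  shows "cmod (osc b t) \<le> cmod (1 - t\<^sup>2)"
proof -
  have "0 \<le> Im (t / (1 - t\<^sup>2))"
  proof -
    have "Im (t * cnj (1 - t\<^sup>2)) = Im t * (1 + (Re t)\<^sup>2 + (Im t)\<^sup>2)"
      by (simp add: power2_eq_square algebra_simps)
    then have "0 \<le> Im (t * cnj (1 - t\<^sup>2))" using t by simp
    moreover have "Im (t / (1 - t\<^sup>2)) = Im (t * cnj (1 - t\<^sup>2)) / (cmod (1 - t\<^sup>2))\<^sup>2"
      by (subst complex_div_cnj) (simp only: Im_divide_of_real flip: of_real_power)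
    ultimately show ?thesis by simp
  qed
  then have "Re (2 * \<i> * of_real b * t / (1 - t\<^sup>2)) \<le> 0"
  proof -
    have "Re (of_real (2 * b) * (\<i> * w)) = - (2 * b * Im w)" for w by simp
    moreover have "2 * \<i> * of_real b * t / (1 - t\<^sup>2) = of_real (2 * b) * (\<i> * (t / (1 - t\<^sup>2)))" by simp
    ultimately have "Re (2 * \<i> * of_real b * t / (1 - t\<^sup>2)) = - (2 * b * Im (t / (1 - t\<^sup>2)))"
      by (simp only:)
    then show ?thesis using b \<open>0 \<le> Im (t / (1 - t\<^sup>2))\<close> by simp
  qed
  then have "cmod (exp (2 * \<i> * of_real b * t / (1 - t\<^sup>2))) \<le> 1" by simp
  then show ?thesis unfolding osc_def norm_mult by (rule mult_left_le) simp
qed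

lemma continuous_on_osc:
  assumes b: "0 \<le> b" shows "continuous_on {t. 0 \<le> Im t} (osc b)"
  unfolding continuous_on_eq_continuous_within
proof
  fix t :: complex assume t: "t \<in> {t. 0 \<le> Im t}"
  show "continuous (at t within {t. 0 \<le> Im t}) (osc b)"
  proof (cases "t\<^sup>2 = 1")
    case False
    then show ?thesis unfolding osc_def by (intro continuous_intros) auto
  next
    case True
    have "(osc b \<longlongrightarrow> 0) (at t within {t. 0 \<le> Im t})"
    proof (rule Lim_null_comparison)
      show "\<forall>\<^sub>F s in at t within {t. 0 \<le> Im t}. norm (osc b s) \<le> cmod (1 - s\<^sup>2)"
        unfolding eventually_at_filter using norm_osc_le[OF b] by (intro always_eventually) auto
      have "((\<lambda>s. cmod (1 - s\<^sup>2)) \<longlongrightarrow> cmod (1 - t\<^sup>2)) (at t within {t. 0 \<le> Im t})"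
        by (intro tendsto_intros)
      then show "((\<lambda>s. cmod (1 - s\<^sup>2)) \<longlongrightarrow> 0) (at t within {t. 0 \<le> Im t})" using True by simp
    qed
    then show ?thesis using True by (simp add: continuous_within osc_def)
  qed
qed

text \<open>On the unit circle 1 - t^2 = -2 i t sin x, so t / (1 - t^2) = i / (2 sin x) and the
  oscillating exponent turns into the real number - b / sin x. Where sin x = 0 both sides
  vanish.\<close>

lemma osc_cis:
  assumes "0 \<le> x" "x \<le> pi"
  shows "osc b (cis x) = - 2 * \<i> * of_real (sin x) * cis x * of_real (exp (- b / sin x))"
proof -
  have 1: "1 - (cis x)\<^sup>2 = - 2 * \<i> * of_real (sin x) * cis x"
    using sin_cos_squared_add[of x] by (simp add: complex_eq_iff power2_eq_square algebra_simps)
  show ?thesis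
  proof (cases "sin x = 0")
    case True then show ?thesis using 1 by (simp add: osc_def)
  next
    case False
    then have "2 * \<i> * of_real b * cis x / (1 - (cis x)\<^sup>2) = of_real (- b / sin x)"
      unfolding 1 by (simp add: field_simps)
    then show ?thesis unfolding osc_def by (simp only: 1 exp_of_real)
  qed
qed

definition osc_ft :: "real \<Rightarrow> complex \<Rightarrow> complex" where
  "osc_ft b z = integral {-1..1} (\<lambda>s. osc b (of_real s) * exp (- \<i> * z * of_real s))"

lemma continuous_on_osc_real:
  assumes b: "0 \<le> b" shows "continuous_on A (\<lambda>s. osc b (complex_of_real s))"
  using continuous_on_compose2[OF continuous_on_osc[OF b], of A complex_of_real]
  by (force intro!: continuous_intros)

lemma osc_ft_integrable:
  assumes b: "0 \<le> b"
  shows "(\<lambda>s. osc b (complex_of_real s) * exp (- \<i> * z * of_real s)) integrable_on {-1..1}"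
  by (intro integrable_continuous_real continuous_intros continuous_on_osc_real b)

lemma holomorphic_osc_ft:
  assumes b: "0 \<le> b" shows "osc_ft b holomorphic_on UNIV"
  unfolding osc_ft_def cbox_interval[symmetric]
proof (rule leibniz_rule_holomorphic)
  fix z s
  show "((\<lambda>z. osc b (of_real s) * exp (- \<i> * z * of_real s)) has_field_derivative
      (\<lambda>z s. osc b (of_real s) * (exp (- \<i> * z * of_real s) * (- \<i> * of_real s))) z s) (at z within UNIV)"
    by (auto intro!: derivative_eq_intros)
next
  fix z
  show "(\<lambda>s. osc b (of_real s) * exp (- \<i> * z * of_real s)) integrable_on cbox (-1) (1::real)"
    using osc_ft_integrable[OF b] by simp
next
  show "continuous_on (UNIV \<times> cbox (-1) (1::real))
     (\<lambda>(z, s). (\<lambda>z s. osc b (of_real s) * (exp (- \<i> * z * of_real s) * (- \<i> * of_real s))) z s)"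
    unfolding split_def
    by (intro continuous_intros continuous_on_compose2[OF continuous_on_osc_real[OF b, of UNIV]]) auto
qed simp

text \<open>The integrand is bounded by exp|Im z| on an interval of length 2. The transform thus has
  exponential type 1, which rescaling turns into type \<sigma>.\<close>

lemma norm_osc_ft_le:
  assumes b: "0 \<le> b" shows "cmod (osc_ft b z) \<le> 2 * exp \<bar>Im z\<bar>"
proof -
  have "cmod (osc_ft b z) \<le> exp \<bar>Im z\<bar> * (1 - (-1))"
    unfolding osc_ft_def
  proof (rule integral_bound)
    show "continuous_on {-1..1} (\<lambda>s. osc b (complex_of_real s) * exp (- \<i> * z * of_real s))"
      by (intro continuous_intros continuous_on_osc_real b)
    fix s :: real assume s: "s \<in> {-1..1}"
    have "cmod (osc b (of_real s)) \<le> cmod (1 - (complex_of_real s)\<^sup>2)"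
      by (rule norm_osc_le[OF b]) simp
    also have "\<dots> = \<bar>1 - s\<^sup>2\<bar>" by (metis norm_of_real of_real_1 of_real_diff of_real_power)
    also have "\<dots> \<le> 1" using s by (simp add: abs_le_iff power2_le_iff_abs_le abs_square_le_1)
    finally have 1: "cmod (osc b (of_real s)) \<le> 1" .
    have "Im z * s \<le> \<bar>Im z\<bar> * \<bar>s\<bar>" by (metis abs_ge_self abs_mult)
    also have "\<dots> \<le> \<bar>Im z\<bar>" using s by (intro mult_left_le) auto
    finally have "cmod (exp (- \<i> * z * of_real s)) \<le> exp \<bar>Im z\<bar>" by simp
    with 1 show "norm (osc b (of_real s) * exp (- \<i> * z * of_real s)) \<le> exp \<bar>Im z\<bar>"
      unfolding norm_mult using mult_mono[OF 1, of "cmod (exp (- \<i> * z * of_real s))" "exp \<bar>Im z\<bar>"] by simp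
  qed simp
  then show ?thesis by simp
qed

text \<open>On the upper unit semicircle the oscillating factor becomes the real exponential
  \<open>exp (- b / sin x)\<close>; deforming \<open>[-1, 1]\<close> into it exhibits the size of the transform.\<close>

lemma osc_ft_semicircle:
  assumes b: "0 \<le> b"
  shows "((\<lambda>x. - 2 * of_real (sin x * exp (- b / sin x)) * cis (2 * x) * exp (- \<i> * z * cis x))
     has_integral osc_ft b z) {0..pi}"
proof -
  let ?f = "\<lambda>t. osc b t * exp (- \<i> * z * t)"
  let ?S = "{t::complex. 0 \<le> Im t}"
  let ?arc = "part_circlepath 0 1 0 pi" and ?l = "linepath (-1) (1::complex)"
  have cont: "continuous_on ?S ?f" by (intro continuous_intros continuous_on_osc b)
  have sub: "path_image (?l +++ ?arc) \<subseteq> ?S"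
  proof -
    have "path_image ?l \<subseteq> ?S" by (auto simp: in_segment path_image_def linepath_def)
    moreover have "path_image ?arc \<subseteq> ?S"
      by (auto simp: path_image_part_circlepath cis_conv_exp[symmetric] intro!: sin_ge_zero)
    ultimately show ?thesis by (auto simp: path_image_join)
  qed
  have "(?f has_contour_integral 0) (?l +++ ?arc)"
  \<comment> \<open>The singularities at 1 and -1 lie on the boundary of the half plane. Cauchy's
    theorem is therefore applied in the form that asks for holomorphy inside a convex set and
    continuity up to its boundary.\<close>
  proof (rule Cauchy_theorem_convex[where K="{}", OF cont])
    show "convex ?S" by (rule convex_halfspace_Im_ge)
    have "?f holomorphic_on {t. 0 < Im t}"
      unfolding osc_def
    proof (intro holomorphic_intros)
      fix t assume "t \<in> {t. 0 < Im t}"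
      then have "0 < Im t * Im t" by simp
      then show "1 - t\<^sup>2 \<noteq> 0"
        by (auto simp: complex_eq_iff power2_eq_square)
    qed
    moreover have "interior ?S = {t. 0 < Im t}"
      using interior_halfspace_ge[of \<i> 0] by (simp add: inner_complex_def)
    ultimately show "\<And>t. t \<in> interior ?S - {} \<Longrightarrow> ?f field_differentiable at t"
      using holomorphic_on_imp_differentiable_at open_halfspace_Im_gt by auto
  qed (use sub in \<open>auto intro!: valid_path_join\<close>)
  moreover have "(?f has_contour_integral osc_ft b z) ?l"
    using has_contour_integral_linepath_Reals_iff[of "-1" 1 ?f "osc_ft b z"]
      integrable_integral[OF osc_ft_integrable[OF b, of z]]
    unfolding osc_ft_def by simp
  moreover obtain I where I: "(?f has_contour_integral I) ?arc"
  proof -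
    have "?f contour_integrable_on ?arc"
      using sub cont
      by (intro contour_integrable_continuous_part_circlepath continuous_on_subset[OF cont])
         (auto simp: path_image_join)
    then show ?thesis using that by (auto simp: contour_integrable_on_def)
  qed
  ultimately have "osc_ft b z + I = 0"
    using has_contour_integral_join[of ?f "osc_ft b z" ?l I ?arc]
    by (metis contour_integral_unique valid_path_linepath valid_path_part_circlepath)
  then have I': "- I = osc_ft b z" by (intro minus_unique) (simp add: add.commute)
  have "((\<lambda>x. ?f (0 + of_real 1 * cis x) * of_real 1 * \<i> * cis x) has_integral I) {0..pi}"
    using I by (subst has_contour_integral_part_circlepath_iff[symmetric]) auto
  then have "((\<lambda>x. - (?f (0 + of_real 1 * cis x) * of_real 1 * \<i> * cis x)) has_integral osc_ft b z) {0..pi}"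
    unfolding I'[symmetric] by (rule has_integral_neg)
  then show ?thesis
  proof (rule has_integral_eq[rotated])
    fix x assume x: "x \<in> {0..pi}"
    have "cis (2 * x) = cis x * cis x" by (simp add: cis_mult)
    then show "- (?f (0 + of_real 1 * cis x) * of_real 1 * \<i> * cis x) =
      - 2 * of_real (sin x * exp (- b / sin x)) * cis (2 * x) * exp (- \<i> * z * cis x)"
      using x by (simp add: osc_cis exp_of_real algebra_simps)
  qed
qed

text \<open>On the semicircle the exponent is at most |Im z| - (b / sin x + |Re z| sin x), and the
  bracket is at least 2 sqrt(b |Re z|), a bound independent of x.\<close>

lemma norm_osc_ft_left:
  assumes b: "0 \<le> b" and z: "Re z \<le> 0"
  shows "cmod (osc_ft b z) \<le> 2 * pi * exp (\<bar>Im z\<bar> - 2 * sqrt (b * - Re z))"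
proof -
  let ?B = "2 * exp (\<bar>Im z\<bar> - 2 * sqrt (b * - Re z))"
  have "cmod (osc_ft b z) \<le> ?B * measure lborel (cbox 0 pi)"
  proof (rule has_integral_bound[rotated])
    show "((\<lambda>x. - 2 * of_real (sin x * exp (- b / sin x)) * cis (2 * x) * exp (- \<i> * z * cis x))
     has_integral osc_ft b z) (cbox 0 pi)"
      using osc_ft_semicircle[OF b] by simp
    fix x assume "x \<in> cbox 0 pi"
    then have s: "0 \<le> sin x" by (auto intro: sin_ge_zero)
    show "norm (- 2 * of_real (sin x * exp (- b / sin x)) * cis (2 * x) * exp (- \<i> * z * cis x)) \<le> ?B"
    proof (cases "sin x = 0")
      case True then show ?thesis by simp
    next
      case False
      then have sp: "0 < sin x" using s by simp
      have "Im z * cos x \<le> \<bar>Im z\<bar> * \<bar>cos x\<bar>" by (metis abs_ge_self abs_mult)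
      also have "\<dots> \<le> \<bar>Im z\<bar>" by (intro mult_left_le) auto
      finally have 1: "Im z * cos x \<le> \<bar>Im z\<bar>" .
      have "sqrt (b * - Re z) = sqrt (b / sin x) * sqrt (- Re z * sin x)"
        using sp by (simp flip: real_sqrt_mult)
      then have 2: "2 * sqrt (b * - Re z) \<le> b / sin x + (- Re z * sin x)"
        using sum_squares_bound[of "sqrt (b / sin x)" "sqrt (- Re z * sin x)"] b z sp
        by (simp add: mult_nonpos_nonneg)
      have "norm (- 2 * of_real (sin x * exp (- b / sin x)) * cis (2 * x) * exp (- \<i> * z * cis x))
        = 2 * sin x * (exp (- b / sin x) * exp (Re z * sin x + Im z * cos x))"
        using sp by (simp add: norm_mult abs_mult)
      also have "\<dots> \<le> 2 * 1 * exp (\<bar>Im z\<bar> - 2 * sqrt (b * - Re z))"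
        using 1 2 sp by (intro mult_mono) (auto simp flip: exp_add)
      finally show ?thesis by simp
    qed
  qed simp
  then show ?thesis by (simp add: mult_ac)
qed

text \<open>Laplace-type estimate: the real part of the semicircle integrand is positive for sin^2 x
  > 1/2 and peaks at \<pi>/2. Where sin^2 x < 1/2 it is negative, but only of order exp(-1.4 b),
  which is negligible against exp(-1.03 b) once b is at least 10.\<close>

lemma osc_ft_0_lower:
  assumes b: "10 \<le> b"
  shows "exp (- (103/100) * b) / 10 \<le> cmod (osc_ft b 0)"
proof -
  define u where "u = exp (- (103/100) * b)"
  define v where "v = exp (- (14/10) * b)"
  have u0: "0 < u" by (simp add: u_def)
  \<comment> \<open>On this window sin x is at least 0.98, and 1 / 0.98 < 1.03 is the origin of the
    factor 103/100.\<close>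
  let ?J = "{pi/2 - 1/5..pi/2 + 1/5}"
  let ?g = "\<lambda>x. 2 * sin x * (2 * (sin x)\<^sup>2 - 1) * exp (- b / sin x)"
  have "((\<lambda>x. Re (- 2 * of_real (sin x * exp (- b / sin x)) * cis (2 * x) * exp (- \<i> * 0 * cis x)))
      has_integral Re (osc_ft b 0)) {0..pi}"
    using b by (intro has_integral_Re osc_ft_semicircle) simp
  then have I: "(?g has_integral Re (osc_ft b 0)) {0..pi}"
  proof (rule has_integral_eq[rotated])
    fix x :: real
    have c: "cos (2 * x) = 1 - 2 * (sin x)\<^sup>2" by (rule cos_double_sin)
    have "Re (- 2 * of_real r * cis (2 * x) * exp (- \<i> * 0 * cis x)) = - 2 * r * cos (2 * x)" for r
      by simp
    also have "- 2 * (sin x * exp (- b / sin x)) * cos (2 * x) = ?g x"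
      unfolding c by (simp add: algebra_simps)
    finally show "Re (- 2 * of_real (sin x * exp (- b / sin x)) * cis (2 * x) * exp (- \<i> * 0 * cis x)) = ?g x" .
  qed
  have near: "98/100 \<le> sin x" if "x \<in> ?J" for x
  proof -
    define y where "y = x - pi/2"
    have "\<bar>sin (y/2)\<bar> \<le> \<bar>y/2\<bar>" by (rule abs_sin_x_le_abs_x)
    also have "\<dots> \<le> 1/10" using that unfolding y_def abs_le_iff by auto
    finally have "(sin (y/2))\<^sup>2 \<le> (1/10)\<^sup>2" by (simp add: abs_le_square_iff[symmetric])
    moreover have "cos y = 1 - 2 * (sin (y/2))\<^sup>2"
      using cos_double_sin[of "y/2"] by simp
    moreover have "cos y = sin x" by (simp add: y_def cos_diff)
    ultimately show ?thesis by (simp add: power2_eq_square)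
  qed
  have low: "(if x \<in> ?J then 17/10 * u else 0) - 2 * v \<le> ?g x" if "x \<in> {0..pi}" for x
  proof -
    define s where "s = sin x"
    have s: "0 \<le> s" "s \<le> 1" using that by (auto simp: s_def intro: sin_ge_zero)
    have v0: "0 < v" by (simp add: v_def)
    show ?thesis
    proof (cases "x \<in> ?J")
      case True
      have s98: "98/100 \<le> s" using near[OF True] by (simp add: s_def)
      have "b / s \<le> (103/100) * b"
      proof -
        have "b * 1 \<le> b * ((103/100) * s)" using s98 b by (intro mult_left_mono) auto
        then show ?thesis using s98 by (simp add: pos_divide_le_eq mult_ac)
      qed
      then have u: "u \<le> exp (- b / s)" by (simp add: u_def)
      have "(98/100)\<^sup>2 \<le> s\<^sup>2" using s98 by (intro power_mono) auto
      then have "(92/100) \<le> 2 * s\<^sup>2 - 1" by (simp add: power2_eq_square)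
      then have "(196/100) * (92/100) \<le> 2 * s * (2 * s\<^sup>2 - 1)"
        using s98 by (intro mult_mono) auto
      then have "17/10 \<le> 2 * s * (2 * s\<^sup>2 - 1)" by simp
      then have "17/10 * u \<le> 2 * s * (2 * s\<^sup>2 - 1) * exp (- b / s)"
        using u u0 by (intro mult_mono) auto
      then show ?thesis using True v0 by (simp add: s_def)
    next
      case False
      have "- (2 * v) \<le> 2 * s * (2 * s\<^sup>2 - 1) * exp (- b / s)"
      proof (cases "1 \<le> 2 * s\<^sup>2 \<or> s = 0")
        case True
        then have "0 \<le> 2 * s * (2 * s\<^sup>2 - 1) * exp (- b / s)" using s by auto
        then show ?thesis using v0 by linarith
      next
        case False
        then have sp: "0 < s" and s2: "2 * s\<^sup>2 < 1" using s by auto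
        \<comment> \<open>10/14 lies just above 1 / sqrt 2, so -b / s is at most -1.4 b wherever the
          integrand is negative.\<close>
        have "s\<^sup>2 < (10/14)\<^sup>2" using s2 by (simp add: power2_eq_square)
        then have "s < 10/14" by (rule power2_less_imp_less) simp
        then have "b * ((14/10) * s) \<le> b * 1" using b by (intro mult_left_mono) auto
        then have "(14/10) * b \<le> b / s" using sp by (simp add: pos_le_divide_eq mult_ac)
        then have e: "exp (- b / s) \<le> v" by (simp add: v_def)
        have "s * (1 - 2 * s\<^sup>2) \<le> 1 * 1" using s s2 by (intro mult_mono) auto
        then have "2 * s * (1 - 2 * s\<^sup>2) * exp (- b / s) \<le> 2 * v"
          using e s s2 v0 by (intro mult_mono) auto
        then show ?thesis by (simp add: algebra_simps)
      qed
      then show ?thesis unfolding if_not_P[OF False] s_def by linarith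
    qed
  qed
  have pi4: "pi < 4" "2 < pi" using pi_less_4 pi_gt3 by auto
  have "((\<lambda>x. 17/10 * u) has_integral 17/10 * u * (2/5)) ?J"
    using has_integral_const_real[of "17/10 * u" "pi/2 - 1/5" "pi/2 + 1/5"] by simp
  then have "((\<lambda>x. if x \<in> ?J then 17/10 * u else 0) has_integral 17/10 * u * (2/5)) {0..pi}"
    using pi4 by (subst has_integral_restrict) auto
  moreover have "((\<lambda>x. 2 * v) has_integral (pi * (2 * v))) {0..pi}"
    using has_integral_const_real[of "2 * v" 0 pi] by simp
  ultimately have "((\<lambda>x. (if x \<in> ?J then 17/10 * u else 0) - 2 * v) has_integral
      17/10 * u * (2/5) - pi * (2 * v)) {0..pi}"
    by (rule has_integral_diff)
  then have le: "17/10 * u * (2/5) - pi * (2 * v) \<le> Re (osc_ft b 0)"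
    using I low by (rule has_integral_le)
  \<comment> \<open>The gap 1.4 - 1.03 = 0.37 and b \<ge> 10 give a ratio of at least exp 3.7, which
    is bounded below by (1 + 3.7/8)^8 > 20. The main part 0.68 u then exceeds the loss 8 v by more
    than u / 10.\<close>
  have "v * 20 \<le> u"
  proof -
    have "(20::real) \<le> (117/80) ^ 8" by (simp add: power_divide)
    also have "\<dots> \<le> exp (37/10)" using exp_ge_one_plus_x_over_n_power_n[of 8 "37/10"] by simp
    also have "\<dots> \<le> exp ((37/100) * b)" using b by simp
    finally have "v * 20 \<le> v * exp ((37/100) * b)" by (intro mult_left_mono) (auto simp: v_def)
    also have "\<dots> = u" by (simp add: u_def v_def flip: exp_add)
    finally show ?thesis .
  qed
  moreover have "pi * (2 * v) \<le> 4 * (2 * v)" using pi4 by (intro mult_right_mono) (auto simp: v_def)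
  ultimately have "u / 10 \<le> Re (osc_ft b 0)" using le u0 by linarith
  also have "\<dots> \<le> cmod (osc_ft b 0)" by (rule complex_Re_le_cmod)
  finally show ?thesis by (simp add: u_def)
qed

section \<open>Biorthogonal functions on the Fourier side\<close>

text \<open>Companion of \<open>norm_sinc_ser_le\<close> for large w; its square provides the
  quadratic decay behind the absolutely convergent Fourier series in time.\<close>

lemma norm_sinc_ser_decay:
  assumes "w \<noteq> 0" shows "cmod (sinc_ser (w\<^sup>2)) \<le> exp \<bar>Im w\<bar> / cmod w"
proof -
  have "cmod w * cmod (sinc_ser (w\<^sup>2)) \<le> exp \<bar>Im w\<bar>"
    using cmod_sin_le_exp[of 1 w] unfolding norm_mult[symmetric] sinc_ser_sq by simp
  then show ?thesis using assms by (simp add: pos_le_divide_eq mult.commute)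
qed

text \<open>The parameters \<open>b\<close> and \<open>\<sigma>\<close> of the oscillating multiplier satisfy \<open>b \<sigma> = \<pi>\<^sup>2 / 4\<close>, which
  makes it decay as \<open>exp (- \<pi> \<surd>\<bar>x\<bar>)\<close> on the negative half line, the growth rate of \<open>Phi\<close>;
  the types \<open>\<sigma>\<close>, \<open>2\<epsilon>\<close> (squared sinc) and \<open>\<epsilon>\<close> (reserve for \<open>Phi\<close>) add up to \<open>\<tau>\<close>.\<close>

definition mult_b :: "real \<Rightarrow> real" where "mult_b \<tau> = 25 * pi\<^sup>2 / (94 * \<tau>)"

text \<open>Here \<sigma> = 47/50 \<tau> and \<epsilon> = \<tau>/50. Both multipliers are centred at
  m^2, where they equal 1, so the values at the squares are those of
  \<open>Phi_quot\<close>.\<close>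

definition biorth :: "real \<Rightarrow> nat \<Rightarrow> complex \<Rightarrow> complex" where
  "biorth \<tau> m z = Phi_quot m z *
     (osc_ft (mult_b \<tau>) (of_real (47/50 * \<tau>) * (z - (of_nat m)\<^sup>2)) / osc_ft (mult_b \<tau>) 0) *
     (sinc_ser ((of_real (\<tau>/50) * (z - (of_nat m)\<^sup>2))\<^sup>2))\<^sup>2"

lemma mult_b:
  assumes "0 < \<tau>"
  shows "0 < mult_b \<tau>" "mult_b \<tau> * (47/50 * \<tau> * x) = (pi/2)\<^sup>2 * x"
  using assms by (auto simp: mult_b_def power2_eq_square field_simps)

lemma sqrt_mult_b:
  assumes "0 < \<tau>" shows "2 * sqrt (mult_b \<tau> * (47/50 * \<tau> * x)) = pi * sqrt x"
  unfolding mult_b(2)[OF assms] by (simp add: real_sqrt_mult)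

text \<open>The multiplier is divided by its value at the node, hence the hypothesis
  \<open>nz\<close>; \<open>osc_ft_0_lower\<close> supplies it for small \<tau>.\<close>

context
  fixes \<tau> :: real and m :: nat
  assumes \<tau>: "0 < \<tau>" "\<tau> \<le> 1" and m: "1 \<le> m" and nz: "osc_ft (mult_b \<tau>) 0 \<noteq> 0"
begin

lemma holomorphic_biorth: "biorth \<tau> m holomorphic_on UNIV"
proof -
  have 1: "(\<lambda>z. osc_ft (mult_b \<tau>) (of_real (47/50 * \<tau>) * (z - (of_nat m)\<^sup>2))) holomorphic_on UNIV"
    using mult_b(1)[OF \<tau>(1)]
    by (intro holomorphic_on_compose_gen[OF _ holomorphic_osc_ft, unfolded comp_def])
      (auto intro!: holomorphic_intros)
  have 2: "(\<lambda>z. sinc_ser ((of_real (\<tau>/50) * (z - (of_nat m)\<^sup>2))\<^sup>2)) holomorphic_on UNIV"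
    by (rule holomorphic_on_compose_gen[OF _ holomorphic_sinc_ser, unfolded comp_def])
      (auto intro!: holomorphic_intros)
  show ?thesis unfolding biorth_def
    using nz by (intro holomorphic_intros holomorphic_Phi_quot m 1 2)
qed

lemma biorth_square:
  assumes "1 \<le> n" shows "biorth \<tau> m ((of_nat n)\<^sup>2) = (if n = m then 1 else 0)"
  using Phi_quot_square[OF m assms] nz by (simp add: biorth_def)

text \<open>On the negative half line the growth exp(\<pi> sqrt|x|) of \<open>Phi_quot\<close> is
  met by the decay of the multiplier, which is evaluated at x - m^2, even further to the left; on
  the nonnegative half line both factors are bounded. The squared sinc adds decay in x - m^2. The
  constant is uniform in m, as the Schur test requires.\<close>

lemma biorth_integer_bound:
  fixes x :: real
  shows "cmod (biorth \<tau> m (of_real x)) \<le>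
    80000 / (\<tau>\<^sup>2 * cmod (osc_ft (mult_b \<tau>) 0)) / (1 + (x - (real m)\<^sup>2)\<^sup>2)"
proof -
  define d where "d = x - (real m)\<^sup>2"
  define H where "H = cmod (osc_ft (mult_b \<tau>) 0)"
  have H: "0 < H" using nz by (simp add: H_def)
  have zd: "complex_of_real x - (of_nat m)\<^sup>2 = of_real d" by (simp add: d_def)
  \<comment> \<open>Combine |sinc| \<le> 1 near the node with |sinc| \<le> 50 / (\<tau> |d|) away
    from it; 5000 covers 2500 + 1, as \<tau> \<le> 1.\<close>
  have s: "(cmod (sinc_ser ((of_real (\<tau>/50) * of_real d)\<^sup>2)))\<^sup>2 \<le> (5000 / \<tau>\<^sup>2) / (1 + d\<^sup>2)"
  proof -
    let ?w = "complex_of_real (\<tau>/50) * of_real d"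
    define S where "S = cmod (sinc_ser (?w\<^sup>2))"
    have "S \<le> 1" unfolding S_def using norm_sinc_ser_le[of ?w] by simp
    then have S1: "S\<^sup>2 \<le> 1" by (simp add: S_def abs_square_le_1)
    have "S * cmod ?w \<le> 1"
      using norm_sinc_ser_decay[of ?w] \<tau> by (cases "d = 0") (auto simp: S_def pos_le_divide_eq)
    then have "(S * cmod ?w)\<^sup>2 \<le> 1" by (simp add: S_def abs_square_le_1)
    then have "S\<^sup>2 * (\<tau>\<^sup>2 * d\<^sup>2) \<le> 2500"
      by (simp add: norm_mult power_mult_distrib power_divide field_simps)
    moreover have "S\<^sup>2 * \<tau>\<^sup>2 \<le> 1 * 1"
      using S1 \<tau> by (intro mult_mono) (auto simp: power_le_one)
    ultimately have "S\<^sup>2 * (\<tau>\<^sup>2 * (1 + d\<^sup>2)) \<le> 5000" by (simp add: algebra_simps)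
    moreover have "0 < \<tau>\<^sup>2 * (1 + d\<^sup>2)" using \<tau> by (intro mult_pos_pos) (auto intro: add_pos_nonneg)
    ultimately have "S\<^sup>2 \<le> 5000 / (\<tau>\<^sup>2 * (1 + d\<^sup>2))" by (simp add: pos_le_divide_eq)
    then show ?thesis by (simp add: S_def)
  qed
  let ?h = "osc_ft (mult_b \<tau>) (of_real (47/50 * \<tau>) * of_real d)"
  have h: "cmod (Phi_quot m (of_real x)) * cmod ?h \<le> 16"
  proof (cases "0 \<le> x")
    case True
    have "cmod ?h \<le> 2"
      using norm_osc_ft_le[of "mult_b \<tau>" "of_real (47/50 * \<tau>) * of_real d"] mult_b(1)[OF \<tau>(1)] by simp
    then have "cmod (Phi_quot m (of_real x)) * cmod ?h \<le> 4 * 2"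
      using norm_Phi_quot_nonneg[OF m True] by (intro mult_mono) auto
    then show ?thesis by simp
  next
    case False
    have d0: "d \<le> x" "d \<le> 0" using False by (auto simp: d_def intro: order_trans[of x 0])
    have "cmod ?h \<le> 2 * pi * exp (- 2 * sqrt (mult_b \<tau> * (47/50 * \<tau> * - d)))"
      using norm_osc_ft_left[of "mult_b \<tau>" "of_real (47/50 * \<tau>) * of_real d"] mult_b(1)[OF \<tau>(1)] d0 \<tau>
      by (simp add: mult_nonneg_nonpos)
    also have "- 2 * sqrt (mult_b \<tau> * (47/50 * \<tau> * - d)) = - (pi * sqrt (- d))"
      using sqrt_mult_b[OF \<tau>(1), of "- d"] by simp
    also have "2 * pi * exp (- (pi * sqrt (- d))) \<le> 8 * exp (- (pi * sqrt (- x)))"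
      using pi_less_4 d0 by (intro mult_mono) auto
    finally have "cmod (Phi_quot m (of_real x)) * cmod ?h \<le> (2 * exp (pi * sqrt (- x))) * (8 * exp (- (pi * sqrt (- x))))"
      using norm_Phi_quot_neg[OF m, of x] False by (intro mult_mono) auto
    then show ?thesis by (simp add: exp_minus field_simps)
  qed
  have "cmod (biorth \<tau> m (of_real x)) = (cmod (Phi_quot m (of_real x)) * cmod ?h) *
     (cmod (sinc_ser ((of_real (\<tau>/50) * of_real d)\<^sup>2)))\<^sup>2 / H"
    unfolding biorth_def zd H_def by (simp add: norm_mult norm_divide norm_power)
  also have "\<dots> \<le> 16 * ((5000 / \<tau>\<^sup>2) / (1 + d\<^sup>2)) / H"
    using h s H by (intro divide_right_mono mult_mono) auto
  also have "\<dots> = 80000 / (\<tau>\<^sup>2 * H) / (1 + d\<^sup>2)" by simp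
  finally show ?thesis by (simp add: H_def d_def)
qed

text \<open>The constant may depend on m and \<tau>, because only the vanishing of a limit is drawn
  from it. Off the real axis \<open>Phi\<close> grows by an extra factor exp(\<pi> sqrt|Im z|), paid
  for by \<epsilon> |Im z| in the exponent and a constant factor.\<close>

lemma biorth_type_bound:
  shows "\<exists>C\<ge>0. \<forall>z. 1 \<le> cmod (z - of_real ((real m)\<^sup>2)) \<longrightarrow>
     cmod (biorth \<tau> m z) \<le> C * exp (\<tau> * \<bar>Im z\<bar>) / (cmod (z - of_real ((real m)\<^sup>2)))\<^sup>2"
proof -
  define H where "H = cmod (osc_ft (mult_b \<tau>) 0)"
  have H: "0 < H" using nz by (simp add: H_def)
  define e where "e = \<tau> / 50"
  have e: "0 < e" using \<tau> by (simp add: e_def)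
  define C where "C = 2 * (real m)\<^sup>2 * (8 * exp (pi\<^sup>2 / (4 * e))) / (e\<^sup>2 * H)"
  have C0: "0 \<le> C" using e H by (simp add: C_def)
  have "cmod (biorth \<tau> m z) \<le> C * exp (\<tau> * \<bar>Im z\<bar>) / (cmod (z - of_real ((real m)\<^sup>2)))\<^sup>2"
    if z1: "1 \<le> cmod (z - of_real ((real m)\<^sup>2))" for z
  proof -
    define D where "D = z - (of_nat m)\<^sup>2"
    have zD: "z - of_real ((real m)\<^sup>2) = D" by (simp add: D_def)
    have D1: "1 \<le> cmod D" using z1 zD by simp
    define y where "y = \<bar>Im z\<bar>"
    have y0: "0 \<le> y" by (simp add: y_def)
    have ImD: "Im D = Im z" by (simp add: D_def flip: of_nat_power)
    have ReD: "Re D = Re z - (real m)\<^sup>2" by (simp add: D_def flip: of_nat_power)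
    let ?h = "osc_ft (mult_b \<tau>) (of_real (47/50 * \<tau>) * D)"
    have Imh: "\<bar>Im (of_real (47/50 * \<tau>) * D)\<bar> = 47/50 * \<tau> * y"
      using \<tau> by (simp add: ImD y_def abs_mult)
    have Reh: "Re (of_real (47/50 * \<tau>) * D) = 47/50 * \<tau> * Re D" by simp
    define w where "w = csqrt z"
    have w: "z = w\<^sup>2" by (simp add: w_def)
    have imw: "(Im w)\<^sup>2 = (cmod z - Re z) / 2"
    proof -
      have "cmod z = (Re w)\<^sup>2 + (Im w)\<^sup>2" by (simp add: w norm_power cmod_power2)
      moreover have "Re z = (Re w)\<^sup>2 - (Im w)\<^sup>2" by (simp add: w power2_eq_square)
      ultimately show ?thesis by simp
    qed
    have cz: "cmod z \<le> \<bar>Re z\<bar> + y" unfolding y_def by (rule cmod_le)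
    \<comment> \<open>Arithmetic-geometric mean inequality: a square root of y costs a small
      multiple of y plus a constant.\<close>
    have am: "pi * sqrt y \<le> e * y + pi\<^sup>2 / (4 * e)"
    proof -
      have "2 * (sqrt e * sqrt y) * (pi / (2 * sqrt e)) \<le> (sqrt e * sqrt y)\<^sup>2 + (pi / (2 * sqrt e))\<^sup>2"
        by (rule sum_squares_bound)
      then show ?thesis using e y0 by (simp add: power_mult_distrib power_divide mult.commute)
    qed
    have Ph: "cmod (Phi z) * cmod ?h \<le> 8 * exp (pi\<^sup>2 / (4 * e)) * exp ((47/50 * \<tau> + e) * y)"
    proof (cases "0 \<le> Re z")
      case True
      then have "(Im w)\<^sup>2 \<le> y" using imw cz y0 by (simp add: abs_if split: if_splits)
      then have "\<bar>Im w\<bar> \<le> sqrt y" using real_le_rsqrt[of "\<bar>Im w\<bar>" y] by simp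
      then have "pi * \<bar>Im w\<bar> \<le> pi * sqrt y" by simp
      then have "cmod (Phi z) \<le> exp (pi * sqrt y)"
        using norm_Phi_le[of w] w by (metis exp_le_cancel_iff order_trans)
      moreover have "cmod ?h \<le> 2 * exp (47/50 * \<tau> * y)"
        using norm_osc_ft_le[of "mult_b \<tau>" "of_real (47/50 * \<tau>) * D"] mult_b(1)[OF \<tau>(1)] unfolding Imh by simp
      ultimately have "cmod (Phi z) * cmod ?h \<le> exp (pi * sqrt y) * (2 * exp (47/50 * \<tau> * y))"
        by (intro mult_mono) auto
      also have "\<dots> \<le> exp (e * y + pi\<^sup>2 / (4 * e)) * (8 * exp (47/50 * \<tau> * y))"
        using am by (intro mult_mono) auto
      also have "\<dots> = 8 * exp (pi\<^sup>2 / (4 * e)) * exp ((47/50 * \<tau> + e) * y)"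
        by (simp add: exp_add distrib_right)
      finally show ?thesis .
    next
      case False
      define x where "x = - Re z"
      have x: "0 < x" using False by (simp add: x_def)
      \<comment> \<open>In the left half plane |Im w| is at most sqrt x + sqrt y. The first term is
        cancelled by the decay of the multiplier, the second is absorbed by
        \<open>am\<close>.\<close>
      have "(Im w)\<^sup>2 \<le> x + y" using imw cz y0 x by (simp add: x_def)
      also have "\<dots> \<le> (sqrt x + sqrt y)\<^sup>2" using x y0 by (simp add: power2_sum)
      finally have "\<bar>Im w\<bar> \<le> sqrt x + sqrt y"
        using x y0 by (simp add: abs_le_square_iff[symmetric])
      then have "pi * \<bar>Im w\<bar> \<le> pi * (sqrt x + sqrt y)" by simp
      then have "cmod (Phi z) \<le> exp (pi * (sqrt x + sqrt y))"
        using norm_Phi_le[of w] w by (metis exp_le_cancel_iff order_trans)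
      moreover have "cmod ?h \<le> 8 * exp (47/50 * \<tau> * y - pi * sqrt x)"
      proof -
        have Dx: "x \<le> - Re D" by (simp add: x_def ReD)
        have neg: "Re (of_real (47/50 * \<tau>) * D) \<le> 0"
          unfolding Reh using Dx x \<tau> by (intro mult_nonneg_nonpos) auto
        have "cmod ?h \<le> 2 * pi * exp (47/50 * \<tau> * y - 2 * sqrt (mult_b \<tau> * - (47/50 * \<tau> * Re D)))"
          using norm_osc_ft_left[OF _ neg, of "mult_b \<tau>"] mult_b(1)[OF \<tau>(1)] unfolding Imh Reh by simp
        also have "2 * sqrt (mult_b \<tau> * - (47/50 * \<tau> * Re D)) = pi * sqrt (- Re D)"
          using sqrt_mult_b[OF \<tau>(1), of "- Re D"] by simp
        also have "2 * pi * exp (47/50 * \<tau> * y - pi * sqrt (- Re D)) \<le> 8 * exp (47/50 * \<tau> * y - pi * sqrt x)"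
          using pi_less_4 Dx by (intro mult_mono) auto
        finally show ?thesis .
      qed
      ultimately have "cmod (Phi z) * cmod ?h \<le>
          exp (pi * (sqrt x + sqrt y)) * (8 * exp (47/50 * \<tau> * y - pi * sqrt x))"
        by (intro mult_mono) auto
      also have "\<dots> = 8 * exp (47/50 * \<tau> * y + pi * sqrt y)"
        by (simp add: distrib_left flip: exp_add)
      also have "\<dots> \<le> 8 * exp (47/50 * \<tau> * y + (e * y + pi\<^sup>2 / (4 * e)))" using am by simp
      also have "\<dots> = 8 * exp (pi\<^sup>2 / (4 * e)) * exp ((47/50 * \<tau> + e) * y)"
        by (simp add: distrib_right flip: exp_add)
      finally show ?thesis .
    qed
    have sn: "(cmod (sinc_ser ((of_real e * D)\<^sup>2)))\<^sup>2 \<le> exp (2 * e * y) / (e\<^sup>2 * (cmod D)\<^sup>2)"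
    proof -
      have "cmod (sinc_ser ((of_real e * D)\<^sup>2)) \<le> exp \<bar>Im (of_real e * D)\<bar> / cmod (of_real e * D)"
        using e D1 by (intro norm_sinc_ser_decay) auto
      also have "\<dots> = exp (e * y) / (e * cmod D)"
        using e by (simp add: ImD y_def abs_mult norm_mult)
      finally have "(cmod (sinc_ser ((of_real e * D)\<^sup>2)))\<^sup>2 \<le> (exp (e * y) / (e * cmod D))\<^sup>2"
        by (rule power_mono) simp
      also have "\<dots> = exp (2 * e * y) / (e\<^sup>2 * (cmod D)\<^sup>2)"
        by (simp add: power_divide power_mult_distrib exp_double[symmetric] mult.assoc)
      finally show ?thesis .
    qed
    have "cmod (Phi_quot m z) \<le> 2 * (real m)\<^sup>2 * cmod (Phi z)"
    proof -
      have "z \<noteq> (of_nat m)\<^sup>2" using D1 by (auto simp: D_def)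
      then have "cmod (Phi_quot m z) = 2 * (real m)\<^sup>2 * cmod (Phi z) / cmod D"
        by (simp add: norm_Phi_quot D_def)
      also have "\<dots> \<le> 2 * (real m)\<^sup>2 * cmod (Phi z) / 1"
        using D1 by (intro divide_left_mono) auto
      finally show ?thesis by simp
    qed
    then have "cmod (Phi_quot m z) * cmod ?h \<le> (2 * (real m)\<^sup>2 * cmod (Phi z)) * cmod ?h"
      by (rule mult_right_mono) simp
    also have "\<dots> = 2 * (real m)\<^sup>2 * (cmod (Phi z) * cmod ?h)" by (simp only: mult.assoc)
    also have "\<dots> \<le> 2 * (real m)\<^sup>2 * (8 * exp (pi\<^sup>2 / (4 * e)) * exp ((47/50 * \<tau> + e) * y))"
      by (intro mult_left_mono Ph) auto
    finally have P: "cmod (Phi_quot m z) * cmod ?h \<le> 2 * (real m)\<^sup>2 * (8 * exp (pi\<^sup>2 / (4 * e)) * exp ((47/50 * \<tau> + e) * y))" .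
    have "cmod (biorth \<tau> m z) = (cmod (Phi_quot m z) * cmod ?h) * (cmod (sinc_ser ((of_real e * D)\<^sup>2)))\<^sup>2 / H"
      unfolding biorth_def H_def D_def e_def by (simp add: norm_mult norm_divide norm_power)
    also have "\<dots> \<le> (2 * (real m)\<^sup>2 * (8 * exp (pi\<^sup>2 / (4 * e)) * exp ((47/50 * \<tau> + e) * y))) *
        (exp (2 * e * y) / (e\<^sup>2 * (cmod D)\<^sup>2)) / H"
      using H by (intro divide_right_mono mult_mono P sn) auto
    also have "\<dots> = C * (exp ((47/50 * \<tau> + e) * y) * exp (2 * e * y)) / (cmod D)\<^sup>2"
      by (simp add: C_def mult_ac)
    also have "exp ((47/50 * \<tau> + e) * y) * exp (2 * e * y) = exp (\<tau> * y)"
      unfolding exp_add[symmetric] by (simp add: e_def algebra_simps)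
    finally show ?thesis unfolding zD y_def .
  qed
  with C0 show ?thesis by blast
qed

end

section \<open>The moment problem\<close>

lemma contour_integral_rectpath_bound:
  assumes f: "continuous_on (path_image (rectpath a b)) f"
    and le: "Re a \<le> Re b" "Im a \<le> Im b" and B: "0 \<le> B"
    and bd: "\<And>z. z \<in> path_image (rectpath a b) \<Longrightarrow> cmod (f z) \<le> B"
  shows "cmod (contour_integral (rectpath a b) f) \<le> B * (2 * (Re b - Re a) + 2 * (Im b - Im a))"
proof -
  define p q where "p = Complex (Re b) (Im a)" and "q = Complex (Re a) (Im b)"
  have path: "rectpath a b = linepath a p +++ linepath p b +++ linepath b q +++ linepath q a"
    by (simp add: rectpath_def Let_def p_def q_def)
  have im: "path_image (rectpath a b) = closed_segment a p \<union> closed_segment p b \<union>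
      closed_segment b q \<union> closed_segment q a"
    unfolding path by (simp add: path_image_join Un_assoc)
  have int: "f contour_integrable_on linepath u v" if "closed_segment u v \<subseteq> path_image (rectpath a b)" for u v
    by (intro contour_integrable_continuous_linepath continuous_on_subset[OF f] that)
  have n: "cmod (p - a) = Re b - Re a" "cmod (b - p) = Im b - Im a"
       "cmod (q - b) = Re b - Re a" "cmod (a - q) = Im b - Im a"
    using le by (auto simp: p_def q_def cmod_def)
  have bl: "cmod (contour_integral (linepath u v) f) \<le> B * cmod (v - u)"
    if "closed_segment u v \<subseteq> path_image (rectpath a b)" for u v
    using that by (intro contour_integral_bound_linepath int B bd) auto
  have "contour_integral (rectpath a b) f = contour_integral (linepath a p) f +
     (contour_integral (linepath p b) f + (contour_integral (linepath b q) f + contour_integral (linepath q a) f))"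
  proof -
    have i: "f contour_integrable_on linepath a p" "f contour_integrable_on linepath p b"
      "f contour_integrable_on linepath b q" "f contour_integrable_on linepath q a"
      unfolding im by (intro int; auto simp: im)+
    then show ?thesis unfolding path by simp
  qed
  also have "cmod \<dots> \<le> B * cmod (p - a) + (B * cmod (b - p) + (B * cmod (q - b) + B * cmod (a - q)))"
    using im by (intro norm_triangle_mono bl) auto
  finally show ?thesis unfolding n by (simp add: algebra_simps)
qed

lemma exp_2pi_i_eq_1_iff: "exp (2 * of_real pi * \<i> * z) = 1 \<longleftrightarrow> z \<in> \<int>"
proof
  assume "exp (2 * of_real pi * \<i> * z) = 1"
  then obtain n :: int where n: "Im (2 * of_real pi * \<i> * z) = of_int (2 * n) * pi"
    and r: "Re (2 * of_real pi * \<i> * z) = 0" by (auto simp: exp_eq_1)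
  then have "Re z = of_int n" "Im z = 0" by auto
  then have "z = of_int n" by (simp add: complex_eq_iff)
  then show "z \<in> \<int>" by simp
next
  assume "z \<in> \<int>"
  then obtain n :: int where "z = of_int n" by (auto simp: Ints_def)
  then show "exp (2 * of_real pi * \<i> * z) = 1"
    by (auto simp: exp_eq_1)
qed

text \<open>The poles of the kernel at the integers reproduce the Fourier series with coefficients
  \<open>g k\<close>, while on large squares the kernel compensates the exponential type of \<open>g\<close>.\<close>

lemma paley_wiener_periodic:
  fixes g :: "complex \<Rightarrow> complex" and a \<tau> t C :: real
  assumes g: "g holomorphic_on UNIV"
    and bd: "\<And>z. 1 \<le> cmod (z - of_real a) \<Longrightarrow>
        cmod (g z) \<le> C * exp (\<tau> * \<bar>Im z\<bar>) / (cmod (z - of_real a))\<^sup>2"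
    and C: "0 \<le> C" and t: "\<tau> < t" "t < 2 * pi - \<tau>" and \<tau>: "0 \<le> \<tau>"
  shows "(\<lambda>N. \<Sum>k\<in>{-int N..int N}. g (of_int k) * exp (- \<i> * of_real t * of_int k)) \<longlonglongrightarrow> 0"
proof -
  \<comment> \<open>The kernel E / (E - 1) has residue 1 / (2 \<pi> i) at every integer. Away from
    the integers it is of order E in the upper half plane and bounded in the lower one. Against
    exp(\<tau> |Im z|) and exp(t Im z) this leaves the rates \<tau> + t - 2 \<pi> above and \<tau> -
    t below, both negative by hypothesis.\<close>
  define E where "E = (\<lambda>z. exp (2 * of_real pi * \<i> * z))"
  define h where "h = (\<lambda>z. g z * exp (- \<i> * of_real t * z) * E z)"
  define f where "f = (\<lambda>z. h z / (E z - 1))"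
  have hol_h: "h holomorphic_on A" for A
    unfolding h_def E_def
    by (intro holomorphic_intros holomorphic_on_subset[OF g]) auto
  have hol_E: "(\<lambda>z. E z - 1) holomorphic_on A" for A
    unfolding E_def by (intro holomorphic_intros)
  have E1: "E z - 1 = 0 \<longleftrightarrow> z \<in> \<int>" for z
    using exp_2pi_i_eq_1_iff[of z] by (simp add: E_def)
  have hol_f: "f holomorphic_on A" if "A \<inter> \<int> = {}" for A
    unfolding f_def using that E1 by (intro holomorphic_on_divide hol_h hol_E) auto
  have normE: "cmod (E z) = exp (- 2 * pi * Im z)" for z by (simp add: E_def)
  have bound: "cmod (\<Sum>k\<in>{-int N..int N}. g (of_int k) * exp (- \<i> * of_real t * of_int k))
      \<le> 64 * C / (real N + 1/2)" if N: "2 * \<bar>a\<bar> + 2 \<le> real N" for N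
  proof -
    \<comment> \<open>Half-integers keep the contour away from the poles: on the vertical sides E is
      a negative number -e, so |E - 1| = 1 + e.\<close>
    define R where "R = real N + 1/2"
    have R: "2 * \<bar>a\<bar> + 2 < R" "2 < R" "0 < R" using N by (auto simp: R_def)
    define p q where "p = Complex (- R) (- R)" and "q = Complex R R"
    let ?P = "complex_of_int ` {-int N..int N}"
    let ?S = "{z::complex. \<bar>Re z\<bar> < R + 1/2}"
    have Z: "z \<in> ?P" if "z \<in> \<int>" "z \<in> ?S" for z
    proof -
      from that(1) obtain k :: int where k: "z = of_int k" by (auto simp: Ints_def)
      then have "\<bar>real_of_int k\<bar> < real N + 1" using that(2) by (simp add: R_def)
      then have "k \<in> {-int N..int N}" by auto
      then show ?thesis using k by blast
    qed
    have img: "path_image (rectpath p q) =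
      {z. Re z \<in> {- R, R} \<and> Im z \<in> {- R..R}} \<union> {z. Im z \<in> {- R, R} \<and> Re z \<in> {- R..R}}"
      using R by (subst path_image_rectpath) (auto simp: p_def q_def)
    have notint: "z \<notin> \<int>" if "z \<in> path_image (rectpath p q)" for z
    proof
      assume "z \<in> \<int>"
      then obtain k :: int where k: "z = of_int k" by (auto simp: Ints_def)
      from that k R have "\<bar>real_of_int k\<bar> = R" unfolding img by auto
      then have "real_of_int (2 * \<bar>k\<bar>) = real_of_int (2 * int N + 1)" by (simp add: R_def)
      then have "2 * \<bar>k\<bar> = 2 * int N + 1" by (simp only: of_int_eq_iff)
      then show False by presburger
    qed
    have "contour_integral (rectpath p q) f = 2 * of_real pi * \<i> *
      (\<Sum>z\<in>?P. winding_number (rectpath p q) z * residue f z)"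
    proof -
      have "contour_integral (rectpath p q) f = complex_of_real (2 * pi) * \<i> *
        (\<Sum>z\<in>?P. winding_number (rectpath p q) z * residue f z)"
      proof (rule Residue_theorem[where S = ?S])
        have "open {z::complex. Re z < R + 1/2}" "open {z::complex. Re z > - R - 1/2}"
          by (rule open_halfspace_Re_lt open_halfspace_Re_gt)+
        moreover have S: "?S = {z. Re z < R + 1/2} \<inter> {z. Re z > - R - 1/2}" by auto
        ultimately show "open ?S" by auto
        have "convex ?S" unfolding S
          by (intro convex_Int convex_halfspace_Re_lt convex_halfspace_Re_gt)
        then show "connected ?S" by (rule convex_connected)
        show "f holomorphic_on ?S - ?P" by (rule hol_f) (use Z in blast)
        have "path_image (rectpath p q) \<subseteq> ?S" using R unfolding img by auto
        moreover have "path_image (rectpath p q) \<inter> ?P = {}" using notint by fastforce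
        ultimately show "path_image (rectpath p q) \<subseteq> ?S - ?P" by blast
        show "\<forall>z. z \<notin> ?S \<longrightarrow> winding_number (rectpath p q) z = 0"
          using R by (auto intro!: winding_number_rectpath_outside simp: p_def q_def in_cbox_complex_iff)
      qed auto
      then show ?thesis by simp
    qed
    also have "(\<Sum>z\<in>?P. winding_number (rectpath p q) z * residue f z)
      = (\<Sum>k\<in>{-int N..int N}. winding_number (rectpath p q) (of_int k) * residue f (of_int k))"
      by (subst sum.reindex) (auto simp: inj_on_def)
    also have "\<dots> = (\<Sum>k\<in>{-int N..int N}.
       (g (of_int k) * exp (- \<i> * of_real t * of_int k)) / (2 * of_real pi * \<i>))"
    proof (rule sum.cong[OF refl])
      fix k assume k: "k \<in> {-int N..int N}"
      have "winding_number (rectpath p q) (of_int k) = 1"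
      proof (rule winding_number_rectpath)
        have "\<bar>real_of_int k\<bar> \<le> real N" using k by auto
        then show "of_int k \<in> box p q" using R by (auto simp: in_box_complex_iff p_def q_def R_def)
      qed
      moreover have "residue f (of_int k) = h (of_int k) / (2 * of_real pi * \<i>)"
      proof -
        have "((\<lambda>z. E z - 1) has_field_derivative (2 * of_real pi * \<i>)) (at (of_int k))"
          using exp_2pi_i_eq_1_iff[of "of_int k"] unfolding E_def
          by (auto intro!: derivative_eq_intros)
        then have "((\<lambda>z. (E z - 1) / (z - of_int k)) \<longlongrightarrow> 2 * of_real pi * \<i>) (at (of_int k))"
          using E1[of "of_int k"] by (simp add: has_field_derivative_iff)
        moreover have "(h \<longlongrightarrow> h (of_int k)) (at (of_int k))"
          using hol_h[of UNIV] by (metis continuous_on_eq_continuous_at holomorphic_on_imp_continuous_on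
              isCont_def open_UNIV UNIV_I)
        ultimately have lim: "((\<lambda>z. h z / ((E z - 1) / (z - of_int k))) \<longlongrightarrow> h (of_int k) / (2 * of_real pi * \<i>)) (at (of_int k))"
          by (intro tendsto_divide) auto
        show ?thesis
        proof (rule residue_simple')
          show "open (ball (complex_of_int k) 1)" "of_int k \<in> ball (complex_of_int k) 1" by auto
          have "z = of_int k" if "z \<in> \<int>" "z \<in> ball (of_int k) 1" for z :: complex
          proof -
            from that(1) obtain j :: int where j: "z = of_int j" by (auto simp: Ints_def)
            have "\<bar>real_of_int (k - j)\<bar> < 1"
              using that(2) unfolding j mem_ball dist_norm by (metis norm_of_int of_int_diff)
            then have "k = j" by linarith
            with j show ?thesis by simp
          qed
          then show "f holomorphic_on ball (of_int k) 1 - {of_int k}"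
            by (intro hol_f) blast
          show "((\<lambda>z. f z * (z - of_int k)) \<longlongrightarrow> h (of_int k) / (2 * of_real pi * \<i>)) (at (of_int k))"
            using lim by (simp add: f_def)
        qed
      qed
      moreover have "E (of_int k) = 1" using E1[of "of_int k"] by simp
      ultimately show "winding_number (rectpath p q) (of_int k) * residue f (of_int k)
        = (g (of_int k) * exp (- \<i> * of_real t * of_int k)) / (2 * of_real pi * \<i>)"
        by (simp add: h_def)
    qed
    finally have eq: "contour_integral (rectpath p q) f =
        (\<Sum>k\<in>{-int N..int N}. g (of_int k) * exp (- \<i> * of_real t * of_int k))"
      by (simp flip: sum_divide_distrib)
    \<comment> \<open>The decay of g makes the integrand at most 8 C / R^2 on a contour of length 8
      R, which explains the constant 64.\<close>
    have "cmod (contour_integral (rectpath p q) f) \<le>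
        (8 * C / R\<^sup>2) * (2 * (Re q - Re p) + 2 * (Im q - Im p))"
    proof (rule contour_integral_rectpath_bound)
      show "continuous_on (path_image (rectpath p q)) f"
        using notint by (intro holomorphic_on_imp_continuous_on hol_f) auto
      show "0 \<le> 8 * C / R\<^sup>2" using C by simp
      fix z assume z: "z \<in> path_image (rectpath p q)"
      have "R \<le> cmod z"
        using z R abs_Re_le_cmod[of z] abs_Im_le_cmod[of z] unfolding img by auto
      \<comment> \<open>R exceeds 2 |a|, so recentring at a at most halves the distance; after
        squaring this costs a factor 4.\<close>
      then have za: "R / 2 \<le> cmod (z - of_real a)"
        using norm_triangle_ineq2[of z "of_real a"] R by simp
      have g4: "cmod (g z) \<le> 4 * C * exp (\<tau> * \<bar>Im z\<bar>) / R\<^sup>2"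
      proof -
        have "cmod (g z) \<le> C * exp (\<tau> * \<bar>Im z\<bar>) / (cmod (z - of_real a))\<^sup>2"
          using za R by (intro bd) auto
        also have "\<dots> \<le> C * exp (\<tau> * \<bar>Im z\<bar>) / (R/2)\<^sup>2"
          using za R C by (intro divide_left_mono power_mono mult_pos_pos) (auto simp: zero_less_power)
        finally show ?thesis by (simp add: power2_eq_square mult_ac)
      qed
      define y where "y = Im z"
      define e where "e = exp (- 2 * pi * y)"
      have e0: "0 < e" by (simp add: e_def)
      have "exp (\<tau> * \<bar>y\<bar>) * (exp (t * y) * (e / cmod (E z - 1))) \<le> 2"
      proof -
        consider "Re z = R \<or> Re z = - R" | "y = R" | "y = - R" using z unfolding img y_def by auto
        then show ?thesis
        proof cases
          case 1
          have "E z = - of_real e"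
          proof -
            have s: "sin (2 * pi * Re z) = 0 \<and> cos (2 * pi * Re z) = - 1"
            proof -
              have "2 * pi * R = 2 * real N * pi + pi" by (simp add: R_def algebra_simps)
              then have "sin (2 * pi * R) = 0" "cos (2 * pi * R) = -1"
                by (simp_all only: sin_periodic_pi cos_periodic_pi sin_2npi cos_2npi minus_zero)
              then show ?thesis using 1 by auto
            qed
            show ?thesis unfolding E_def e_def y_def
              using s by (simp add: complex_eq_iff Re_exp Im_exp)
          qed
          then have "E z - 1 = - of_real (e + 1)" by simp
          then have "cmod (E z - 1) = e + 1" using e0 by (simp only: norm_minus_cancel norm_of_real) 
          then have c: "cmod (E z - 1) = e + 1" .
          show ?thesis
          proof (cases "0 \<le> y")
            case True
            have "exp (\<tau> * \<bar>y\<bar>) * (exp (t * y) * (e / cmod (E z - 1))) \<le> exp (\<tau> * y) * (exp (t * y) * e)"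
              using True e0 unfolding c by (intro mult_mono) (auto simp: pos_divide_le_eq)
            also have "\<dots> = exp (- (2 * pi - \<tau> - t) * y)" by (simp add: e_def algebra_simps flip: exp_add)
            also have "\<dots> \<le> 1" using t True by (simp add: mult_nonpos_nonneg)
            finally show ?thesis by simp
          next
            case False
            have "exp (\<tau> * \<bar>y\<bar>) * (exp (t * y) * (e / cmod (E z - 1))) \<le> exp (- \<tau> * y) * (exp (t * y) * 1)"
              using False e0 unfolding c by (intro mult_mono) (auto simp: pos_divide_le_eq)
            also have "\<dots> = exp ((t - \<tau>) * y)" by (simp add: algebra_simps flip: exp_add)
            also have "\<dots> \<le> 1" using t False by (simp add: mult_nonneg_nonpos)
            finally show ?thesis by simp
          qed
        next
          case 2
          have "e \<le> exp (- 1)" unfolding e_def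
          proof (subst exp_le_cancel_iff)
            have "1 * 1 \<le> (2 * pi) * y" using pi_gt3 2 R by (intro mult_mono) auto
            then show "- 2 * pi * y \<le> - 1" by simp
          qed
          also have "exp (- 1) \<le> (1/2::real)"
            using exp_ge_add_one_self[of 1] by (simp add: exp_minus inverse_eq_divide pos_divide_le_eq)
          finally have e2: "e \<le> 1/2" .
          have "cmod 1 - cmod (E z) \<le> cmod (E z - 1)" by (metis norm_minus_commute norm_triangle_ineq2)
          then have c: "1/2 \<le> cmod (E z - 1)" using e2 normE[of z] by (simp add: e_def y_def)
          then have "e / cmod (E z - 1) \<le> e / (1/2)"
            using e0 by (intro divide_left_mono) auto
          then have "e / cmod (E z - 1) \<le> 2 * e" by simp
          then have "exp (\<tau> * \<bar>y\<bar>) * (exp (t * y) * (e / cmod (E z - 1))) \<le> exp (\<tau> * y) * (exp (t * y) * (2 * e))"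
            using 2 R by (intro mult_mono) (auto intro!: mult_nonneg_nonneg divide_nonneg_nonneg less_imp_le[OF e0])
          also have "\<dots> = 2 * exp (- (2 * pi - \<tau> - t) * y)" by (simp add: e_def algebra_simps flip: exp_add)
          also have "\<dots> \<le> 2" using t 2 R by (simp add: mult_nonpos_nonneg)
          finally show ?thesis .
        next
          case 3
          have "exp 1 \<le> e" unfolding e_def
          proof (subst exp_le_cancel_iff)
            have "1 * 1 \<le> (2 * pi) * (- y)" using pi_gt3 3 R by (intro mult_mono) auto
            then show "1 \<le> - 2 * pi * y" by simp
          qed
          then have e2: "2 \<le> e"
            using exp_ge_add_one_self[of 1] by simp
          have "cmod (E z) - cmod 1 \<le> cmod (E z - 1)" by (rule norm_triangle_ineq2)
          then have c: "e - 1 \<le> cmod (E z - 1)" using normE[of z] by (simp add: e_def y_def)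
          then have "0 < cmod (E z - 1)" "e \<le> 2 * cmod (E z - 1)" using e2 by linarith+
          then have "e / cmod (E z - 1) \<le> 2" by (simp add: pos_divide_le_eq)
          then have "exp (\<tau> * \<bar>y\<bar>) * (exp (t * y) * (e / cmod (E z - 1))) \<le> exp (- \<tau> * y) * (exp (t * y) * 2)"
            using 3 R by (intro mult_mono) (auto intro!: mult_nonneg_nonneg divide_nonneg_nonneg less_imp_le[OF e0])
          also have "\<dots> = 2 * exp ((t - \<tau>) * y)" by (simp add: algebra_simps flip: exp_add)
          also have "\<dots> \<le> 2" using t 3 R by (simp add: mult_nonneg_nonpos)
          finally show ?thesis .
        qed
      qed
      note K = this
      have "cmod (f z) = cmod (g z) * (exp (t * y) * (e / cmod (E z - 1)))"
        by (simp add: f_def h_def norm_divide norm_mult normE e_def y_def)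
      also have "\<dots> \<le> (4 * C * exp (\<tau> * \<bar>y\<bar>) / R\<^sup>2) * (exp (t * y) * (e / cmod (E z - 1)))"
        using g4 e0 unfolding y_def by (intro mult_right_mono) auto
      also have "\<dots> = (4 * C / R\<^sup>2) * (exp (\<tau> * \<bar>y\<bar>) * (exp (t * y) * (e / cmod (E z - 1))))"
        by simp
      also have "\<dots> \<le> (4 * C / R\<^sup>2) * 2" using K C by (intro mult_left_mono) auto
      finally show "cmod (f z) \<le> 8 * C / R\<^sup>2" by simp
    qed (use R in \<open>auto simp: p_def q_def\<close>)
    also have "\<dots> = 64 * C / R"
      using R by (simp add: p_def q_def power2_eq_square)
    finally show ?thesis unfolding eq R_def .
  qed
  show ?thesis
  proof (rule Lim_null_comparison)
    obtain N0 :: nat where N0: "2 * \<bar>a\<bar> + 2 \<le> real N0" using real_arch_simple by blast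
    show "\<forall>\<^sub>F N in sequentially. norm (\<Sum>k\<in>{-int N..int N}. g (of_int k) * exp (- \<i> * of_real t * of_int k))
        \<le> 64 * C / (real N + 1/2)"
      using N0 by (intro eventually_sequentiallyI[of N0] bound) auto
    show "(\<lambda>N. 64 * C / (real N + 1/2)) \<longlonglongrightarrow> 0"
      by real_asymp
  qed
qed

section \<open>Restriction to sub-intervals and square integrable functions on intervals\<close>

lemma lebesgue_on_subset:
  fixes f :: "real \<Rightarrow> 'b::{banach, second_countable_topology}"
  assumes A: "A \<in> sets lebesgue" and B: "B \<in> sets lebesgue" and AB: "A \<subseteq> B"
    and f: "integrable (lebesgue_on B) f"
  shows "integrable (lebesgue_on A) f"
proof -
  have "integrable lebesgue (\<lambda>x. indicator B x *\<^sub>R f x)"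
    using f B by (simp add: integrable_restrict_space)
  then have "integrable lebesgue (\<lambda>x. indicator A x *\<^sub>R (indicator B x *\<^sub>R f x))"
    using A by (rule integrable_mult_indicator[rotated])
  also have "(\<lambda>x. indicator A x *\<^sub>R (indicator B x *\<^sub>R f x)) = (\<lambda>x. indicator A x *\<^sub>R f x)"
    using AB by (auto simp: indicator_def fun_eq_iff)
  finally show ?thesis using A by (simp add: integrable_restrict_space)
qed

lemma lebesgue_on_mono:
  fixes f :: "real \<Rightarrow> real"
  assumes A: "A \<in> sets lebesgue" and B: "B \<in> sets lebesgue" and AB: "A \<subseteq> B"
    and f: "integrable (lebesgue_on B) f" and pos: "\<And>x. 0 \<le> f x"
  shows "(LINT x|lebesgue_on A. f x) \<le> (LINT x|lebesgue_on B. f x)"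
proof -
  have iB: "integrable lebesgue (\<lambda>x. indicator B x *\<^sub>R f x)"
    using f B by (simp add: integrable_restrict_space)
  have iA: "integrable lebesgue (\<lambda>x. indicator A x *\<^sub>R f x)"
    using lebesgue_on_subset[OF A B AB f] A by (simp add: integrable_restrict_space)
  have "(\<integral>x. indicator A x *\<^sub>R f x \<partial>lebesgue) \<le> (\<integral>x. indicator B x *\<^sub>R f x \<partial>lebesgue)"
    using iA iB AB pos by (intro integral_mono) (auto simp: indicator_def)
  then show ?thesis using A B by (simp add: integral_restrict_space)
qed

lemma sq_int_subset:
  fixes f :: "real \<Rightarrow> complex"
  assumes A: "A \<in> sets lebesgue" and B: "B \<in> sets lebesgue" and AB: "A \<subseteq> B"
    and f: "sq_int (lebesgue_on B) f"
  shows "sq_int (lebesgue_on A) f" "l2norm (lebesgue_on A) f \<le> l2norm (lebesgue_on B) f"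
proof -
  have i: "integrable (lebesgue_on B) (\<lambda>x. (cmod (f x))\<^sup>2)" using f by (simp add: sq_int_def)
  have "f \<in> borel_measurable (lebesgue_on A)"
  proof -
    have "f \<in> borel_measurable (restrict_space (lebesgue_on B) A)"
      using f by (rule measurable_restrict_space1[OF sq_int_measurable])
    also have "restrict_space (lebesgue_on B) A = lebesgue_on A"
      using A B AB by (simp add: restrict_restrict_space Int_absorb1)
    finally show ?thesis .
  qed
  with lebesgue_on_subset[OF A B AB i] show "sq_int (lebesgue_on A) f" by (simp add: sq_int_def)
  show "l2norm (lebesgue_on A) f \<le> l2norm (lebesgue_on B) f"
    unfolding l2norm_def by (intro real_sqrt_le_mono lebesgue_on_mono[OF A B AB i]) simp
qed

lemma continuous_integrable_open_interval:
  fixes f :: "real \<Rightarrow> 'b::euclidean_space"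
  assumes "continuous_on {a..b} f"
  shows "integrable (lebesgue_on {a<..<b}) f"
    and "(LINT x|lebesgue_on {a<..<b}. f x) = integral {a..b} f"
proof -
  show i: "integrable (lebesgue_on {a<..<b}) f"
    by (rule lebesgue_on_subset[OF _ _ _ continuous_imp_integrable_real[OF assms]]) auto
  then have "(LINT x|lebesgue_on {a<..<b}. f x) = integral {a<..<b} f"
    by (rule lebesgue_integral_eq_integral) simp
  then show "(LINT x|lebesgue_on {a<..<b}. f x) = integral {a..b} f"
    by (simp add: integral_open_interval_real)
qed

lemma continuous_sq_int:
  fixes f :: "real \<Rightarrow> complex"
  assumes "continuous_on {a..b} f"
  shows "sq_int (lebesgue_on {a<..<b}) f"
proof -
  have "f \<in> borel_measurable (lebesgue_on {a<..<b})"
    using borel_measurable_integrable[OF continuous_integrable_open_interval(1)[OF assms]] .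
  moreover have "integrable (lebesgue_on {a<..<b}) (\<lambda>x. (cmod (f x))\<^sup>2)"
    by (intro continuous_integrable_open_interval continuous_intros assms)
  ultimately show ?thesis by (simp add: sq_int_def)
qed

lemma l2norm_le_const:
  fixes f :: "real \<Rightarrow> complex"
  assumes "continuous_on {a..b} f" "a \<le> b" "\<And>x. x \<in> {a..b} \<Longrightarrow> cmod (f x) \<le> K" "0 \<le> K"
  shows "l2norm (lebesgue_on {a<..<b}) f \<le> K * sqrt (b - a)"
proof -
  have c: "continuous_on {a..b} (\<lambda>x. (cmod (f x))\<^sup>2)" by (intro continuous_intros assms)
  have "(LINT x|lebesgue_on {a<..<b}. (cmod (f x))\<^sup>2) = integral {a..b} (\<lambda>x. (cmod (f x))\<^sup>2)"
    by (rule continuous_integrable_open_interval(2)[OF c])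
  also have "\<dots> \<le> integral {a..b} (\<lambda>x. K\<^sup>2)"
    using assms by (intro integral_le integrable_continuous_real c) (auto intro: power_mono)
  also have "\<dots> = K\<^sup>2 * (b - a)" using assms by simp
  finally have "l2norm (lebesgue_on {a<..<b}) f \<le> sqrt (K\<^sup>2 * (b - a))"
    unfolding l2norm_def by (rule real_sqrt_le_mono)
  also have "\<dots> = K * sqrt (b - a)" using assms by (simp add: real_sqrt_mult)
  finally show ?thesis .
qed

lemma l2norm_uniform_limit:
  fixes f :: "nat \<Rightarrow> real \<Rightarrow> complex"
  assumes f: "\<And>n. continuous_on {a..b} (f n)" and ab: "a < b" and ul: "uniform_limit {a..b} f g sequentially"
  shows "continuous_on {a..b} g" "(\<lambda>n. l2norm (lebesgue_on {a<..<b}) (\<lambda>x. f n x - g x)) \<longlonglongrightarrow> 0"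
proof -
  show g: "continuous_on {a..b} g"
    by (rule uniform_limit_theorem[OF _ ul trivial_limit_sequentially]) (intro always_eventually allI f)
  show "(\<lambda>n. l2norm (lebesgue_on {a<..<b}) (\<lambda>x. f n x - g x)) \<longlonglongrightarrow> 0"
  proof (rule LIMSEQ_I)
    fix e :: real assume e: "0 < e"
    define r where "r = e / (2 * sqrt (b - a))"
    have r: "0 < r" using e ab by (simp add: r_def)
    from uniform_limitD[OF ul r] obtain N where N: "\<And>n x. n \<ge> N \<Longrightarrow> x \<in> {a..b} \<Longrightarrow> dist (f n x) (g x) < r"
      unfolding eventually_sequentially by blast
    have "norm (l2norm (lebesgue_on {a<..<b}) (\<lambda>x. f n x - g x) - 0) < e" if "n \<ge> N" for n
    proof -
      have "l2norm (lebesgue_on {a<..<b}) (\<lambda>x. f n x - g x) \<le> r * sqrt (b - a)"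
        using N[OF that] r ab
        by (intro l2norm_le_const continuous_on_diff f g) (auto simp: dist_norm less_imp_le)
      also have "\<dots> = e / 2" using ab by (simp add: r_def)
      finally show ?thesis using e by simp
    qed
    then show "\<exists>N. \<forall>n\<ge>N. norm (l2norm (lebesgue_on {a<..<b}) (\<lambda>x. f n x - g x) - 0) < e" by blast
  qed
qed

section \<open>Exponentials over one period\<close>

lemma trig_orthogonal:
  fixes j :: int
  assumes \<omega>: "0 < \<omega>" and P: "P = 2 * pi / \<omega>"
  shows "(LINT t|lebesgue_on {a<..<a+P}. cis (of_int j * \<omega> * t)) = (if j = 0 then of_real P else 0)"
proof -
  have P0: "0 < P" using \<omega> P by simp
  have c: "continuous_on {a..a+P} (\<lambda>t. cis (of_int j * \<omega> * t))"
    by (intro continuous_intros)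
  have "integral {a..a+P} (\<lambda>t. cis (of_int j * \<omega> * t)) = (if j = 0 then of_real P else 0)"
  proof (cases "j = 0")
    case True then show ?thesis using P0 by (simp add: scaleR_conv_of_real)
  next
    case False
    define r where "r = of_int j * \<omega>"
    have r: "r \<noteq> 0" using False \<omega> by (simp add: r_def)
    have "((\<lambda>t. cis (r * t)) has_integral (cis (r * (a+P)) / (\<i> * of_real r) - cis (r * a) / (\<i> * of_real r))) {a..a+P}"
    proof (rule fundamental_theorem_of_calculus)
      fix t
      have "((\<lambda>z. exp (\<i> * of_real r * z) / (\<i> * of_real r)) has_field_derivative exp (\<i> * of_real r * of_real t))
          (at (of_real t))"
        using r by (auto intro!: derivative_eq_intros)
      then have "((\<lambda>t. exp (\<i> * of_real r * of_real t) / (\<i> * of_real r)) has_vector_derivative exp (\<i> * of_real r * of_real t))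
          (at t within {a..a+P})"
        by (rule has_vector_derivative_real_field)
      then show "((\<lambda>t. cis (r * t) / (\<i> * of_real r)) has_vector_derivative cis (r * t)) (at t within {a..a+P})"
        by (simp add: cis_conv_exp mult.assoc)
    qed (use P0 in simp)
    moreover have "cis (r * (a + P)) = cis (r * a)"
    proof -
      have "r * P = 2 * pi * of_int j" using \<omega> by (simp add: r_def P)
      then have "cis (r * (a + P)) = cis (r * a) * cis (2 * pi * of_int j)"
        by (simp add: distrib_left flip: cis_mult)
      also have "cis (2 * pi * of_int j) = 1" by (simp add: cis_multiple_2pi)
      finally show ?thesis by simp
    qed
    ultimately show ?thesis using False by (simp add: r_def integral_unique)
  qed
  then show ?thesis using continuous_integrable_open_interval(2)[OF c] by simp
qed

lemma trig_poly_l2norm: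
  fixes F :: "int set"
  assumes \<omega>: "0 < \<omega>" and P: "P = 2 * pi / \<omega>" and F: "finite F"
  shows "(l2norm (lebesgue_on {a<..<a+P}) (\<lambda>t. \<Sum>k\<in>F. d k * cis (of_int k * \<omega> * t)))\<^sup>2
    = P * (\<Sum>k\<in>F. (cmod (d k))\<^sup>2)"
proof (rule l2norm_orthogonal_sum[OF F])
  show "sq_int (lebesgue_on {a<..<a+P}) (\<lambda>t. cis (of_int k * \<omega> * t))" for k :: int
    by (intro continuous_sq_int continuous_intros)
  fix k l :: int
  have "cis (of_int k * \<omega> * t) * cnj (cis (of_int l * \<omega> * t)) = cis (of_int (k - l) * \<omega> * t)" for t
    by (simp add: cis_cnj cis_mult algebra_simps)
  then show "(LINT t|lebesgue_on {a<..<a+P}. cis (of_int k * \<omega> * t) * cnj (cis (of_int l * \<omega> * t)))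
      = (if l = k then of_real P else 0)"
    by (simp only: trig_orthogonal[OF \<omega> P]) simp
qed

text \<open>On part of a period the exponentials are not orthogonal, but restriction only decreases
  the norm of a combination, so Parseval over the period gives the bound that
  \<open>bessel_dual\<close> asks for.\<close>

lemma trig_bessel:
  fixes F :: "int set"
  assumes \<omega>: "0 < \<omega>" and P: "P = 2 * pi / \<omega>" and F: "finite F"
    and sub: "{p<..<q} \<subseteq> {a<..<a+P}" and u: "sq_int (lebesgue_on {p<..<q}) u"
  shows "(\<Sum>k\<in>F. (cmod (LINT t|lebesgue_on {p<..<q}. u t * cis (of_int k * \<omega> * t)))\<^sup>2)
    \<le> P * (l2norm (lebesgue_on {p<..<q}) u)\<^sup>2"
proof (rule bessel_dual[OF F _ _ _ u])
  show "sq_int (lebesgue_on {p<..<q}) (\<lambda>t. cis (of_int k * \<omega> * t))" for k :: int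
    by (intro continuous_sq_int continuous_intros)
  show "0 \<le> P" using P \<omega> by simp
  fix d :: "int \<Rightarrow> complex"
  let ?f = "\<lambda>t. \<Sum>k\<in>F. d k * cis (of_int k * \<omega> * t)"
  have "sq_int (lebesgue_on {a<..<a+P}) ?f"
    by (intro continuous_sq_int continuous_intros)
  then have "l2norm (lebesgue_on {p<..<q}) ?f \<le> l2norm (lebesgue_on {a<..<a+P}) ?f"
    by (intro sq_int_subset(2)[OF _ _ sub]) auto
  then have "(l2norm (lebesgue_on {p<..<q}) ?f)\<^sup>2 \<le> (l2norm (lebesgue_on {a<..<a+P}) ?f)\<^sup>2"
    by (intro power_mono) auto
  then show "(l2norm (lebesgue_on {p<..<q}) ?f)\<^sup>2 \<le> P * (\<Sum>k\<in>F. (cmod (d k))\<^sup>2)"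
    unfolding trig_poly_l2norm[OF \<omega> P F] .
qed

section \<open>Inverse square decay and a Schur test\<close>

lemma sum_int_symmetric_Suc:
  fixes f :: "int \<Rightarrow> 'a::comm_monoid_add"
  shows "(\<Sum>k\<in>{- int (Suc n)..int (Suc n)}. f k) =
    (\<Sum>k\<in>{- int n..int n}. f k) + (f (int (Suc n)) + f (- int (Suc n)))"
proof -
  have "{- int (Suc n)..int (Suc n)} = insert (- int (Suc n)) (insert (int (Suc n)) {- int n..int n})"
    by auto
  then show ?thesis by (simp add: add_ac)
qed

text \<open>Telescoping: 2 / (1 + a^2) \<le> 4 / a - 4 / (a + 1) for a > 0, so the symmetric partial
  sums stay below 5 - 4 / (n + 1), with equality at n = 0; every finite set lies in a symmetric
  interval.\<close>

lemma sum_inverse_square_le: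
  fixes F :: "int set"
  assumes "finite F"
  shows "(\<Sum>j\<in>F. 1 / (1 + (real_of_int j)\<^sup>2)) \<le> 5"
proof -
  let ?q = "\<lambda>j. 1 / (1 + (real_of_int j)\<^sup>2)"
  have sym: "(\<Sum>j\<in>{- int n..int n}. ?q j) \<le> 5 - 4 / real (Suc n)" for n
  proof (induction n)
    case (Suc n)
    define a where "a = real (Suc n)"
    have a: "0 < a" by (simp add: a_def)
    have "a * (a + 1) \<le> 2 * (1 + a\<^sup>2)"
      using sum_squares_bound[of a 1] a by (simp add: power2_eq_square algebra_simps)
    then have "2 / (2 * (1 + a\<^sup>2)) \<le> 2 / (a * (a + 1))"
      using a by (intro divide_left_mono) (auto intro!: mult_pos_pos add_pos_nonneg)
    then have "2 * (2 / (2 * (1 + a\<^sup>2))) \<le> 2 * (2 / (a * (a + 1)))"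
      by (intro mult_left_mono) auto
    moreover have "2 * (2 / (2 * x)) = 2 / x" "2 * (2 / x) = 4 / x" for x :: real by auto
    ultimately have "2 / (1 + a\<^sup>2) \<le> 4 / (a * (a + 1))" by (simp only:)
    also have "\<dots> = 4 / a - 4 / (a + 1)" using a by (simp add: field_simps)
    finally have "1 / (1 + a\<^sup>2) + 1 / (1 + a\<^sup>2) \<le> 4 / a - 4 / (a + 1)" by simp
    moreover have "?q (int (Suc n)) = 1 / (1 + a\<^sup>2)" "?q (- int (Suc n)) = 1 / (1 + a\<^sup>2)"
      by (simp_all only: of_int_minus power2_minus of_int_of_nat_eq a_def)
    moreover have "a + 1 = real (Suc (Suc n))" by (simp add: a_def)
    ultimately have "?q (int (Suc n)) + ?q (- int (Suc n)) \<le> 4 / real (Suc n) - 4 / real (Suc (Suc n))"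
      by (simp only: a_def)
    then show ?case using Suc unfolding sum_int_symmetric_Suc by linarith
  qed simp
  define n where "n = nat (Max (insert 0 (abs ` F)))"
  have "F \<subseteq> {- int n..int n}"
  proof
    fix j assume "j \<in> F"
    then have "\<bar>j\<bar> \<le> Max (insert 0 (abs ` F))" using assms by (intro Max_ge) auto
    then show "j \<in> {- int n..int n}" unfolding n_def by auto
  qed
  then have "(\<Sum>j\<in>F. ?q j) \<le> (\<Sum>j\<in>{- int n..int n}. ?q j)"
    by (intro sum_mono2) (auto intro: add_nonneg_nonneg)
  moreover have "0 \<le> 4 / real (Suc n)" by simp
  ultimately show ?thesis using sym[of n] by linarith
qed

text \<open>Row and column sums of |g| are at most 5 B, because k - m^2 is injective in m for fixed
  k and in k for fixed m. Cauchy-Schwarz with the weight |g| split evenly between the two factors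
  then bounds the operator on l^2 by 5 B.\<close>

lemma schur_test:
  fixes g :: "nat \<Rightarrow> int \<Rightarrow> complex"
  assumes I: "finite I" and F: "finite F" and B: "0 \<le> B"
    and g: "\<And>m k. m \<in> I \<Longrightarrow> cmod (g m k) \<le> B / (1 + (real_of_int k - (real m)\<^sup>2)\<^sup>2)"
  shows "(\<Sum>k\<in>F. (cmod (\<Sum>m\<in>I. c m * g m k))\<^sup>2) \<le> (5 * B)\<^sup>2 * (\<Sum>m\<in>I. (cmod (c m))\<^sup>2)"
proof -
  have q: "B / (1 + (real_of_int k - (real m)\<^sup>2)\<^sup>2) = B * (1 / (1 + (real_of_int (k - int (m\<^sup>2)))\<^sup>2))" for k m
    by simp
  have row: "(\<Sum>m\<in>I. cmod (g m k)) \<le> 5 * B" for k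
  proof -
    have "inj_on (\<lambda>m. k - int (m\<^sup>2)) I"
      by (auto simp: inj_on_def power2_eq_iff_nonneg)
    then have "(\<Sum>m\<in>I. 1 / (1 + (real_of_int (k - int (m\<^sup>2)))\<^sup>2))
        = (\<Sum>j\<in>(\<lambda>m. k - int (m\<^sup>2)) ` I. 1 / (1 + (real_of_int j)\<^sup>2))"
      by (simp only: sum.reindex comp_def)
    also have "\<dots> \<le> 5" using I by (intro sum_inverse_square_le) auto
    finally have "B * (\<Sum>m\<in>I. 1 / (1 + (real_of_int (k - int (m\<^sup>2)))\<^sup>2)) \<le> B * 5"
      using B by (rule mult_left_mono)
    moreover have "(\<Sum>m\<in>I. cmod (g m k)) \<le> B * (\<Sum>m\<in>I. 1 / (1 + (real_of_int (k - int (m\<^sup>2)))\<^sup>2))"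
      unfolding sum_distrib_left q[symmetric] by (intro sum_mono g)
    ultimately show ?thesis by simp
  qed
  have col: "(\<Sum>k\<in>F. cmod (g m k)) \<le> 5 * B" if "m \<in> I" for m
  proof -
    have "inj_on (\<lambda>k. k - int (m\<^sup>2)) F" by (auto simp: inj_on_def)
    then have "(\<Sum>k\<in>F. 1 / (1 + (real_of_int (k - int (m\<^sup>2)))\<^sup>2))
        = (\<Sum>j\<in>(\<lambda>k. k - int (m\<^sup>2)) ` F. 1 / (1 + (real_of_int j)\<^sup>2))"
      by (simp only: sum.reindex comp_def)
    also have "\<dots> \<le> 5" using F by (intro sum_inverse_square_le) auto
    finally have "B * (\<Sum>k\<in>F. 1 / (1 + (real_of_int (k - int (m\<^sup>2)))\<^sup>2)) \<le> B * 5"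
      using B by (rule mult_left_mono)
    moreover have "(\<Sum>k\<in>F. cmod (g m k)) \<le> B * (\<Sum>k\<in>F. 1 / (1 + (real_of_int (k - int (m\<^sup>2)))\<^sup>2))"
      unfolding sum_distrib_left q[symmetric] using that by (intro sum_mono g)
    ultimately show ?thesis by simp
  qed
  have "(cmod (\<Sum>m\<in>I. c m * g m k))\<^sup>2 \<le> 5 * B * (\<Sum>m\<in>I. (cmod (c m))\<^sup>2 * cmod (g m k))" for k
  proof -
    have "cmod (\<Sum>m\<in>I. c m * g m k) \<le> (\<Sum>m\<in>I. cmod (c m) * cmod (g m k))"
      using norm_sum[of "\<lambda>m. c m * g m k" I] by (simp add: norm_mult)
    also have "\<dots> = (\<Sum>m\<in>I. sqrt (cmod (g m k)) * (cmod (c m) * sqrt (cmod (g m k))))"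
      by (simp add: mult_ac flip: real_sqrt_mult)
    finally have "(cmod (\<Sum>m\<in>I. c m * g m k))\<^sup>2 \<le> (\<Sum>m\<in>I. sqrt (cmod (g m k)) * (cmod (c m) * sqrt (cmod (g m k))))\<^sup>2"
      by (rule power_mono) simp
    also have "\<dots> \<le> (\<Sum>m\<in>I. (sqrt (cmod (g m k)))\<^sup>2) * (\<Sum>m\<in>I. (cmod (c m) * sqrt (cmod (g m k)))\<^sup>2)"
      by (rule Cauchy_Schwarz_ineq_sum)
    also have "\<dots> = (\<Sum>m\<in>I. cmod (g m k)) * (\<Sum>m\<in>I. (cmod (c m))\<^sup>2 * cmod (g m k))"
      by (simp add: power_mult_distrib)
    also have "\<dots> \<le> 5 * B * (\<Sum>m\<in>I. (cmod (c m))\<^sup>2 * cmod (g m k))"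
      by (intro mult_right_mono row sum_nonneg) auto
    finally show ?thesis .
  qed
  then have "(\<Sum>k\<in>F. (cmod (\<Sum>m\<in>I. c m * g m k))\<^sup>2) \<le>
      (\<Sum>k\<in>F. 5 * B * (\<Sum>m\<in>I. (cmod (c m))\<^sup>2 * cmod (g m k)))"
    by (rule sum_mono)
  also have "\<dots> = 5 * B * (\<Sum>m\<in>I. (cmod (c m))\<^sup>2 * (\<Sum>k\<in>F. cmod (g m k)))"
    unfolding sum_distrib_left by (subst sum.swap) simp
  also have "\<dots> \<le> 5 * B * (\<Sum>m\<in>I. (cmod (c m))\<^sup>2 * (5 * B))"
    using B by (intro mult_left_mono sum_mono col) auto
  also have "\<dots> = (5 * B)\<^sup>2 * (\<Sum>m\<in>I. (cmod (c m))\<^sup>2)"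
    by (simp add: power2_eq_square sum_distrib_left mult_ac)
  finally show ?thesis .
qed

section \<open>Biorthogonal functions of time\<close>

lemma uniform_limit_sum:
  fixes f :: "'i \<Rightarrow> 'n \<Rightarrow> 'x \<Rightarrow> 'b::real_normed_vector"
  assumes "\<And>i. i \<in> I \<Longrightarrow> uniform_limit X (f i) (l i) F"
  shows "uniform_limit X (\<lambda>n x. \<Sum>i\<in>I. f i n x) (\<lambda>x. \<Sum>i\<in>I. l i x) F"
  using assms
  by (induction I rule: infinite_finite_induct) (auto intro!: uniform_limit_add uniform_limit_const)

lemma l2_tendsto_integral:
  assumes f: "\<And>n::nat. sq_int M (f n)" and h: "sq_int M h" and g: "sq_int M g"
    and lim: "(\<lambda>n. l2norm M (\<lambda>x. f n x - h x)) \<longlonglongrightarrow> 0"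
  shows "(\<lambda>n. LINT x|M. f n x * g x) \<longlonglongrightarrow> (LINT x|M. h x * g x)"
proof (rule LIM_zero_cancel, rule Lim_null_comparison)
  have "(LINT x|M. f n x * g x) - (LINT x|M. h x * g x) = (LINT x|M. (f n x - h x) * g x)" for n
    unfolding left_diff_distrib
    by (rule Bochner_Integration.integral_diff[symmetric]; rule sq_int_mult_integrable; fact)
  then show "\<forall>\<^sub>F n in sequentially. norm ((LINT x|M. f n x * g x) - (LINT x|M. h x * g x)) \<le>
      l2norm M (\<lambda>x. f n x - h x) * l2norm M g"
    using l2_cauchy_schwarz[OF sq_int_diff[OF f h] g] by simp
  show "(\<lambda>n. l2norm M (\<lambda>x. f n x - h x) * l2norm M g) \<longlonglongrightarrow> 0"
    using tendsto_mult_right[OF lim, of "l2norm M g"] by simp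
qed

text \<open>Fourier partial sums whose coefficients are the samples of \<open>biorth\<close> at the
  integers. As the frequencies n^2 are integers, this periodic series can take the place of an
  inverse Fourier transform.\<close>

definition partial_series :: "real \<Rightarrow> nat \<Rightarrow> nat \<Rightarrow> real \<Rightarrow> complex" where
  "partial_series \<tau> m N t = (\<Sum>k\<in>{- int N..int N}. biorth \<tau> m (of_int k) * cis (- (of_int k * t))) / of_real (2 * pi)"

definition biorth_time :: "real \<Rightarrow> nat \<Rightarrow> real \<Rightarrow> complex" where
  "biorth_time \<tau> m t = lim (\<lambda>N. partial_series \<tau> m N t)"

definition biorth_bound :: "real \<Rightarrow> real" where
  "biorth_bound \<tau> = 80000 / (\<tau>\<^sup>2 * cmod (osc_ft (mult_b \<tau>) 0))"

context
  fixes \<tau> :: real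
  assumes \<tau>: "0 < \<tau>" "\<tau> \<le> 1" and nz: "osc_ft (mult_b \<tau>) 0 \<noteq> 0"
begin

lemma biorth_bound_pos: "0 < biorth_bound \<tau>"
  using \<tau> nz by (simp add: biorth_bound_def)

lemma biorth_int_bound:
  assumes "1 \<le> m"
  shows "cmod (biorth \<tau> m (of_int k)) \<le> biorth_bound \<tau> / (1 + (real_of_int k - (real m)\<^sup>2)\<^sup>2)"
  using biorth_integer_bound[OF \<tau> assms nz, of "real_of_int k"] by (simp add: biorth_bound_def)

text \<open>Terms k and -k are paired to form an ordinary series, for which the bound at the
  integers is a summable majorant. Uniformity later yields continuity and the passage to the limit
  in norms and integrals.\<close>

lemma partial_series_uniform_limit:
  assumes m: "1 \<le> m"
  shows "uniform_limit UNIV (partial_series \<tau> m) (biorth_time \<tau> m) sequentially"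
proof -
  define a where "a = (\<lambda>k. biorth \<tau> m (of_int k))"
  define T where "T = (\<lambda>n t. if n = 0 then a 0 else a (int n) * cis (- (real n * t)) + a (- int n) * cis (real n * t))"
  have sumT: "(\<Sum>n<Suc N. T n t) = (\<Sum>k\<in>{- int N..int N}. a k * cis (- (of_int k * t)))" for N t
  proof (induction N)
    case 0 show ?case by (simp add: T_def)
  next
    case (Suc N)
    have "(\<Sum>n<Suc (Suc N). T n t) = (\<Sum>n<Suc N. T n t) + T (Suc N) t" by simp
    moreover have "T (Suc N) t = a (int (Suc N)) * cis (- (of_int (int (Suc N)) * t)) +
        a (- int (Suc N)) * cis (- (of_int (- int (Suc N)) * t))"
      by (simp add: T_def del: of_nat_Suc)
    ultimately show ?case unfolding Suc sum_int_symmetric_Suc by (simp only:)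
  qed
  define b where "b = (\<lambda>n. if n = 0 then cmod (a 0) else cmod (a (int n)) + cmod (a (- int n)))"
  have sumb: "(\<Sum>n<Suc N. b n) = (\<Sum>k\<in>{- int N..int N}. cmod (a k))" for N
  proof (induction N)
    case 0 show ?case by (simp add: b_def)
  next
    case (Suc N)
    have "(\<Sum>n<Suc (Suc N). b n) = (\<Sum>n<Suc N. b n) + b (Suc N)" by simp
    then show ?case unfolding Suc sum_int_symmetric_Suc by (simp add: b_def)
  qed
  have b0: "0 \<le> b n" for n by (simp add: b_def)
  have "summable b"
  proof (rule bounded_imp_summable[OF b0])
    fix N
    have "(\<Sum>n\<le>N. b n) = (\<Sum>k\<in>{- int N..int N}. cmod (a k))"
      using sumb[of N] by (simp only: lessThan_Suc_atMost)
    also have "\<dots> \<le> (\<Sum>k\<in>{- int N..int N}. biorth_bound \<tau> * (1 / (1 + (real_of_int (k - int (m\<^sup>2)))\<^sup>2)))"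
      using biorth_int_bound[OF m] by (intro sum_mono) (simp add: a_def)
    also have "\<dots> = biorth_bound \<tau> * (\<Sum>j\<in>(\<lambda>k. k - int (m\<^sup>2)) ` {- int N..int N}. 1 / (1 + (real_of_int j)\<^sup>2))"
      by (subst sum.reindex) (auto simp: inj_on_def sum_distrib_left)
    also have "\<dots> \<le> biorth_bound \<tau> * 5"
      using biorth_bound_pos by (intro mult_left_mono sum_inverse_square_le) auto
    finally show "(\<Sum>n\<le>N. b n) \<le> biorth_bound \<tau> * 5" .
  qed
  then have "uniform_limit UNIV (\<lambda>N t. \<Sum>n<N. T n t) (\<lambda>t. suminf (\<lambda>n. T n t)) sequentially"
  proof (rule Weierstrass_m_test[rotated])
    fix n t
    show "norm (T n t) \<le> b n"
      by (auto simp: T_def b_def norm_mult intro!: order_trans[OF norm_triangle_ineq])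
  qed
  then have "uniform_limit UNIV (\<lambda>N t. \<Sum>n<Suc N. T n t) (\<lambda>t. suminf (\<lambda>n. T n t)) sequentially"
    by (rule filterlim_compose[OF _ filterlim_Suc])
  then have "uniform_limit UNIV (\<lambda>N t. (\<Sum>n<Suc N. T n t) / of_real (2 * pi)) (\<lambda>t. suminf (\<lambda>n. T n t) / of_real (2 * pi)) sequentially"
    unfolding divide_inverse by (intro bounded_linear_uniform_limit_intros)
  then have *: "uniform_limit UNIV (partial_series \<tau> m) (\<lambda>t. suminf (\<lambda>n. T n t) / of_real (2 * pi)) sequentially"
    by (simp only: sumT partial_series_def[abs_def] a_def)
  have "(\<lambda>N. partial_series \<tau> m N t) \<longlonglongrightarrow> suminf (\<lambda>n. T n t) / of_real (2 * pi)" for t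
    using tendsto_uniform_limitI[OF *] by simp
  then have "biorth_time \<tau> m = (\<lambda>t. suminf (\<lambda>n. T n t) / of_real (2 * pi))"
    unfolding biorth_time_def by (intro ext limI)
  with * show ?thesis by simp
qed

lemma continuous_biorth_time:
  assumes m: "1 \<le> m" shows "continuous_on A (biorth_time \<tau> m)"
proof -
  have "continuous_on UNIV (biorth_time \<tau> m)"
    by (rule uniform_limit_theorem[OF _ partial_series_uniform_limit[OF m]])
      (auto simp: partial_series_def intro!: always_eventually continuous_intros)
  then show ?thesis by (rule continuous_on_subset) simp
qed

text \<open>For \<tau> < t < 2 \<pi> - \<tau> the series sums to 0 by the residue argument; negative
  t are moved into this range by the period 2 \<pi>.\<close>

lemma biorth_time_support:
  assumes m: "1 \<le> m" and t: "\<tau> < \<bar>t\<bar>" "\<bar>t\<bar> \<le> pi"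
  shows "biorth_time \<tau> m t = 0"
proof -
  have pi1: "1 < pi" using pi_gt3 by simp
  have pos: "biorth_time \<tau> m s = 0" if s: "\<tau> < s" "s < 2 * pi - \<tau>" for s
  proof -
    obtain C where C: "0 \<le> C" "\<And>z. 1 \<le> cmod (z - of_real ((real m)\<^sup>2)) \<Longrightarrow>
     cmod (biorth \<tau> m z) \<le> C * exp (\<tau> * \<bar>Im z\<bar>) / (cmod (z - of_real ((real m)\<^sup>2)))\<^sup>2"
      using biorth_type_bound[OF \<tau> m nz] by blast
    have "(\<lambda>N. \<Sum>k\<in>{-int N..int N}. biorth \<tau> m (of_int k) * exp (- \<i> * of_real s * of_int k)) \<longlonglongrightarrow> 0"
      by (rule paley_wiener_periodic[OF holomorphic_biorth[OF \<tau> m nz] C(2) C(1) s]) (use \<tau> in auto)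
    then have "(\<lambda>N. (\<Sum>k\<in>{-int N..int N}. biorth \<tau> m (of_int k) * exp (- \<i> * of_real s * of_int k)) / of_real (2 * pi)) \<longlonglongrightarrow> 0"
      using tendsto_divide_zero by blast
    moreover have "exp (- \<i> * of_real s * of_int k) = cis (- (of_int k * s))" for k
      by (simp add: cis_conv_exp mult_ac)
    ultimately have "(\<lambda>N. partial_series \<tau> m N s) \<longlonglongrightarrow> 0"
      by (simp only: partial_series_def)
    then show ?thesis unfolding biorth_time_def by (rule limI)
  qed
  show ?thesis
  proof (cases "0 \<le> t")
    case True then show ?thesis using t \<tau> pi1 by (intro pos) auto
  next
    case False
    have "partial_series \<tau> m N t = partial_series \<tau> m N (t + 2 * pi)" for N
    proof -
      have "cis (- (of_int k * (t + 2 * pi))) = cis (- (of_int k * t))" for k :: int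
      proof -
        have "cis (- (of_int k * (t + 2 * pi))) = cis (- (of_int k * t)) * cis (2 * pi * of_int (- k))"
          by (simp add: cis_mult algebra_simps)
        also have "cis (2 * pi * of_int (- k)) = 1" by (rule cis_multiple_2pi) simp
        finally show ?thesis by simp
      qed
      then show ?thesis by (simp only: partial_series_def)
    qed
    then have "biorth_time \<tau> m t = biorth_time \<tau> m (t + 2 * pi)" by (simp only: biorth_time_def)
    also have "\<dots> = 0" using False t by (intro pos) auto
    finally show ?thesis .
  qed
qed

text \<open>Parseval over the period turns the norm into the l^2 norm of the Fourier coefficients,
  to which the Schur test applies. A moment with frequency n^2 is a Fourier coefficient, hence a
  combination of values of \<open>biorth\<close> at a square, which are 0 or 1. Vanishing outside
  [-\<tau>, \<tau>] lets integrals over the period and over the short interval be exchanged.\<close>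

lemma biorth_time_combination:
  fixes c :: "nat \<Rightarrow> complex"
  assumes I: "finite I" "\<And>m. m \<in> I \<Longrightarrow> 1 \<le> m"
  defines "v \<equiv> \<lambda>t. \<Sum>m\<in>I. c m * biorth_time \<tau> m t"
  shows "l2norm (lebesgue_on {-\<tau><..<\<tau>}) v \<le> 5 * biorth_bound \<tau> * sqrt (\<Sum>m\<in>I. (cmod (c m))\<^sup>2)"
    and "1 \<le> n \<Longrightarrow> (LINT t|lebesgue_on {-\<tau><..<\<tau>}. v t * cis ((real n)\<^sup>2 * t)) = (if n \<in> I then c n else 0)"
    and "continuous_on A v"
proof -
  have pi1: "1 < pi" using pi_gt3 by simp
  let ?M = "lebesgue_on {-pi<..<pi}"
  have P: "2 * pi = 2 * pi / 1" and ppi: "- pi + 2 * pi = pi" by auto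
  define V where "V = (\<lambda>N t. \<Sum>m\<in>I. c m * partial_series \<tau> m N t)"
  define d where "d = (\<lambda>k. (\<Sum>m\<in>I. c m * biorth \<tau> m (of_int k)) / of_real (2 * pi))"
  have V: "V N t = (\<Sum>k\<in>{- int N..int N}. d k * cis (- (of_int k * t)))" for N t
  proof -
    have "V N t = (\<Sum>m\<in>I. \<Sum>k\<in>{- int N..int N}. c m * biorth \<tau> m (of_int k) / of_real (2 * pi) * cis (- (of_int k * t)))"
      by (simp add: V_def partial_series_def sum_distrib_left sum_divide_distrib mult.assoc)
    also have "\<dots> = (\<Sum>k\<in>{- int N..int N}. \<Sum>m\<in>I. c m * biorth \<tau> m (of_int k) / of_real (2 * pi) * cis (- (of_int k * t)))"
      by (rule sum.swap)
    finally show ?thesis by (simp add: d_def sum_distrib_right sum_divide_distrib)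
  qed
  have lim: "uniform_limit UNIV V v sequentially"
    unfolding V_def v_def
    using I(2) by (intro uniform_limit_sum bounded_linear_uniform_limit_intros partial_series_uniform_limit) auto
  show cv: "continuous_on A v" for A unfolding v_def
    using I(2) by (intro continuous_intros continuous_biorth_time) auto
  have cV: "continuous_on A (V N)" for A N unfolding V by (intro continuous_intros)
  have sub: "{-\<tau><..<\<tau>} \<subseteq> {-pi<..<pi}" using \<tau> pi1 by auto
  have sqv: "sq_int ?M v" by (intro continuous_sq_int cv)
  have sqV: "sq_int ?M (V N)" for N by (intro continuous_sq_int cV)
  have lim': "uniform_limit {-pi..pi} V v sequentially" by (rule uniform_limit_on_subset[OF lim]) simp
  have diff: "(\<lambda>N. l2norm ?M (\<lambda>t. V N t - v t)) \<longlonglongrightarrow> 0"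
    using pi1 by (intro l2norm_uniform_limit(2) cV lim') simp
  then have diff': "(\<lambda>N. l2norm ?M (\<lambda>t. v t - V N t)) \<longlonglongrightarrow> 0"
    by (simp add: l2norm_diff_commute[of ?M v])
  have nV: "l2norm ?M (V N) \<le> 5 * biorth_bound \<tau> * sqrt (\<Sum>m\<in>I. (cmod (c m))\<^sup>2)" for N
  proof -
    let ?F = "{- int N..int N}"
    \<comment> \<open>The series carries the frequencies -k; reflecting the symmetric range brings
      it into the form of \<open>trig_poly_l2norm\<close>.\<close>
    have Veq: "V N = (\<lambda>t. \<Sum>k\<in>?F. d (- k) * cis (of_int k * 1 * t))"
      unfolding V by (rule ext, rule sum.reindex_bij_witness[of _ uminus uminus]) auto
    have "(l2norm ?M (V N))\<^sup>2 = 2 * pi * (\<Sum>k\<in>?F. (cmod (d (- k)))\<^sup>2)"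
      using trig_poly_l2norm[OF zero_less_one P, of ?F "- pi" "\<lambda>k. d (- k)"] unfolding Veq ppi by simp
    also have "(\<Sum>k\<in>?F. (cmod (d (- k)))\<^sup>2) = (\<Sum>k\<in>?F. (cmod (d k))\<^sup>2)"
      by (rule sum.reindex_bij_witness[of _ uminus uminus]) auto
    also have "\<dots> = (\<Sum>k\<in>?F. (cmod (\<Sum>m\<in>I. c m * biorth \<tau> m (of_int k)))\<^sup>2) / (2 * pi)\<^sup>2"
      by (simp only: d_def norm_divide power_divide norm_of_real power2_abs sum_divide_distrib[symmetric])
    also have "2 * pi * \<dots> = (\<Sum>k\<in>?F. (cmod (\<Sum>m\<in>I. c m * biorth \<tau> m (of_int k)))\<^sup>2) / (2 * pi)"
      by (simp add: power2_eq_square)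
    also have "\<dots> \<le> (\<Sum>k\<in>?F. (cmod (\<Sum>m\<in>I. c m * biorth \<tau> m (of_int k)))\<^sup>2) / 1"
      using pi1 by (intro divide_left_mono sum_nonneg) auto
    also have "\<dots> \<le> (5 * biorth_bound \<tau>)\<^sup>2 * (\<Sum>m\<in>I. (cmod (c m))\<^sup>2)"
      unfolding div_by_1 using biorth_bound_pos I by (intro schur_test biorth_int_bound) auto
    finally have "l2norm ?M (V N) \<le> sqrt ((5 * biorth_bound \<tau>)\<^sup>2 * (\<Sum>m\<in>I. (cmod (c m))\<^sup>2))"
      by (rule real_le_rsqrt)
    then show ?thesis using biorth_bound_pos by (simp add: real_sqrt_mult)
  qed
  have "l2norm ?M v \<le> 5 * biorth_bound \<tau> * sqrt (\<Sum>m\<in>I. (cmod (c m))\<^sup>2)"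
  proof (rule LIMSEQ_le_const)
    show "(\<lambda>N. 5 * biorth_bound \<tau> * sqrt (\<Sum>m\<in>I. (cmod (c m))\<^sup>2) + l2norm ?M (\<lambda>t. v t - V N t)) \<longlonglongrightarrow>
        5 * biorth_bound \<tau> * sqrt (\<Sum>m\<in>I. (cmod (c m))\<^sup>2)"
      using tendsto_add[OF tendsto_const diff'] by simp
    show "\<exists>N. \<forall>n\<ge>N. l2norm ?M v \<le> 5 * biorth_bound \<tau> * sqrt (\<Sum>m\<in>I. (cmod (c m))\<^sup>2) + l2norm ?M (\<lambda>t. v t - V n t)"
      using l2norm_triangle_diff[OF sqv sqV] nV by (meson add_right_mono order_trans)
  qed
  moreover have "l2norm (lebesgue_on {-\<tau><..<\<tau>}) v \<le> l2norm ?M v"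
    by (rule sq_int_subset(2)[OF _ _ sub sqv]) auto
  ultimately show "l2norm (lebesgue_on {-\<tau><..<\<tau>}) v \<le> 5 * biorth_bound \<tau> * sqrt (\<Sum>m\<in>I. (cmod (c m))\<^sup>2)" by simp
  assume n: "1 \<le> n"
  let ?e = "\<lambda>t. cis ((real n)\<^sup>2 * t)"
  have sqe: "sq_int ?M ?e" by (intro continuous_sq_int continuous_intros)
  have "(LINT t|lebesgue_on {-\<tau><..<\<tau>}. v t * ?e t) = (LINT t|?M. v t * ?e t)"
  proof -
    have z: "v t = 0" if "\<tau> < \<bar>t\<bar>" "\<bar>t\<bar> \<le> pi" for t
      unfolding v_def using biorth_time_support[OF I(2) that] by simp
    have "(LINT t|?M. v t * ?e t) = (LINT t|?M. (if t \<in> {-\<tau>..\<tau>} then v t * ?e t else 0))"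
      using z by (intro Bochner_Integration.integral_cong refl) auto
    also have "\<dots> = (LINT t|lebesgue_on {-\<tau>..\<tau>}. v t * ?e t)"
      using \<tau> pi1 by (intro integral_restrict) auto
    also have "\<dots> = integral {-\<tau>..\<tau>} (\<lambda>t. v t * ?e t)"
      by (intro lebesgue_integral_eq_integral continuous_imp_integrable_real continuous_intros cv) auto
    also have "\<dots> = (LINT t|lebesgue_on {-\<tau><..<\<tau>}. v t * ?e t)"
      by (intro continuous_integrable_open_interval(2)[symmetric] continuous_intros cv)
    finally show ?thesis by simp
  qed
  also have "\<dots> = 2 * pi * d ((int n)\<^sup>2)"
  proof (rule LIMSEQ_unique)
    show "(\<lambda>N. LINT t|?M. V N t * ?e t) \<longlonglongrightarrow> (LINT t|?M. v t * ?e t)"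
      by (rule l2_tendsto_integral[OF sqV sqv sqe diff])
    \<comment> \<open>As soon as N reaches n^2, the frequency n^2 occurs in the partial sum, and
      orthogonality makes the integral independent of N.\<close>
    have "(LINT t|?M. V N t * ?e t) = 2 * pi * d ((int n)\<^sup>2)" if N: "n\<^sup>2 \<le> N" for N
    proof -
      let ?F = "{- int N..int N}"
      have i: "integrable ?M (\<lambda>t. cis (of_int j * 1 * t))" for j :: int
        by (intro continuous_integrable_open_interval continuous_intros)
      have orth: "(LINT t|?M. cis (of_int j * 1 * t)) = (if j = 0 then of_real (2 * pi) else 0)" for j :: int
        using trig_orthogonal[OF zero_less_one P, of "- pi" j] unfolding ppi .
      have "(LINT t|?M. V N t * ?e t) = (LINT t|?M. (\<Sum>k\<in>?F. d k * cis (of_int ((int n)\<^sup>2 - k) * 1 * t)))"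
        unfolding V sum_distrib_right
        by (intro Bochner_Integration.integral_cong sum.cong refl) (simp add: cis_mult algebra_simps)
      also have "\<dots> = (\<Sum>k\<in>?F. (LINT t|?M. d k * cis (of_int ((int n)\<^sup>2 - k) * 1 * t)))"
        by (intro Bochner_Integration.integral_sum integrable_mult_right i)
      also have "\<dots> = (\<Sum>k\<in>?F. d k * (LINT t|?M. cis (of_int ((int n)\<^sup>2 - k) * 1 * t)))"
        by (simp only: integral_mult_right_zero)
      also have "\<dots> = (\<Sum>k\<in>?F. if k = (int n)\<^sup>2 then 2 * pi * d k else 0)"
        unfolding orth by (intro sum.cong refl) auto
      also have "\<dots> = 2 * pi * d ((int n)\<^sup>2)"
      proof -
        have "int (n\<^sup>2) \<le> int N" using N by (simp only: of_nat_le_iff)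
        then have "(int n)\<^sup>2 \<in> ?F" by (auto intro: order_trans[of _ 0])
        then show ?thesis by (simp add: sum.delta)
      qed
      finally show ?thesis .
    qed
    then show "(\<lambda>N. LINT t|?M. V N t * ?e t) \<longlonglongrightarrow> 2 * pi * d ((int n)\<^sup>2)"
      by (intro tendsto_eventually eventually_sequentiallyI[of "n\<^sup>2"])
  qed
  also have "\<dots> = (\<Sum>m\<in>I. c m * biorth \<tau> m ((of_nat n)\<^sup>2))"
    by (simp add: d_def)
  also have "\<dots> = (\<Sum>m\<in>I. if m = n then c n else 0)"
    by (rule sum.cong[OF refl]) (simp add: biorth_square[OF \<tau> I(2) nz n])
  also have "\<dots> = (if n \<in> I then c n else 0)" using I by (simp add: sum.delta)
  finally show "(LINT t|lebesgue_on {-\<tau><..<\<tau>}. v t * ?e t) = (if n \<in> I then c n else 0)" .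
qed

text \<open>The bound for finite combinations does not depend on their size, so the partial sums are
  Cauchy in the mean. The limit inherits the norm bound and the moments, each moment being
  eventually constant along the partial sums.\<close>

theorem moment_problem:
  fixes c :: "nat \<Rightarrow> complex"
  assumes c: "summable (\<lambda>n. (cmod (c n))\<^sup>2)"
  shows "\<exists>v. sq_int (lebesgue_on {-\<tau><..<\<tau>}) v \<and>
    (\<forall>n\<ge>1. (LINT t|lebesgue_on {-\<tau><..<\<tau>}. v t * cis ((real n)\<^sup>2 * t)) = c n) \<and>
    l2norm (lebesgue_on {-\<tau><..<\<tau>}) v \<le> 5 * biorth_bound \<tau> * sqrt (\<Sum>n. (cmod (c n))\<^sup>2)"
proof -
  let ?M = "lebesgue_on {-\<tau><..<\<tau>}"
  define v where "v = (\<lambda>N t. \<Sum>m\<in>{1..<N}. c m * biorth_time \<tau> m t)"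
  have cv: "continuous_on A (v N)" for A N
    unfolding v_def by (rule biorth_time_combination(3)) auto
  have sqv: "sq_int ?M (v N)" for N by (intro continuous_sq_int cv)
  have mono: "sqrt (\<Sum>m\<in>F. (cmod (c m))\<^sup>2) \<le> sqrt (\<Sum>n. (cmod (c n))\<^sup>2)" if "finite F" for F
    using that by (intro real_sqrt_le_mono sum_le_suminf c) auto
  have dv: "l2norm ?M (\<lambda>t. v n t - v m t) \<le> 5 * biorth_bound \<tau> * sqrt (\<Sum>k\<in>{m..<n}. (cmod (c k))\<^sup>2)" if "1 \<le> m" "m \<le> n" for m n
  proof -
    have "{1..<n} = {1..<m} \<union> {m..<n}" "{1..<m} \<inter> {m..<n} = {}" using that by auto
    then have "(\<lambda>t. v n t - v m t) = (\<lambda>t. \<Sum>k\<in>{m..<n}. c k * biorth_time \<tau> k t)"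
      by (simp add: v_def sum.union_disjoint fun_eq_iff)
    then show ?thesis using that by (simp only:) (rule biorth_time_combination(1); auto)
  qed
  have "(l2norm ?M (\<lambda>t. v n t - v m t))\<^sup>2 \<le> (5 * biorth_bound \<tau>)\<^sup>2 * (\<Sum>k\<in>{m..<n}. (cmod (c k))\<^sup>2)" if "1 \<le> m" "m \<le> n" for m n
    using power_mono[OF dv[OF that], of 2] by (simp add: power_mult_distrib sum_nonneg)
  from riesz_fischer_series[OF sqv c this] obtain w where w: "sq_int ?M w"
    and lim: "(\<lambda>N. l2norm ?M (\<lambda>t. v N t - w t)) \<longlonglongrightarrow> 0"
    using biorth_bound_pos by auto
  have "(LINT t|?M. w t * cis ((real n)\<^sup>2 * t)) = c n" if n: "1 \<le> n" for n
  proof (rule LIMSEQ_unique)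
    show "(\<lambda>N. LINT t|?M. v N t * cis ((real n)\<^sup>2 * t)) \<longlonglongrightarrow> (LINT t|?M. w t * cis ((real n)\<^sup>2 * t))"
      by (rule l2_tendsto_integral[OF sqv w _ lim]) (intro continuous_sq_int continuous_intros)
    have "(LINT t|?M. v N t * cis ((real n)\<^sup>2 * t)) = c n" if "Suc n \<le> N" for N
      unfolding v_def using biorth_time_combination(2)[of "{1..<N}" n c] n that by auto
    then show "(\<lambda>N. LINT t|?M. v N t * cis ((real n)\<^sup>2 * t)) \<longlonglongrightarrow> c n"
      by (intro tendsto_eventually eventually_sequentiallyI[of "Suc n"])
  qed
  moreover have "l2norm ?M w \<le> 5 * biorth_bound \<tau> * sqrt (\<Sum>n. (cmod (c n))\<^sup>2)"
  proof (rule LIMSEQ_le_const)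
    show "(\<lambda>N. 5 * biorth_bound \<tau> * sqrt (\<Sum>n. (cmod (c n))\<^sup>2) + l2norm ?M (\<lambda>t. v N t - w t)) \<longlonglongrightarrow>
        5 * biorth_bound \<tau> * sqrt (\<Sum>n. (cmod (c n))\<^sup>2)"
      using tendsto_add[OF tendsto_const lim] by simp
    have "l2norm ?M w \<le> 5 * biorth_bound \<tau> * sqrt (\<Sum>n. (cmod (c n))\<^sup>2) + l2norm ?M (\<lambda>t. v N t - w t)" for N
    proof -
      have "l2norm ?M (v N) \<le> 5 * biorth_bound \<tau> * sqrt (\<Sum>m\<in>{1..<N}. (cmod (c m))\<^sup>2)"
        unfolding v_def by (rule biorth_time_combination(1)) auto
      also have "\<dots> \<le> 5 * biorth_bound \<tau> * sqrt (\<Sum>n. (cmod (c n))\<^sup>2)"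
        using biorth_bound_pos by (intro mult_left_mono mono) auto
      finally show ?thesis
        using l2norm_triangle_diff[OF w sqv, of N] l2norm_diff_commute[of ?M w "v N"] by linarith
    qed
    then show "\<exists>N. \<forall>n\<ge>N. l2norm ?M w \<le> 5 * biorth_bound \<tau> * sqrt (\<Sum>n. (cmod (c n))\<^sup>2) + l2norm ?M (\<lambda>t. v n t - w t)"
      by blast
  qed
  ultimately show ?thesis using w by blast
qed

end

section \<open>Sine series\<close>

text \<open>With \<theta> = \<pi> x / L, multiplication by cos \<theta> turns sin(j \<theta>) into
  the mean of the neighbouring sines, so orthogonality to all sines extends to sin \<theta> times
  every polynomial in cos \<theta>. Weierstrass approximation in the variable cos \<theta> then
  shows that H = h sin \<theta> vanishes.\<close>

lemma sine_uniqueness_real: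
  fixes h :: "real \<Rightarrow> real"
  assumes L: "0 < L" and h: "continuous_on {0..L} h"
    and orth: "\<And>n. 1 \<le> n \<Longrightarrow> integral {0..L} (\<lambda>x. h x * sin (real n * pi * x / L)) = 0"
    and x: "0 < x" "x < L"
  shows "h x = 0"
proof -
  define \<theta> where "\<theta> = (\<lambda>x. pi * x / L)"
  have c\<theta>: "continuous_on A \<theta>" for A unfolding \<theta>_def by (intro continuous_intros) (use L in auto)
  have int: "(\<lambda>x. h x * (cos (\<theta> x))^k * sin (real j * \<theta> x)) integrable_on {0..L}" for k j
    by (intro integrable_continuous_real continuous_intros h c\<theta>)
  have A: "integral {0..L} (\<lambda>x. h x * (cos (\<theta> x))^k * sin (real j * \<theta> x)) = 0" for k j
  proof (induction k arbitrary: j)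
    case 0
    show ?case
    proof (cases "j = 0")
      case False
      then show ?thesis using orth[of j] by (simp add: \<theta>_def mult.assoc)
    qed simp
  next
    case (Suc k)
    show ?case
    proof (cases j)
      case 0 then show ?thesis by simp
    next
      case (Suc i)
      have "h x * (cos (\<theta> x))^Suc k * sin (real j * \<theta> x) =
          h x * (cos (\<theta> x))^k * sin (real (Suc j) * \<theta> x) / 2 + h x * (cos (\<theta> x))^k * sin (real i * \<theta> x) / 2" for x
      proof -
        have "sin (real j * \<theta> x) * cos (\<theta> x) = (sin (real j * \<theta> x + \<theta> x) + sin (real j * \<theta> x - \<theta> x)) / 2"
          by (rule sin_times_cos)
        also have "real j * \<theta> x + \<theta> x = real (Suc j) * \<theta> x" by (simp add: algebra_simps)
        also have "real j * \<theta> x - \<theta> x = real i * \<theta> x" by (simp add: Suc algebra_simps)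
        finally have "h x * (cos (\<theta> x))^k * (sin (real j * \<theta> x) * cos (\<theta> x)) =
          h x * (cos (\<theta> x))^k * ((sin (real (Suc j) * \<theta> x) + sin (real i * \<theta> x)) / 2)" by simp
        then show ?thesis by (simp add: algebra_simps add_divide_distrib)
      qed
      then have "integral {0..L} (\<lambda>x. h x * (cos (\<theta> x))^Suc k * sin (real j * \<theta> x)) =
         integral {0..L} (\<lambda>x. h x * (cos (\<theta> x))^k * sin (real (Suc j) * \<theta> x) / 2) +
         integral {0..L} (\<lambda>x. h x * (cos (\<theta> x))^k * sin (real i * \<theta> x) / 2)"
        by (simp only:) (intro integral_add integrable_on_divide int)
      then show ?thesis using Suc.IH[of "Suc j"] Suc.IH[of i] by simp
    qed
  qed
  define H where "H = (\<lambda>x. h x * sin (\<theta> x))"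
  have cH: "continuous_on {0..L} H" unfolding H_def by (intro continuous_intros h c\<theta>)
  \<comment> \<open>H as a function of cos \<theta>, continuous on the closed interval [-1, 1]
    because arccos is.\<close>
  define G where "G = (\<lambda>c. H (L / pi * arccos c))"
  have rng: "L / pi * arccos c \<in> {0..L}" if "c \<in> {-1..1}" for c
    using that L arccos_lbound[of c] arccos_ubound[of c] by (auto simp: field_simps)
  have cG: "continuous_on {-1..1} G"
    unfolding G_def
  proof (rule continuous_on_compose2[OF cH])
    show "continuous_on {-1..1} (\<lambda>c. L / pi * arccos c)" by (intro continuous_intros) auto
    show "(\<lambda>c. L / pi * arccos c) ` {-1..1} \<subseteq> {0..L}" using rng by blast
  qed
  have GH: "G (cos (\<theta> x)) = H x" if "x \<in> {0..L}" for x
  proof -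
    have "arccos (cos (\<theta> x)) = \<theta> x"
      using that L by (intro arccos_cos) (auto simp: \<theta>_def field_simps)
    then show ?thesis using L by (simp add: G_def \<theta>_def)
  qed
  define K where "K = integral {0..L} (\<lambda>x. \<bar>H x\<bar>)"
  have K0: "0 \<le> K" unfolding K_def by (intro integral_nonneg integrable_continuous_real continuous_intros cH) auto
  \<comment> \<open>H is orthogonal to q(cos \<theta>), so the integral of H^2 equals that of H
    times G - q at cos \<theta>, which is at most e times the integral of |H|.\<close>
  have small: "integral {0..L} (\<lambda>x. (H x)\<^sup>2) \<le> e * K" if e: "0 < e" for e
  proof -
    obtain q where q: "real_polynomial_function q" "\<And>c. c \<in> {-1..1} \<Longrightarrow> \<bar>G c - q c\<bar> < e"
      using Stone_Weierstrass_real_polynomial_function[OF _ cG e] by auto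
    then obtain a n where qa: "q = (\<lambda>c. \<Sum>i\<le>n. a i * c ^ i)"
      using real_polynomial_function_iff_sum by blast
    have zero: "integral {0..L} (\<lambda>x. H x * q (cos (\<theta> x))) = 0"
    proof -
      have "(\<lambda>x. H x * q (cos (\<theta> x))) = (\<lambda>x. \<Sum>i\<le>n. a i * (h x * (cos (\<theta> x))^i * sin (real 1 * \<theta> x)))"
        by (simp add: H_def qa sum_distrib_left mult_ac)
      then have "integral {0..L} (\<lambda>x. H x * q (cos (\<theta> x))) =
          (\<Sum>i\<le>n. integral {0..L} (\<lambda>x. a i * (h x * (cos (\<theta> x))^i * sin (real 1 * \<theta> x))))"
        by (simp only:) (intro integral_sum integrable_on_mult_right int finite_atMost)
      then show ?thesis using A[of _ 1] by simp
    qed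
    have cq: "continuous_on {0..L} (\<lambda>x. q (cos (\<theta> x)))"
      unfolding qa by (intro continuous_intros c\<theta>)
    have "integral {0..L} (\<lambda>x. (H x)\<^sup>2) = integral {0..L} (\<lambda>x. (H x)\<^sup>2) - integral {0..L} (\<lambda>x. H x * q (cos (\<theta> x)))"
      using zero by simp
    also have "\<dots> = integral {0..L} (\<lambda>x. (H x)\<^sup>2 - H x * q (cos (\<theta> x)))"
      by (intro integral_diff[symmetric] integrable_continuous_real continuous_intros cH cq)
    also have "\<dots> \<le> integral {0..L} (\<lambda>x. e * \<bar>H x\<bar>)"
    proof (intro integral_le integrable_continuous_real continuous_intros cH cq)
      fix x assume x: "x \<in> {0..L}"
      have "(H x)\<^sup>2 - H x * q (cos (\<theta> x)) = H x * (G (cos (\<theta> x)) - q (cos (\<theta> x)))"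
        by (simp add: GH[OF x] power2_eq_square algebra_simps)
      also have "\<dots> \<le> \<bar>H x\<bar> * \<bar>G (cos (\<theta> x)) - q (cos (\<theta> x))\<bar>"
        by (metis abs_ge_self abs_mult)
      also have "\<dots> \<le> \<bar>H x\<bar> * e" using q(2)[of "cos (\<theta> x)"] by (intro mult_left_mono) auto
      finally show "(H x)\<^sup>2 - H x * q (cos (\<theta> x)) \<le> e * \<bar>H x\<bar>" by (simp add: mult.commute)
    qed
    also have "\<dots> = e * K" by (simp add: K_def)
    finally show ?thesis .
  qed
  have "integral {0..L} (\<lambda>x. (H x)\<^sup>2) \<le> 0"
  proof (rule field_le_epsilon)
    fix e :: real assume e: "0 < e"
    have "integral {0..L} (\<lambda>x. (H x)\<^sup>2) \<le> e / (K + 1) * K" using e K0 by (intro small) auto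
    also have "\<dots> \<le> e" using e K0 by (simp add: field_simps)
    finally show "integral {0..L} (\<lambda>x. (H x)\<^sup>2) \<le> 0 + e" by simp
  qed
  moreover have "0 \<le> integral {0..L} (\<lambda>x. (H x)\<^sup>2)"
    by (intro integral_nonneg integrable_continuous_real continuous_intros cH) auto
  ultimately have "integral {0..L} (\<lambda>x. (H x)\<^sup>2) = 0" by simp
  then have "\<forall>x\<in>{0..L}. (H x)\<^sup>2 = 0"
    using integral_eq_0_iff[of 0 L "\<lambda>x. (H x)\<^sup>2"] cH L by (auto intro!: continuous_intros)
  then have "H x = 0" using x by auto
  moreover have "0 < sin (\<theta> x)" using x L by (intro sin_gt_zero) (auto simp: \<theta>_def field_simps)
  ultimately show ?thesis by (simp add: H_def)
qed

section \<open>Sine and cosine modes\<close>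

definition sin_mode :: "real \<Rightarrow> nat \<Rightarrow> real \<Rightarrow> complex" where
  "sin_mode L n x = of_real (sin (real n * pi * x / L))"

definition cos_mode :: "real \<Rightarrow> nat \<Rightarrow> real \<Rightarrow> complex" where
  "cos_mode L n x = of_real (cos (real n * pi * x / L))"

lemma continuous_modes: "continuous_on A (sin_mode L n)" "continuous_on A (cos_mode L n)"
  unfolding sin_mode_def cos_mode_def divide_inverse by (intro continuous_intros)+

lemma norm_modes: "cmod (sin_mode L n x) \<le> 1" "cmod (cos_mode L n x) \<le> 1"
  by (simp_all add: sin_mode_def cos_mode_def)

lemma sin_mode_bdry [simp]: "sin_mode L n 0 = 0" "0 < L \<Longrightarrow> sin_mode L n L = 0" "sin_mode L 0 x = 0"
  by (simp_all add: sin_mode_def)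

lemma mode_derivs:
  assumes "0 < L"
  shows "(sin_mode L n has_vector_derivative of_real (real n * pi / L) * cos_mode L n x) (at x within A)"
    and "(cos_mode L n has_vector_derivative - (of_real (real n * pi / L) * sin_mode L n x)) (at x within A)"
proof -
  have "((\<lambda>x. sin (real n * pi * x / L)) has_vector_derivative (real n * pi / L) * cos (real n * pi * x / L)) (at x within A)"
    using assms by (auto intro!: derivative_eq_intros simp flip: has_real_derivative_iff_has_vector_derivative)
  then have "((\<lambda>x. complex_of_real (sin (real n * pi * x / L))) has_vector_derivative
      of_real ((real n * pi / L) * cos (real n * pi * x / L))) (at x within A)"
    by (rule bounded_linear.has_vector_derivative[OF bounded_linear_of_real])
  then show "(sin_mode L n has_vector_derivative of_real (real n * pi / L) * cos_mode L n x) (at x within A)"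
    by (simp add: sin_mode_def[abs_def] cos_mode_def)
  have "((\<lambda>x. cos (real n * pi * x / L)) has_vector_derivative - ((real n * pi / L) * sin (real n * pi * x / L))) (at x within A)"
    using assms by (auto intro!: derivative_eq_intros simp flip: has_real_derivative_iff_has_vector_derivative)
  then have "((\<lambda>x. complex_of_real (cos (real n * pi * x / L))) has_vector_derivative
      of_real (- ((real n * pi / L) * sin (real n * pi * x / L)))) (at x within A)"
    by (rule bounded_linear.has_vector_derivative[OF bounded_linear_of_real])
  then show "(cos_mode L n has_vector_derivative - (of_real (real n * pi / L) * sin_mode L n x)) (at x within A)"
    by (simp add: cos_mode_def[abs_def] sin_mode_def)
qed

lemma sine_uniqueness:
  fixes f :: "real \<Rightarrow> complex"
  assumes L: "0 < L" and f: "continuous_on {0..L} f" and bdry: "f 0 = 0" "f L = 0"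
    and orth: "\<And>n. 1 \<le> n \<Longrightarrow> integral {0..L} (\<lambda>x. f x * sin_mode L n x) = 0"
    and x: "x \<in> {0..L}"
  shows "f x = 0"
proof (cases "0 < x \<and> x < L")
  case False
  then show ?thesis using x bdry by (cases "x = 0") auto
next
  case True
  have i: "(\<lambda>x. f x * sin_mode L n x) integrable_on {0..L}" for n
    by (intro integrable_continuous_real continuous_intros f continuous_modes)
  have "Re (f x) = 0"
  proof (rule sine_uniqueness_real[where h="\<lambda>x. Re (f x)", OF L])
    show "continuous_on {0..L} (\<lambda>x. Re (f x))" by (intro continuous_intros f)
    show "integral {0..L} (\<lambda>x. Re (f x) * sin (real n * pi * x / L)) = 0" if "1 \<le> n" for n
      using has_integral_Re[OF integrable_integral[OF i[of n]]] orth[OF that]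
      by (simp add: sin_mode_def integral_unique)
  qed (use True in auto)
  moreover have "Im (f x) = 0"
  proof (rule sine_uniqueness_real[where h="\<lambda>x. Im (f x)", OF L])
    show "continuous_on {0..L} (\<lambda>x. Im (f x))" by (intro continuous_intros f)
    show "integral {0..L} (\<lambda>x. Im (f x) * sin (real n * pi * x / L)) = 0" if "1 \<le> n" for n
      using has_integral_Im[OF integrable_integral[OF i[of n]]] orth[OF that]
      by (simp add: sin_mode_def integral_unique)
  qed (use True in auto)
  ultimately show ?thesis by (simp add: complex_eq_iff)
qed

text \<open>Since g is merely integrable, its primitive need not be differentiable everywhere. The
  formula is instead Fubini on the triangle s < x, where the inner integral of f over (s, L) is F L
  - F s.\<close>

lemma indefinite_integral_by_parts:
  fixes g f F :: "real \<Rightarrow> complex"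
  assumes L: "0 < L" and g: "integrable (lebesgue_on {0<..<L}) g"
    and f: "continuous_on {0..L} f"
    and F: "\<And>x. x \<in> {0..L} \<Longrightarrow> (F has_vector_derivative f x) (at x within {0..L})"
  shows "(LINT x|lebesgue_on {0<..<L}. (LINT s|lebesgue_on {0<..<x}. g s) * f x)
    = (LINT s|lebesgue_on {0<..<L}. g s) * F L - (LINT s|lebesgue_on {0<..<L}. g s * F s)"
proof -
  let ?M = "lebesgue_on {0<..<L}"
  interpret finite_measure ?M by (rule finite_measure_lebesgue_on) simp
  interpret pair_sigma_finite ?M ?M ..
  have [measurable]: "g \<in> borel_measurable ?M" using g by auto
  have [measurable]: "f \<in> borel_measurable ?M"
    using borel_measurable_integrable[OF continuous_integrable_open_interval(1)[OF f]] .
  have [measurable]: "(\<lambda>x. x) \<in> measurable ?M borel"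
    by (intro borel_measurable_integrable continuous_integrable_open_interval(1) continuous_intros)
  obtain K where K: "\<And>x. x \<in> {0..L} \<Longrightarrow> cmod (f x) \<le> K" "0 \<le> K"
  proof -
    have "bounded (f ` {0..L})" by (intro compact_imp_bounded compact_continuous_image f) simp
    then show ?thesis using that unfolding bounded_iff
      by (metis imageI norm_ge_zero order_trans abs_ge_self abs_ge_zero)
  qed
  define k where "k = (\<lambda>s x. if s < x then g s * f x else 0)"
  have km: "case_prod k \<in> borel_measurable (?M \<Otimes>\<^sub>M ?M)"
    unfolding k_def split_def by measurable
  have "integrable (?M \<Otimes>\<^sub>M ?M) (\<lambda>(s, x). norm (g s) * K)"
  proof (rule Fubini_integrable)
    show "(\<lambda>(s, x). norm (g s) * K) \<in> borel_measurable (?M \<Otimes>\<^sub>M ?M)" by measurable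
    show "integrable ?M (\<lambda>s. LINT x|?M. norm (case (s, x) of (s, x) \<Rightarrow> norm (g s) * K))"
      using g by auto
  qed auto
  then have ki: "integrable (?M \<Otimes>\<^sub>M ?M) (case_prod k)"
  proof (rule Bochner_Integration.integrable_bound[OF _ km], intro AE_I2)
    fix p assume "p \<in> space (?M \<Otimes>\<^sub>M ?M)"
    then obtain s x where p: "p = (s, x)" "x \<in> {0..L}" by (auto simp: space_pair_measure)
    have "norm (g s * f x) \<le> norm (g s) * K"
      using K(1)[OF p(2)] by (simp add: norm_mult mult_left_mono)
    then show "norm (case_prod k p) \<le> norm (case p of (s, x) \<Rightarrow> norm (g s) * K)"
      using K(2) by (simp add: p(1) k_def)
  qed
  have "(LINT x|?M. (LINT s|?M. k s x)) = (LINT s|?M. (LINT x|?M. k s x))"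
    using Fubini_integral[OF ki] .
  also have "(LINT x|?M. (LINT s|?M. k s x)) = (LINT x|?M. (LINT s|lebesgue_on {0<..<x}. g s) * f x)"
  proof (rule Bochner_Integration.integral_cong[OF refl])
    fix x assume "x \<in> space ?M"
    then have x: "0 < x" "x < L" by auto
    have "(LINT s|?M. k s x) = (LINT s|?M. (if s \<in> {0<..<x} then g s * f x else 0))"
      unfolding k_def by (intro Bochner_Integration.integral_cong) auto
    also have "\<dots> = (LINT s|lebesgue_on {0<..<x}. g s * f x)"
      using x by (intro integral_restrict) auto
    finally show "(LINT s|?M. k s x) = (LINT s|lebesgue_on {0<..<x}. g s) * f x" by simp
  qed
  also have "(LINT s|?M. (LINT x|?M. k s x)) = (LINT s|?M. g s * F L - g s * F s)"
  proof (rule Bochner_Integration.integral_cong[OF refl])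
    fix s assume "s \<in> space ?M"
    then have s: "0 < s" "s < L" by auto
    have "(LINT x|?M. k s x) = (LINT x|?M. (if x \<in> {s<..<L} then g s * f x else 0))"
      unfolding k_def by (intro Bochner_Integration.integral_cong) auto
    also have "\<dots> = (LINT x|lebesgue_on {s<..<L}. g s * f x)"
      using s by (intro integral_restrict) auto
    also have "\<dots> = g s * (LINT x|lebesgue_on {s<..<L}. f x)" by simp
    also have "(LINT x|lebesgue_on {s<..<L}. f x) = integral {s..L} f"
      using s by (intro continuous_integrable_open_interval continuous_on_subset[OF f]) auto
    also have "\<dots> = F L - F s"
      using s by (intro integral_unique fundamental_theorem_of_calculus)
        (auto intro: has_vector_derivative_within_subset[OF F])
    finally show "(LINT x|?M. k s x) = g s * F L - g s * F s" by (simp add: algebra_simps)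
  qed
  also have "\<dots> = (LINT s|?M. g s) * F L - (LINT s|?M. g s * F s)"
  proof -
    have cF: "continuous_on {0..L} F"
      using F by (rule continuous_on_vector_derivative)
    have "integrable ?M (\<lambda>s. g s * F s)"
    proof -
      have [measurable]: "F \<in> borel_measurable ?M"
        using borel_measurable_integrable[OF continuous_integrable_open_interval(1)[OF cF]] .
      have "bounded (F ` {0..L})" by (intro compact_imp_bounded compact_continuous_image cF) simp
      then obtain B where "\<forall>y\<in>F ` {0..L}. cmod y \<le> B" unfolding bounded_iff by blast
      then have B: "\<And>x. x \<in> {0..L} \<Longrightarrow> cmod (F x) \<le> B" by blast
      show ?thesis
      proof (rule Bochner_Integration.integrable_bound)
        show "integrable ?M (\<lambda>s. norm (g s) * B)" using g by auto
        show "AE x in ?M. norm (g x * F x) \<le> norm (norm (g x) * B)"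
        proof (rule AE_I2)
          fix x assume "x \<in> space ?M"
          then have "cmod (F x) \<le> \<bar>B\<bar>" using B[of x] by auto
          then show "norm (g x * F x) \<le> norm (norm (g x) * B)"
            by (simp add: norm_mult abs_mult mult_left_mono)
        qed
      qed measurable
    qed
    then show ?thesis using g by (subst Bochner_Integration.integral_diff) auto
  qed
  finally show ?thesis .
qed

section \<open>Duality in the space of order minus one\<close>

lemma space_L2_iff: "f \<in> space_L2 a b \<longleftrightarrow> sq_int (lebesgue_on {a<..<b}) f"
  by (simp add: space_L2_def sq_int_def)

lemma norm_L2_eq: "norm_L2 a b f = l2norm (lebesgue_on {a<..<b}) f"
  by (simp add: norm_L2_def l2norm_def)

lemma sq_int_integrable:
  fixes f :: "real \<Rightarrow> complex"
  assumes "sq_int (lebesgue_on {a<..<b}) f" shows "integrable (lebesgue_on {a<..<b}) f"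
  using sq_int_mult_integrable[OF assms continuous_sq_int[OF continuous_on_const, of a b 1]] by simp

lemma open_interval_henstock:
  fixes f :: "real \<Rightarrow> 'b::euclidean_space"
  assumes "integrable (lebesgue_on {a<..<b}) f"
  shows "f integrable_on {a..b}" "(LINT x|lebesgue_on {a<..<b}. f x) = integral {a..b} f"
proof -
  have "(f has_integral integral\<^sup>L (lebesgue_on {a<..<b}) f) {a<..<b}"
    by (rule has_integral_integral_lebesgue_on[OF assms]) simp
  then have "(f has_integral integral\<^sup>L (lebesgue_on {a<..<b}) f) {a..b}"
    by (simp only: has_integral_Icc_iff_Ioo)
  then show "f integrable_on {a..b}" "(LINT x|lebesgue_on {a<..<b}. f x) = integral {a..b} f"
    by (auto simp: integral_unique)
qed

lemma indefinite_integral_henstock: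
  fixes f :: "real \<Rightarrow> 'b::euclidean_space"
  assumes f: "integrable (lebesgue_on {a<..<b}) f" and x: "x \<in> {a..b}"
  shows "(LINT s|lebesgue_on {a<..<x}. f s) = integral {a..x} f"
  using x by (intro open_interval_henstock(2) lebesgue_on_subset[OF _ _ _ f]) auto

lemma continuous_indefinite_integral:
  fixes f :: "real \<Rightarrow> 'b::euclidean_space"
  assumes f: "integrable (lebesgue_on {a<..<b}) f"
  shows "continuous_on {a..b} (\<lambda>x. LINT s|lebesgue_on {a<..<x}. f s)"
proof -
  have "continuous_on {a..b} (\<lambda>x. integral {a..x} f)"
    by (rule indefinite_integral_continuous_1[OF open_interval_henstock(1)[OF f]])
  then show ?thesis
    by (rule continuous_on_eq) (rule indefinite_integral_henstock[OF f, symmetric])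
qed

section \<open>Orthogonality and Bessel inequalities for the modes\<close>

lemma integral_cos_mode:
  fixes k :: int
  assumes L: "0 < L"
  shows "integral {0..L} (\<lambda>x. cos (of_int k * pi * x / L)) = (if k = 0 then L else 0)"
proof (cases "k = 0")
  case False
  have "((\<lambda>x. cos (of_int k * pi * x / L)) has_integral
      sin (of_int k * pi * L / L) * (L / (of_int k * pi)) - sin (of_int k * pi * 0 / L) * (L / (of_int k * pi))) {0..L}"
  proof (rule fundamental_theorem_of_calculus)
    fix x
    show "((\<lambda>x. sin (of_int k * pi * x / L) * (L / (of_int k * pi))) has_vector_derivative cos (of_int k * pi * x / L)) (at x within {0..L})"
      unfolding has_real_derivative_iff_has_vector_derivative[symmetric]
      using L False by (auto intro!: derivative_eq_intros)
  qed (use L in simp)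
  moreover have "sin (of_int k * pi * L / L) = 0" using L by (simp add: sin_zero_iff_int2)
  ultimately show ?thesis using False by (simp add: integral_unique)
qed (use L in simp)

text \<open>Products of modes are half sums or half differences of cosines with indices n - m and n
  + m. Indices start at 1, since the constant cosine has squared norm L instead of L / 2.\<close>

lemma mode_orthogonal:
  assumes L: "0 < L" and n: "1 \<le> n" "1 \<le> m"
  shows "(LINT x|lebesgue_on {0<..<L}. cos_mode L n x * cnj (cos_mode L m x)) = (if m = n then of_real (L/2) else 0)"
    and "(LINT x|lebesgue_on {0<..<L}. sin_mode L n x * cnj (sin_mode L m x)) = (if m = n then of_real (L/2) else 0)"
proof -
  have c: "continuous_on {0..L} (\<lambda>x. cos (of_int k * pi * x / L))" for k
    using L by (intro continuous_intros) auto
  let ?c = "\<lambda>k x. cos (of_int k * pi * x / L)"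
  have ang: "real n * pi * x / L - real m * pi * x / L = of_int (int n - int m) * pi * x / L"
    "real n * pi * x / L + real m * pi * x / L = of_int (int n + int m) * pi * x / L" for x
    by (simp_all add: diff_divide_distrib add_divide_distrib left_diff_distrib distrib_right)
  have cc: "cos (real n * pi * x / L) * cos (real m * pi * x / L) = (?c (int n - int m) x + ?c (int n + int m) x) / 2" for x
    unfolding cos_times_cos ang by simp
  have ss: "sin (real n * pi * x / L) * sin (real m * pi * x / L) = (?c (int n - int m) x - ?c (int n + int m) x) / 2" for x
    unfolding sin_times_sin ang by simp
  have nm: "int n + int m \<noteq> 0" "int n - int m = 0 \<longleftrightarrow> m = n" using n by auto
  have I: "(LINT x|lebesgue_on {0<..<L}. ?c k x) = (if k = 0 then L else 0)" for k
    using continuous_integrable_open_interval(2)[OF c, of k] integral_cos_mode[OF L, of k] by simp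
  have i: "integrable (lebesgue_on {0<..<L}) (?c k)" for k
    by (rule continuous_integrable_open_interval(1)[OF c])
  have "(LINT x|lebesgue_on {0<..<L}. cos_mode L n x * cnj (cos_mode L m x)) =
      of_real (LINT x|lebesgue_on {0<..<L}. (?c (int n - int m) x + ?c (int n + int m) x) / 2)"
    unfolding cc[symmetric] by (simp add: cos_mode_def flip: integral_complex_of_real)
  also have "(LINT x|lebesgue_on {0<..<L}. (?c (int n - int m) x + ?c (int n + int m) x) / 2) = (if m = n then L/2 else 0)"
    unfolding integral_divide_zero Bochner_Integration.integral_add[OF i i] I using nm by simp
  finally show "(LINT x|lebesgue_on {0<..<L}. cos_mode L n x * cnj (cos_mode L m x)) = (if m = n then of_real (L/2) else 0)"
    by simp
  have "(LINT x|lebesgue_on {0<..<L}. sin_mode L n x * cnj (sin_mode L m x)) =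
      of_real (LINT x|lebesgue_on {0<..<L}. (?c (int n - int m) x - ?c (int n + int m) x) / 2)"
    unfolding ss[symmetric] by (simp add: sin_mode_def flip: integral_complex_of_real)
  also have "(LINT x|lebesgue_on {0<..<L}. (?c (int n - int m) x - ?c (int n + int m) x) / 2) = (if m = n then L/2 else 0)"
    unfolding integral_divide_zero Bochner_Integration.integral_diff[OF i i] I using nm by simp
  finally show "(LINT x|lebesgue_on {0<..<L}. sin_mode L n x * cnj (sin_mode L m x)) = (if m = n then of_real (L/2) else 0)"
    by simp
qed

lemma mode_l2norm:
  assumes L: "0 < L" and F: "finite F" "0 \<notin> F"
  shows "(l2norm (lebesgue_on {0<..<L}) (\<lambda>x. \<Sum>n\<in>F. d n * cos_mode L n x))\<^sup>2 = L/2 * (\<Sum>n\<in>F. (cmod (d n))\<^sup>2)"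
    and "(l2norm (lebesgue_on {0<..<L}) (\<lambda>x. \<Sum>n\<in>F. d n * sin_mode L n x))\<^sup>2 = L/2 * (\<Sum>n\<in>F. (cmod (d n))\<^sup>2)"
proof -
  have F1: "1 \<le> n" if "n \<in> F" for n using that F by (cases n) auto
  have c: "sq_int (lebesgue_on {0<..<L}) (cos_mode L n)" and s: "sq_int (lebesgue_on {0<..<L}) (sin_mode L n)" for n
    by (intro continuous_sq_int continuous_modes)+
  show "(l2norm (lebesgue_on {0<..<L}) (\<lambda>x. \<Sum>n\<in>F. d n * cos_mode L n x))\<^sup>2 = L/2 * (\<Sum>n\<in>F. (cmod (d n))\<^sup>2)"
    by (rule l2norm_orthogonal_sum[OF F(1) c]) (rule mode_orthogonal(1)[OF L F1 F1])
  show "(l2norm (lebesgue_on {0<..<L}) (\<lambda>x. \<Sum>n\<in>F. d n * sin_mode L n x))\<^sup>2 = L/2 * (\<Sum>n\<in>F. (cmod (d n))\<^sup>2)"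
    by (rule l2norm_orthogonal_sum[OF F(1) s]) (rule mode_orthogonal(2)[OF L F1 F1])
qed

lemma mode_bessel:
  assumes L: "0 < L" and F: "finite F" "0 \<notin> F" and u: "sq_int (lebesgue_on {0<..<L}) u"
  shows "(\<Sum>n\<in>F. (cmod (LINT x|lebesgue_on {0<..<L}. u x * cos_mode L n x))\<^sup>2) \<le> L/2 * (l2norm (lebesgue_on {0<..<L}) u)\<^sup>2"
    and "(\<Sum>n\<in>F. (cmod (LINT x|lebesgue_on {0<..<L}. u x * sin_mode L n x))\<^sup>2) \<le> L/2 * (l2norm (lebesgue_on {0<..<L}) u)\<^sup>2"
proof -
  have c: "sq_int (lebesgue_on {0<..<L}) (cos_mode L n)" and s: "sq_int (lebesgue_on {0<..<L}) (sin_mode L n)" for n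
    by (intro continuous_sq_int continuous_modes)+
  have L2: "0 \<le> L/2" using L by simp
  show "(\<Sum>n\<in>F. (cmod (LINT x|lebesgue_on {0<..<L}. u x * cos_mode L n x))\<^sup>2) \<le> L/2 * (l2norm (lebesgue_on {0<..<L}) u)\<^sup>2"
    by (rule bessel_dual[OF F(1) c L2 _ u]) (simp only: mode_l2norm[OF L F] order_refl)
  show "(\<Sum>n\<in>F. (cmod (LINT x|lebesgue_on {0<..<L}. u x * sin_mode L n x))\<^sup>2) \<le> L/2 * (l2norm (lebesgue_on {0<..<L}) u)\<^sup>2"
    by (rule bessel_dual[OF F(1) s L2 _ u]) (simp only: mode_l2norm[OF L F] order_refl)
qed

section \<open>Weak derivatives and sine coefficients\<close>

lemma H10_derivD:
  assumes "H10_deriv L \<phi> g"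
  shows "sq_int (lebesgue_on {0<..<L}) g" "integrable (lebesgue_on {0<..<L}) g"
    "\<And>x. x \<in> {0..L} \<Longrightarrow> \<phi> x = (LINT s|lebesgue_on {0<..<x}. g s)" "\<phi> L = 0"
  using assms sq_int_integrable by (auto simp: H10_deriv_def space_L2_iff)

lemma H10_deriv_add:
  assumes "H10_deriv L \<phi> g" "H10_deriv L \<psi> h"
  shows "H10_deriv L (\<lambda>x. \<phi> x + \<psi> x) (\<lambda>x. g x + h x)"
proof -
  have "(LINT s|lebesgue_on {0<..<x}. g s + h s) = (LINT s|lebesgue_on {0<..<x}. g s) + (LINT s|lebesgue_on {0<..<x}. h s)"
    if "x \<in> {0..L}" for x
    using that by (intro Bochner_Integration.integral_add lebesgue_on_subset[OF _ _ _ H10_derivD(2)[OF assms(1)]]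
      lebesgue_on_subset[OF _ _ _ H10_derivD(2)[OF assms(2)]]) auto
  then show ?thesis
    using assms unfolding H10_deriv_def space_L2_iff by (auto intro: sq_int_add)
qed

lemma H10_deriv_cmult:
  assumes "H10_deriv L \<phi> g" shows "H10_deriv L (\<lambda>x. c * \<phi> x) (\<lambda>x. c * g x)"
  using assms unfolding H10_deriv_def space_L2_iff by (auto intro: sq_int_cmult)

lemma H10_deriv_zero: "H10_deriv L (\<lambda>x. 0) (\<lambda>x. 0)"
  by (simp add: H10_deriv_def space_L2_iff)

lemma H10_deriv_sum:
  assumes "\<And>n. n \<in> F \<Longrightarrow> H10_deriv L (\<phi> n) (g n)"
  shows "H10_deriv L (\<lambda>x. \<Sum>n\<in>F. c n * \<phi> n x) (\<lambda>x. \<Sum>n\<in>F. c n * g n x)"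
  using assms
  by (induction F rule: infinite_finite_induct)
    (auto intro!: H10_deriv_zero H10_deriv_add H10_deriv_cmult)

lemma H10_deriv_classical:
  assumes L: "0 < L" and d: "\<And>x. x \<in> {0..L} \<Longrightarrow> (\<phi> has_vector_derivative g x) (at x within {0..L})"
    and g: "continuous_on {0..L} g" and b: "\<phi> 0 = 0" "\<phi> L = 0"
  shows "H10_deriv L \<phi> g"
proof -
  have "\<phi> x = (LINT s|lebesgue_on {0<..<x}. g s)" if x: "x \<in> {0..L}" for x
  proof -
    have "(g has_integral \<phi> x - \<phi> 0) {0..x}"
      using x by (intro fundamental_theorem_of_calculus) (auto intro: has_vector_derivative_within_subset[OF d])
    then show ?thesis
      using indefinite_integral_henstock[OF continuous_integrable_open_interval(1)[OF g] x] b
      by (simp add: integral_unique)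
  qed
  then show ?thesis using continuous_sq_int[OF g] b by (simp add: H10_deriv_def space_L2_iff)
qed

lemma H10_deriv_sin_mode:
  assumes L: "0 < L"
  shows "H10_deriv L (sin_mode L n) (\<lambda>x. of_real (real n * pi / L) * cos_mode L n x)"
proof (rule H10_deriv_classical[OF L mode_derivs(1)[OF L]])
  show "continuous_on {0..L} (\<lambda>x. of_real (real n * pi / L) * cos_mode L n x)"
    by (intro continuous_intros continuous_modes)
qed (use L in auto)

lemma H10_deriv_bdry:
  assumes L: "0 < L" and H: "H10_deriv L \<phi> g"
  shows "\<phi> 0 = 0" "continuous_on {0..L} \<phi>" "(LINT s|lebesgue_on {0<..<L}. g s) = 0"
proof -
  show "\<phi> 0 = 0" using H10_derivD(3)[OF H, of 0] L by simp
  show "continuous_on {0..L} \<phi>"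
    by (rule continuous_on_eq[OF continuous_indefinite_integral[OF H10_derivD(2)[OF H]]])
      (rule H10_derivD(3)[OF H, symmetric])
  show "(LINT s|lebesgue_on {0<..<L}. g s) = 0"
    using H10_derivD(3)[OF H, of L] H10_derivD(4)[OF H] L by simp
qed

text \<open>The squared norm of a sine mode is L / 2, so the factor 2 / L makes these the
  coefficients of the sine expansion.\<close>

definition sine_coeff :: "real \<Rightarrow> (real \<Rightarrow> complex) \<Rightarrow> nat \<Rightarrow> complex" where
  "sine_coeff L \<phi> n = of_real (2 / L) * integral {0..L} (\<lambda>x. \<phi> x * sin_mode L n x)"

lemma sine_coeff_0 [simp]: "sine_coeff L \<phi> 0 = 0"
  by (simp add: sine_coeff_def)

text \<open>The primitive of g vanishes at both ends because g has mean zero, so no boundary term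
  survives. The identity is multiplied by n \<pi> / L so that n = 0 is included.\<close>

lemma integral_sin_mode_by_parts:
  assumes L: "0 < L" and g: "integrable (lebesgue_on {0<..<L}) g" and g0: "(LINT s|lebesgue_on {0<..<L}. g s) = 0"
  shows "of_real (real n * pi / L) * integral {0..L} (\<lambda>x. (LINT s|lebesgue_on {0<..<x}. g s) * sin_mode L n x)
    = (if n = 0 then 0 else LINT x|lebesgue_on {0<..<L}. g x * cos_mode L n x)"
proof (cases "n = 0")
  case False
  define r where "r = complex_of_real (real n * pi / L)"
  have r: "r \<noteq> 0" using False L by (simp add: r_def)
  let ?F = "\<lambda>x. - (cos_mode L n x / r)"
  have "integral {0..L} (\<lambda>x. (LINT s|lebesgue_on {0<..<x}. g s) * sin_mode L n x)
    = (LINT x|lebesgue_on {0<..<L}. (LINT s|lebesgue_on {0<..<x}. g s) * sin_mode L n x)"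
    by (intro continuous_integrable_open_interval(2)[symmetric] continuous_intros continuous_modes
        continuous_indefinite_integral[OF g])
  also have "\<dots> = (LINT s|lebesgue_on {0<..<L}. g s) * ?F L - (LINT s|lebesgue_on {0<..<L}. g s * ?F s)"
  proof (rule indefinite_integral_by_parts[OF L g continuous_modes(1)])
    fix x
    have "((\<lambda>x. - (cos_mode L n x / r)) has_vector_derivative - (- (r * sin_mode L n x) / r)) (at x within {0..L})"
      unfolding r_def by (intro has_vector_derivative_minus has_vector_derivative_divide mode_derivs L)
    then show "(?F has_vector_derivative sin_mode L n x) (at x within {0..L})" using r by simp
  qed
  also have "\<dots> = (LINT s|lebesgue_on {0<..<L}. g s * cos_mode L n s) / r"
    using g0 by simp
  finally show ?thesis using False r by (simp add: r_def)
qed simp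

lemma sine_coeff_deriv:
  assumes L: "0 < L" and H: "H10_deriv L \<phi> g"
  shows "of_real (real n * pi / L) * sine_coeff L \<phi> n
    = (if n = 0 then 0 else of_real (2 / L) * (LINT x|lebesgue_on {0<..<L}. g x * cos_mode L n x))"
proof -
  have "integral {0..L} (\<lambda>x. \<phi> x * sin_mode L n x) =
      integral {0..L} (\<lambda>x. (LINT s|lebesgue_on {0<..<x}. g s) * sin_mode L n x)"
    by (rule integral_cong) (simp add: H10_derivD(3)[OF H])
  then have "of_real (real n * pi / L) * sine_coeff L \<phi> n = of_real (2 / L) * (of_real (real n * pi / L) *
      integral {0..L} (\<lambda>x. (LINT s|lebesgue_on {0<..<x}. g s) * sin_mode L n x))"
    by (simp add: sine_coeff_def mult_ac)
  then show ?thesis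
    unfolding integral_sin_mode_by_parts[OF L H10_derivD(2)[OF H] H10_deriv_bdry(3)[OF L H]]
    by (cases "n = 0") simp_all
qed

text \<open>For n \<ge> 1 the numbers (n \<pi> / L) c_n are 2 / L times the cosine moments of g, so
  Bessel for the cosines applies; the constant is (2 / \<pi>)^2 times L / 2.\<close>

lemma sine_coeff_bessel:
  assumes L: "0 < L" and H: "H10_deriv L \<phi> g"
  shows "summable (\<lambda>n. (real n * cmod (sine_coeff L \<phi> n))\<^sup>2)"
    and "(\<Sum>n. (real n * cmod (sine_coeff L \<phi> n))\<^sup>2) \<le> 2 * L / pi\<^sup>2 * (norm_L2 0 L g)\<^sup>2"
proof -
  let ?a = "\<lambda>n. (real n * cmod (sine_coeff L \<phi> n))\<^sup>2"
  have a: "?a n = 4 / pi\<^sup>2 * (cmod (LINT x|lebesgue_on {0<..<L}. g x * cos_mode L n x))\<^sup>2" if "n \<noteq> 0" for n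
  proof -
    have "real n * pi / L * cmod (sine_coeff L \<phi> n) = 2 / L * cmod (LINT x|lebesgue_on {0<..<L}. g x * cos_mode L n x)"
      using arg_cong[OF sine_coeff_deriv[OF L H, of n], of cmod] that L by (simp add: norm_mult norm_divide)
    then have "real n * cmod (sine_coeff L \<phi> n) = 2 / pi * cmod (LINT x|lebesgue_on {0<..<L}. g x * cos_mode L n x)"
      using L by (simp add: field_simps)
    then show ?thesis by (simp add: power_mult_distrib power_divide)
  qed
  have bd: "(\<Sum>n\<in>F. ?a n) \<le> 2 * L / pi\<^sup>2 * (norm_L2 0 L g)\<^sup>2" if F: "finite F" for F
  proof -
    have "(\<Sum>n\<in>F. ?a n) = (\<Sum>n\<in>F - {0}. ?a n)" using F by (intro sum.mono_neutral_right) auto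
    also have "\<dots> = 4 / pi\<^sup>2 * (\<Sum>n\<in>F - {0}. (cmod (LINT x|lebesgue_on {0<..<L}. g x * cos_mode L n x))\<^sup>2)"
      unfolding sum_distrib_left by (intro sum.cong refl a) auto
    also have "\<dots> \<le> 4 / pi\<^sup>2 * (L/2 * (l2norm (lebesgue_on {0<..<L}) g)\<^sup>2)"
      using F by (intro mult_left_mono mode_bessel L H10_derivD[OF H]) auto
    finally show ?thesis by (simp add: norm_L2_eq)
  qed
  show s: "summable ?a"
    by (rule bounded_imp_summable[OF _ bd]) simp_all
  show "suminf ?a \<le> 2 * L / pi\<^sup>2 * (norm_L2 0 L g)\<^sup>2"
    by (rule suminf_le_const[OF s bd]) simp
qed

text \<open>The cosine series of \<open>g\<close> is only shown to converge to some weak derivative \<open>h\<close> of \<open>\<phi>\<close>, not to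
  \<open>g\<close> itself; for this, completeness of the sines among continuous functions suffices.\<close>

lemma H10_cosine_series:
  assumes L: "0 < L" and H: "H10_deriv L \<phi> g"
  defines "S \<equiv> \<lambda>N x. \<Sum>n<N. sine_coeff L \<phi> n * (of_real (real n * pi / L) * cos_mode L n x)"
  shows "\<exists>h. H10_deriv L \<phi> h \<and> (\<lambda>N. l2norm (lebesgue_on {0<..<L}) (\<lambda>x. S N x - h x)) \<longlonglongrightarrow> 0"
proof -
  let ?M = "lebesgue_on {0<..<L}"
  define \<gamma> where "\<gamma> = (\<lambda>n. of_real (real n * pi / L) * sine_coeff L \<phi> n)"
  have S: "S N x = (\<Sum>n<N. \<gamma> n * cos_mode L n x)" for N x
    by (simp add: S_def \<gamma>_def mult_ac)
  have \<gamma>0: "\<gamma> 0 = 0" by (simp add: \<gamma>_def)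
  have cS: "continuous_on A (S N)" for A N
    unfolding S by (intro continuous_intros continuous_modes)
  have sqS: "sq_int ?M (S N)" for N by (intro continuous_sq_int cS)
  have sm: "summable (\<lambda>n. (cmod (\<gamma> n))\<^sup>2)"
  proof -
    have "(\<lambda>n. (cmod (\<gamma> n))\<^sup>2) = (\<lambda>n. (pi / L)\<^sup>2 * (real n * cmod (sine_coeff L \<phi> n))\<^sup>2)"
      using L by (auto simp: \<gamma>_def norm_mult norm_divide power_mult_distrib power_divide)
    then show ?thesis using summable_mult[OF sine_coeff_bessel(1)[OF L H]] by simp
  qed
  have diff: "(l2norm ?M (\<lambda>x. S n x - S m x))\<^sup>2 = L/2 * (\<Sum>k\<in>{m..<n}. (cmod (\<gamma> k))\<^sup>2)" if "1 \<le> m" "m \<le> n" for m n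
  proof -
    have "{..<n} = {..<m} \<union> {m..<n}" "{..<m} \<inter> {m..<n} = {}" using that by auto
    then have "(\<lambda>x. S n x - S m x) = (\<lambda>x. \<Sum>k\<in>{m..<n}. \<gamma> k * cos_mode L k x)"
      by (simp add: S sum.union_disjoint fun_eq_iff)
    then show ?thesis using mode_l2norm(1)[OF L, of "{m..<n}" \<gamma>] that by simp
  qed
  from riesz_fischer_series[OF sqS sm eq_refl[OF diff]] obtain h where h: "sq_int ?M h"
    and lim: "(\<lambda>N. l2norm ?M (\<lambda>x. S N x - h x)) \<longlonglongrightarrow> 0"
    using L by auto
  have hi: "integrable ?M h" by (rule sq_int_integrable[OF h])
  \<comment> \<open>Mean convergence transfers to h the cosine moments of the partial sums, which
    are constant from N = n + 1 on. The moment at n = 0 is zero, so the primitive of h vanishes at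
    L.\<close>
  have inner: "(LINT x|?M. h x * cos_mode L n x) = (if n = 0 then 0 else of_real (L/2) * \<gamma> n)" for n
  proof (rule LIMSEQ_unique)
    show "(\<lambda>N. LINT x|?M. S N x * cos_mode L n x) \<longlonglongrightarrow> (LINT x|?M. h x * cos_mode L n x)"
      by (rule l2_tendsto_integral[OF sqS h _ lim]) (intro continuous_sq_int continuous_modes)
    have "(LINT x|?M. S N x * cos_mode L n x) = (if n = 0 then 0 else of_real (L/2) * \<gamma> n)" if N: "Suc n \<le> N" for N
    proof -
      have i: "integrable ?M (\<lambda>x. cos_mode L k x * cos_mode L n x)" for k
        by (intro continuous_integrable_open_interval continuous_intros continuous_modes)
      have cn: "cnj (cos_mode L n x) = cos_mode L n x" for x by (simp add: cos_mode_def)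
      have orth: "(LINT x|?M. cos_mode L k x * cos_mode L n x) = (if k = n then of_real (L/2) else 0)" if "k \<noteq> 0" "n \<noteq> 0" for k
        using mode_orthogonal(1)[OF L, of k n] that unfolding cn by auto
      have o0: "(LINT x|?M. cos_mode L k x * cos_mode L 0 x) = 0" if "k \<noteq> 0" for k
      proof -
        have "(LINT x|?M. cos_mode L k x * cos_mode L 0 x) = of_real (LINT x|?M. cos (of_int (int k) * pi * x / L))"
          by (simp add: cos_mode_def flip: integral_complex_of_real)
        also have "(LINT x|?M. cos (of_int (int k) * pi * x / L)) = integral {0..L} (\<lambda>x. cos (of_int (int k) * pi * x / L))"
          using L by (intro continuous_integrable_open_interval continuous_intros) auto
        also have "\<dots> = 0" using integral_cos_mode[OF L, of "int k"] that by simp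
        finally show ?thesis by simp
      qed
      have "(LINT x|?M. S N x * cos_mode L n x) = (\<Sum>k<N. LINT x|?M. \<gamma> k * (cos_mode L k x * cos_mode L n x))"
        unfolding S sum_distrib_right mult.assoc
        by (intro Bochner_Integration.integral_sum integrable_mult_right i)
      also have "\<dots> = (\<Sum>k<N. \<gamma> k * (LINT x|?M. cos_mode L k x * cos_mode L n x))" by simp
      also have "\<dots> = (\<Sum>k<N. if k = n then (if n = 0 then 0 else of_real (L/2) * \<gamma> n) else 0)"
      proof (rule sum.cong[OF refl])
        fix k
        show "\<gamma> k * (LINT x|?M. cos_mode L k x * cos_mode L n x) = (if k = n then (if n = 0 then 0 else of_real (L/2) * \<gamma> n) else 0)"
          using \<gamma>0 orth[of k] o0[of k] by (cases "k = 0"; cases "n = 0") auto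
      qed
      also have "\<dots> = (if n = 0 then 0 else of_real (L/2) * \<gamma> n)" using N by (simp add: sum.delta)
      finally show ?thesis .
    qed
    then show "(\<lambda>N. LINT x|?M. S N x * cos_mode L n x) \<longlonglongrightarrow> (if n = 0 then 0 else of_real (L/2) * \<gamma> n)"
      by (intro tendsto_eventually eventually_sequentiallyI[of "Suc n"])
  qed
  have h0: "(LINT x|?M. h x) = 0" using inner[of 0] by (simp add: cos_mode_def)
  let ?\<psi> = "\<lambda>x. LINT s|lebesgue_on {0<..<x}. h s"
  have c\<psi>: "continuous_on {0..L} ?\<psi>" by (rule continuous_indefinite_integral[OF hi])
  have c\<phi>: "continuous_on {0..L} \<phi>" by (rule H10_deriv_bdry(2)[OF L H])
  \<comment> \<open>\<phi> and the primitive of h vanish at both ends and have the same sine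
    coefficients, hence coincide.\<close>
  have "\<phi> x - ?\<psi> x = 0" if x: "x \<in> {0..L}" for x
  proof (rule sine_uniqueness[where f="\<lambda>x. \<phi> x - ?\<psi> x", OF L _ _ _ _ x])
    show "continuous_on {0..L} (\<lambda>x. \<phi> x - ?\<psi> x)" by (intro continuous_intros c\<phi> c\<psi>)
    show "\<phi> 0 - ?\<psi> 0 = 0" using H10_deriv_bdry(1)[OF L H] by simp
    show "\<phi> L - ?\<psi> L = 0" using H10_derivD(4)[OF H] h0 by simp
    fix n :: nat assume n: "1 \<le> n"
    define r where "r = complex_of_real (real n * pi / L)"
    have r: "r \<noteq> 0" using n L by (simp add: r_def)
    have "r * integral {0..L} (\<lambda>x. ?\<psi> x * sin_mode L n x) = of_real (L/2) * \<gamma> n"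
      using integral_sin_mode_by_parts[OF L hi h0, of n] n inner[of n] by (simp add: r_def)
    also have "\<dots> = r * integral {0..L} (\<lambda>x. \<phi> x * sin_mode L n x)"
      using L by (simp add: \<gamma>_def r_def sine_coeff_def)
    finally have "integral {0..L} (\<lambda>x. ?\<psi> x * sin_mode L n x) = integral {0..L} (\<lambda>x. \<phi> x * sin_mode L n x)"
      using r by simp
    moreover have "integral {0..L} (\<lambda>x. (\<phi> x - ?\<psi> x) * sin_mode L n x) =
       integral {0..L} (\<lambda>x. \<phi> x * sin_mode L n x) - integral {0..L} (\<lambda>x. ?\<psi> x * sin_mode L n x)"
      unfolding left_diff_distrib
      by (intro integral_diff integrable_continuous_real continuous_intros c\<phi> c\<psi> continuous_modes)
    ultimately show "integral {0..L} (\<lambda>x. (\<phi> x - ?\<psi> x) * sin_mode L n x) = 0" by simp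
  qed
  then have "H10_deriv L \<phi> h"
    using h H10_derivD(4)[OF H] by (auto simp: H10_deriv_def space_L2_iff)
  then show ?thesis using lim by blast
qed

lemma l2_series_cauchy_schwarz:
  fixes x y :: "nat \<Rightarrow> real"
  assumes x: "summable (\<lambda>n. (x n)\<^sup>2)" and y: "summable (\<lambda>n. (y n)\<^sup>2)"
  shows "summable (\<lambda>n. \<bar>x n * y n\<bar>)"
    and "(\<Sum>n. \<bar>x n * y n\<bar>) \<le> sqrt (\<Sum>n. (x n)\<^sup>2) * sqrt (\<Sum>n. (y n)\<^sup>2)"
proof -
  let ?B = "sqrt (\<Sum>n. (x n)\<^sup>2) * sqrt (\<Sum>n. (y n)\<^sup>2)"
  have bd: "(\<Sum>n\<in>F. \<bar>x n * y n\<bar>) \<le> ?B" if F: "finite F" for F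
  proof -
    have "(\<Sum>n\<in>F. \<bar>x n\<bar> * \<bar>y n\<bar>)\<^sup>2 \<le> (\<Sum>n\<in>F. \<bar>x n\<bar>\<^sup>2) * (\<Sum>n\<in>F. \<bar>y n\<bar>\<^sup>2)"
      by (rule Cauchy_Schwarz_ineq_sum)
    also have "\<dots> \<le> (\<Sum>n. (x n)\<^sup>2) * (\<Sum>n. (y n)\<^sup>2)"
      unfolding power2_abs using F x y by (intro mult_mono sum_le_suminf suminf_nonneg sum_nonneg) auto
    finally have "(\<Sum>n\<in>F. \<bar>x n\<bar> * \<bar>y n\<bar>) \<le> sqrt ((\<Sum>n. (x n)\<^sup>2) * (\<Sum>n. (y n)\<^sup>2))"
      by (rule real_le_rsqrt)
    then show ?thesis by (simp add: abs_mult real_sqrt_mult)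
  qed
  show s: "summable (\<lambda>n. \<bar>x n * y n\<bar>)"
    by (rule bounded_imp_summable[OF _ bd]) simp_all
  show "(\<Sum>n. \<bar>x n * y n\<bar>) \<le> ?B"
    by (rule suminf_le_const[OF s bd]) simp
qed

section \<open>Bounded functionals and their sine coefficients\<close>

lemma Hm1D:
  assumes "F \<in> Hm1 L"
  shows "H10_deriv L \<phi> g \<Longrightarrow> H10_deriv L \<psi> h \<Longrightarrow> F (\<lambda>x. \<phi> x + \<psi> x) = F \<phi> + F \<psi>"
    and "H10_deriv L \<phi> g \<Longrightarrow> F (\<lambda>x. c * \<phi> x) = c * F \<phi>"
    and "\<exists>C\<ge>0. \<forall>\<phi> g. H10_deriv L \<phi> g \<longrightarrow> cmod (F \<phi>) \<le> C * norm_L2 0 L g"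
proof -
  have a: "\<forall>\<phi>\<in>H10 L. \<forall>\<psi>\<in>H10 L. F (\<lambda>x. \<phi> x + \<psi> x) = F \<phi> + F \<psi>"
    and m: "\<forall>c. \<forall>\<phi>\<in>H10 L. F (\<lambda>x. c * \<phi> x) = c * F \<phi>"
    using assms by (simp_all add: Hm1_def)
  show "H10_deriv L \<phi> g \<Longrightarrow> H10_deriv L \<psi> h \<Longrightarrow> F (\<lambda>x. \<phi> x + \<psi> x) = F \<phi> + F \<psi>"
    using a unfolding H10_def by blast
  show "H10_deriv L \<phi> g \<Longrightarrow> F (\<lambda>x. c * \<phi> x) = c * F \<phi>"
    using m unfolding H10_def by blast
  obtain C where C: "\<And>\<phi> g. H10_deriv L \<phi> g \<Longrightarrow> cmod (F \<phi>) \<le> C * norm_L2 0 L g"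
    using assms by (auto simp: Hm1_def)
  have "cmod (F \<phi>) \<le> \<bar>C\<bar> * norm_L2 0 L g" if "H10_deriv L \<phi> g" for \<phi> g
    by (rule order_trans[OF C[OF that]]) (intro mult_right_mono, auto simp: norm_L2_eq)
  then show "\<exists>C\<ge>0. \<forall>\<phi> g. H10_deriv L \<phi> g \<longrightarrow> cmod (F \<phi>) \<le> C * norm_L2 0 L g"
    by (intro exI[of _ "\<bar>C\<bar>"]) auto
qed

lemma norm_Hm1_le:
  assumes "0 \<le> C" "\<And>\<phi> g. H10_deriv L \<phi> g \<Longrightarrow> cmod (F \<phi>) \<le> C * norm_L2 0 L g"
  shows "0 \<le> norm_Hm1 L F" "norm_Hm1 L F \<le> C"
proof -
  let ?S = "{C. 0 \<le> C \<and> (\<forall>\<phi> g. H10_deriv L \<phi> g \<longrightarrow> cmod (F \<phi>) \<le> C * norm_L2 0 L g)}"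
  have C: "C \<in> ?S" using assms by auto
  then have "?S \<noteq> {}" by blast
  then show "0 \<le> norm_Hm1 L F" unfolding norm_Hm1_def by (rule cInf_greatest) auto
  show "norm_Hm1 L F \<le> C" unfolding norm_Hm1_def by (rule cInf_lower[OF C]) (auto intro: bdd_belowI[of _ 0])
qed

text \<open>The infimum in the dual norm is itself an admissible constant. If g has norm zero, any
  admissible constant shows that F vanishes at \<phi>; otherwise one divides by the norm of
  g.\<close>

lemma norm_Hm1_bound:
  assumes F: "F \<in> Hm1 L"
  shows "0 \<le> norm_Hm1 L F" and "H10_deriv L \<phi> g \<Longrightarrow> cmod (F \<phi>) \<le> norm_Hm1 L F * norm_L2 0 L g"
proof -
  let ?S = "{C. 0 \<le> C \<and> (\<forall>\<phi> g. H10_deriv L \<phi> g \<longrightarrow> cmod (F \<phi>) \<le> C * norm_L2 0 L g)}"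
  have ne: "?S \<noteq> {}" using Hm1D(3)[OF F] by blast
  show "0 \<le> norm_Hm1 L F" unfolding norm_Hm1_def using ne by (rule cInf_greatest) auto
  assume H: "H10_deriv L \<phi> g"
  show "cmod (F \<phi>) \<le> norm_Hm1 L F * norm_L2 0 L g"
  proof (cases "norm_L2 0 L g = 0")
    case True
    obtain C where "cmod (F \<phi>) \<le> C * norm_L2 0 L g" using Hm1D(3)[OF F] H by blast
    then show ?thesis using True by simp
  next
    case False
    then have pos: "0 < norm_L2 0 L g" using l2norm_nonneg by (simp add: norm_L2_eq order_less_le)
    have "cmod (F \<phi>) / norm_L2 0 L g \<le> norm_Hm1 L F"
      unfolding norm_Hm1_def using ne
    proof (rule cInf_greatest)
      fix C assume "C \<in> ?S"
      then show "cmod (F \<phi>) / norm_L2 0 L g \<le> C" using H pos by (auto simp: pos_divide_le_eq)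
    qed
    then show ?thesis using pos by (simp add: pos_divide_le_eq)
  qed
qed

lemma Hm1_zero:
  assumes F: "F \<in> Hm1 L" shows "F (\<lambda>x. 0) = 0"
  using Hm1D(2)[OF F H10_deriv_zero, of 0] by simp

lemma Hm1_sum:
  assumes F: "F \<in> Hm1 L" and \<phi>: "\<And>n. n \<in> I \<Longrightarrow> H10_deriv L (\<phi> n) (g n)"
  shows "F (\<lambda>x. \<Sum>n\<in>I. c n * \<phi> n x) = (\<Sum>n\<in>I. c n * F (\<phi> n))"
  using \<phi>
proof (induction I rule: infinite_finite_induct)
  case (insert k I)
  have "F (\<lambda>x. c k * \<phi> k x + (\<Sum>n\<in>I. c n * \<phi> n x)) = F (\<lambda>x. c k * \<phi> k x) + F (\<lambda>x. \<Sum>n\<in>I. c n * \<phi> n x)"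
    by (rule Hm1D(1)[OF F H10_deriv_cmult H10_deriv_sum]) (use insert.prems in auto)
  then show ?case using insert Hm1D(2)[OF F insert.prems[of k]] by simp
qed (simp_all add: Hm1_zero[OF F])

text \<open>F is bounded in terms of derivatives, so mean convergence of the differentiated sine
  series suffices. Its limit h is a weak derivative of \<phi> and serves in place of g, as F sees
  only \<phi>.\<close>

lemma Hm1_expansion:
  assumes L: "0 < L" and F: "F \<in> Hm1 L" and H: "H10_deriv L \<phi> g"
  shows "(\<lambda>n. sine_coeff L \<phi> n * F (sin_mode L n)) sums F \<phi>"
proof -
  define S where "S = (\<lambda>N x. \<Sum>n<N. sine_coeff L \<phi> n * sin_mode L n x)"
  define S' where "S' = (\<lambda>N x. \<Sum>n<N. sine_coeff L \<phi> n * (of_real (real n * pi / L) * cos_mode L n x))"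
  obtain h where h: "H10_deriv L \<phi> h"
    and lim: "(\<lambda>N. l2norm (lebesgue_on {0<..<L}) (\<lambda>x. S' N x - h x)) \<longlonglongrightarrow> 0"
    using H10_cosine_series[OF L H] unfolding S'_def by blast
  have "(\<lambda>N. (\<Sum>n<N. sine_coeff L \<phi> n * F (sin_mode L n)) - F \<phi>) \<longlonglongrightarrow> 0"
  proof (rule Lim_null_comparison[OF always_eventually[OF allI] tendsto_mult_right_zero[OF lim]])
    fix N
    have S: "H10_deriv L (S N) (S' N)" unfolding S_def S'_def by (intro H10_deriv_sum H10_deriv_sin_mode L)
    have m: "H10_deriv L (\<lambda>x. - 1 * \<phi> x) (\<lambda>x. - 1 * h x)" by (rule H10_deriv_cmult[OF h])
    have "F (\<lambda>x. S N x + (- 1 * \<phi> x)) = F (S N) + F (\<lambda>x. - 1 * \<phi> x)" by (rule Hm1D(1)[OF F S m])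
    also have "F (\<lambda>x. - 1 * \<phi> x) = - 1 * F \<phi>" by (rule Hm1D(2)[OF F h])
    also have "F (S N) = (\<Sum>n<N. sine_coeff L \<phi> n * F (sin_mode L n))"
      unfolding S_def by (rule Hm1_sum[OF F H10_deriv_sin_mode[OF L]])
    finally have "(\<Sum>n<N. sine_coeff L \<phi> n * F (sin_mode L n)) - F \<phi> = F (\<lambda>x. S N x + (- 1 * \<phi> x))" by simp
    also have "cmod \<dots> \<le> norm_Hm1 L F * norm_L2 0 L (\<lambda>x. S' N x + (- 1 * h x))"
      by (rule norm_Hm1_bound(2)[OF F H10_deriv_add[OF S m]])
    finally show "norm ((\<Sum>n<N. sine_coeff L \<phi> n * F (sin_mode L n)) - F \<phi>) \<le>
        norm_Hm1 L F * l2norm (lebesgue_on {0<..<L}) (\<lambda>x. S' N x - h x)"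
      by (simp add: norm_L2_eq)
  qed
  then show ?thesis unfolding sums_def by (rule LIM_zero_cancel)
qed

text \<open>With a_n the value of F at the n-th sine mode, F is tested on a finite sum of cnj(a_n) /
  n^2 times the modes. This gives the finite sum S of |a_n|^2 / n^2, while the derivative of the
  test function has squared norm \<pi>^2 S / (2 L). At n = 0 the quotient is 0 by division by
  zero.\<close>

lemma Hm1_coeff_bound:
  assumes L: "0 < L" and F: "F \<in> Hm1 L"
  shows "summable (\<lambda>n. (cmod (F (sin_mode L n)) / real n)\<^sup>2)"
    and "(\<Sum>n. (cmod (F (sin_mode L n)) / real n)\<^sup>2) \<le> pi\<^sup>2 / (2 * L) * (norm_Hm1 L F)\<^sup>2"
proof -
  let ?a = "\<lambda>n. F (sin_mode L n)"
  let ?B = "pi\<^sup>2 / (2 * L) * (norm_Hm1 L F)\<^sup>2"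
  have bd: "(\<Sum>n\<in>I. (cmod (?a n) / real n)\<^sup>2) \<le> ?B" if "finite I" for I
  proof -
    define J where "J = I - {0}"
    have J: "finite J" "0 \<notin> J" using that by (auto simp: J_def)
    define S where "S = (\<Sum>n\<in>J. (cmod (?a n) / real n)\<^sup>2)"
    have S0: "0 \<le> S" by (simp add: S_def sum_nonneg)
    define c where "c = (\<lambda>n. cnj (?a n) / of_real ((real n)\<^sup>2))"
    have H: "H10_deriv L (\<lambda>x. \<Sum>n\<in>J. c n * sin_mode L n x) (\<lambda>x. \<Sum>n\<in>J. c n * (of_real (real n * pi / L) * cos_mode L n x))"
      by (intro H10_deriv_sum H10_deriv_sin_mode L)
    have "F (\<lambda>x. \<Sum>n\<in>J. c n * sin_mode L n x) = (\<Sum>n\<in>J. c n * ?a n)"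
      by (rule Hm1_sum[OF F H10_deriv_sin_mode[OF L]])
    also have "\<dots> = of_real S"
      unfolding S_def of_real_sum
    proof (rule sum.cong[OF refl])
      fix n
      have "c n * ?a n = of_real ((cmod (?a n))\<^sup>2) / of_real ((real n)\<^sup>2)"
        unfolding c_def complex_norm_square by simp
      then show "c n * ?a n = of_real ((cmod (?a n) / real n)\<^sup>2)" by (simp add: power_divide)
    qed
    finally have FS: "cmod (F (\<lambda>x. \<Sum>n\<in>J. c n * sin_mode L n x)) = S" using S0 by simp
    have "(norm_L2 0 L (\<lambda>x. \<Sum>n\<in>J. c n * (of_real (real n * pi / L) * cos_mode L n x)))\<^sup>2
        = (l2norm (lebesgue_on {0<..<L}) (\<lambda>x. \<Sum>n\<in>J. (c n * of_real (real n * pi / L)) * cos_mode L n x))\<^sup>2"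
      by (simp add: norm_L2_eq mult.assoc)
    also have "\<dots> = L/2 * (\<Sum>n\<in>J. (cmod (c n * of_real (real n * pi / L)))\<^sup>2)"
      by (rule mode_l2norm(1)[OF L J])
    also have "(\<Sum>n\<in>J. (cmod (c n * of_real (real n * pi / L)))\<^sup>2) = (\<Sum>n\<in>J. (pi / L)\<^sup>2 * (cmod (?a n) / real n)\<^sup>2)"
    proof (rule sum.cong[OF refl])
      fix n assume "n \<in> J"
      then have n: "0 < real n" using J by (cases n) auto
      have "cmod (c n * of_real (real n * pi / L)) = (pi / L) * (cmod (?a n) / real n)"
        using n L by (simp add: c_def norm_mult norm_divide power2_eq_square mult_ac)
      then show "(cmod (c n * of_real (real n * pi / L)))\<^sup>2 = (pi / L)\<^sup>2 * (cmod (?a n) / real n)\<^sup>2"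
        by (simp only: power_mult_distrib)
    qed
    also have "L/2 * \<dots> = pi\<^sup>2 / (2 * L) * S"
      unfolding S_def[symmetric] sum_distrib_left[symmetric] using L by (simp add: power2_eq_square)
    finally have n2: "(norm_L2 0 L (\<lambda>x. \<Sum>n\<in>J. c n * (of_real (real n * pi / L) * cos_mode L n x)))\<^sup>2 = pi\<^sup>2 / (2 * L) * S" .
    have "S\<^sup>2 \<le> (norm_Hm1 L F * norm_L2 0 L (\<lambda>x. \<Sum>n\<in>J. c n * (of_real (real n * pi / L) * cos_mode L n x)))\<^sup>2"
      using norm_Hm1_bound(2)[OF F H] S0 unfolding FS by (intro power_mono) auto
    also have "\<dots> = ?B * S" unfolding power_mult_distrib n2 by simp
    finally have "S * S \<le> ?B * S" by (simp add: power2_eq_square)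
    then have "S \<le> ?B"
    proof (cases "S = 0")
      case True then show ?thesis using L by simp
    next
      case False
      then have "0 < S" using S0 by simp
      with \<open>S * S \<le> ?B * S\<close> show ?thesis by (rule mult_right_le_imp_le)
    qed
    moreover have "(\<Sum>n\<in>I. (cmod (?a n) / real n)\<^sup>2) = S"
      unfolding S_def J_def using that by (intro sum.mono_neutral_right) auto
    ultimately show ?thesis by simp
  qed
  show s: "summable (\<lambda>n. (cmod (?a n) / real n)\<^sup>2)"
    by (rule bounded_imp_summable[OF _ bd]) simp_all
  show "(\<Sum>n. (cmod (?a n) / real n)\<^sup>2) \<le> ?B"
    by (rule suminf_le_const[OF s bd]) simp
qed

text \<open>The functional taking the value n z_n at the n-th sine mode. The weight n matches the
  one in \<open>sine_coeff_bessel\<close>, so that square summable z give bounded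
  functionals.\<close>

definition dual_series :: "real \<Rightarrow> (nat \<Rightarrow> complex) \<Rightarrow> (real \<Rightarrow> complex) \<Rightarrow> complex" where
  "dual_series L z \<phi> = (\<Sum>n. sine_coeff L \<phi> n * (of_nat n * z n))"

lemma dual_series_bound:
  assumes L: "0 < L" and z: "summable (\<lambda>n. (cmod (z n))\<^sup>2)" and H: "H10_deriv L \<phi> g"
  shows "summable (\<lambda>n. sine_coeff L \<phi> n * (of_nat n * z n))"
    and "cmod (dual_series L z \<phi>) \<le> sqrt (2 * L / pi\<^sup>2) * sqrt (\<Sum>n. (cmod (z n))\<^sup>2) * norm_L2 0 L g"
proof -
  let ?x = "\<lambda>n. real n * cmod (sine_coeff L \<phi> n)"
  note x = sine_coeff_bessel[OF L H]
  have eq: "cmod (sine_coeff L \<phi> n * (of_nat n * z n)) = \<bar>?x n * cmod (z n)\<bar>" for n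
    by (simp add: norm_mult abs_mult)
  have s: "summable (\<lambda>n. cmod (sine_coeff L \<phi> n * (of_nat n * z n)))"
    unfolding eq by (rule l2_series_cauchy_schwarz(1)[OF x(1) z])
  then show "summable (\<lambda>n. sine_coeff L \<phi> n * (of_nat n * z n))" by (rule summable_norm_cancel)
  have "cmod (dual_series L z \<phi>) \<le> (\<Sum>n. cmod (sine_coeff L \<phi> n * (of_nat n * z n)))"
    unfolding dual_series_def by (rule summable_norm[OF s])
  also have "\<dots> \<le> sqrt (\<Sum>n. (?x n)\<^sup>2) * sqrt (\<Sum>n. (cmod (z n))\<^sup>2)"
    unfolding eq by (rule l2_series_cauchy_schwarz(2)[OF x(1) z])
  also have "\<dots> \<le> sqrt (2 * L / pi\<^sup>2 * (norm_L2 0 L g)\<^sup>2) * sqrt (\<Sum>n. (cmod (z n))\<^sup>2)"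
    using x(2) z by (intro mult_right_mono real_sqrt_le_mono real_sqrt_ge_zero suminf_nonneg) auto
  also have "sqrt (2 * L / pi\<^sup>2 * (norm_L2 0 L g)\<^sup>2) = sqrt (2 * L / pi\<^sup>2) * norm_L2 0 L g"
    by (simp only: real_sqrt_mult real_sqrt_abs norm_L2_eq abs_of_nonneg[OF l2norm_nonneg])
  finally show "cmod (dual_series L z \<phi>) \<le> sqrt (2 * L / pi\<^sup>2) * sqrt (\<Sum>n. (cmod (z n))\<^sup>2) * norm_L2 0 L g"
    by (simp add: mult_ac)
qed

lemma sine_coeff_linear:
  assumes L: "0 < L" and H: "H10_deriv L \<phi> g" "H10_deriv L \<psi> h"
  shows "sine_coeff L (\<lambda>x. \<phi> x + \<psi> x) n = sine_coeff L \<phi> n + sine_coeff L \<psi> n"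
    and "sine_coeff L (\<lambda>x. c * \<phi> x) n = c * sine_coeff L \<phi> n"
proof -
  have "integral {0..L} (\<lambda>x. \<phi> x * sin_mode L n x + \<psi> x * sin_mode L n x) =
      integral {0..L} (\<lambda>x. \<phi> x * sin_mode L n x) + integral {0..L} (\<lambda>x. \<psi> x * sin_mode L n x)"
    by (intro integral_add integrable_continuous_real continuous_intros continuous_modes
        H10_deriv_bdry(2)[OF L H(1)] H10_deriv_bdry(2)[OF L H(2)])
  then show "sine_coeff L (\<lambda>x. \<phi> x + \<psi> x) n = sine_coeff L \<phi> n + sine_coeff L \<psi> n"
    by (simp add: sine_coeff_def distrib_left distrib_right)
  show "sine_coeff L (\<lambda>x. c * \<phi> x) n = c * sine_coeff L \<phi> n"
    by (simp add: sine_coeff_def mult.assoc)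
qed

lemma dual_series_Hm1:
  assumes L: "0 < L" and z: "summable (\<lambda>n. (cmod (z n))\<^sup>2)"
  shows "dual_series L z \<in> Hm1 L"
proof -
  have "dual_series L z (\<lambda>x. \<phi> x + \<psi> x) = dual_series L z \<phi> + dual_series L z \<psi>"
    if H: "H10_deriv L \<phi> g" "H10_deriv L \<psi> h" for \<phi> \<psi> g h
    unfolding dual_series_def sine_coeff_linear(1)[OF L H] distrib_right
    by (rule suminf_add[symmetric]) (rule dual_series_bound(1)[OF L z H(1)], rule dual_series_bound(1)[OF L z H(2)])
  moreover have "dual_series L z (\<lambda>x. c * \<phi> x) = c * dual_series L z \<phi>" if H: "H10_deriv L \<phi> g" for \<phi> g c
    unfolding dual_series_def sine_coeff_linear(2)[OF L H H] mult.assoc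
    by (rule suminf_mult[OF dual_series_bound(1)[OF L z H]])
  ultimately show ?thesis
    unfolding Hm1_def H10_def using dual_series_bound(2)[OF L z] by blast
qed

text \<open>The difference of two such functionals is the functional of the difference of the
  sequences, so continuity in the dual norm reduces to continuity in l^2.\<close>

lemma continuous_Hm1_dual_series:
  assumes L: "0 < L" and z: "\<And>t. t \<in> {0..T} \<Longrightarrow> summable (\<lambda>n. (cmod (z t n))\<^sup>2)"
    and lim: "\<And>t. t \<in> {0..T} \<Longrightarrow> ((\<lambda>s. \<Sum>n. (cmod (z s n - z t n))\<^sup>2) \<longlongrightarrow> 0) (at t within {0..T})"
  shows "continuous_Hm1 T L (\<lambda>t. dual_series L (z t))"
  unfolding continuous_Hm1_def
proof (intro ballI conjI)
  fix t assume t: "t \<in> {0..T}"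
  show "dual_series L (z t) \<in> Hm1 L" by (rule dual_series_Hm1[OF L z[OF t]])
  define b where "b = (\<lambda>s. sqrt (2 * L / pi\<^sup>2) * sqrt (\<Sum>n. (cmod (z s n - z t n))\<^sup>2))"
  have bd: "0 \<le> norm_Hm1 L (\<lambda>\<phi>. dual_series L (z s) \<phi> - dual_series L (z t) \<phi>) \<and>
     norm_Hm1 L (\<lambda>\<phi>. dual_series L (z s) \<phi> - dual_series L (z t) \<phi>) \<le> b s" if s: "s \<in> {0..T}" for s
  proof -
    have sm: "summable (\<lambda>n. (cmod (z s n - z t n))\<^sup>2)"
    proof (rule summable_comparison_test')
      show "summable (\<lambda>n. 2 * (cmod (z s n))\<^sup>2 + 2 * (cmod (z t n))\<^sup>2)"
        by (intro summable_add summable_mult z s t)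
      fix n
      show "norm ((cmod (z s n - z t n))\<^sup>2) \<le> 2 * (cmod (z s n))\<^sup>2 + 2 * (cmod (z t n))\<^sup>2"
        using cmod_add_sq_le[of "z s n" "- z t n"] by simp
    qed
    have le: "cmod (dual_series L (z s) \<phi> - dual_series L (z t) \<phi>) \<le> b s * norm_L2 0 L g" if H: "H10_deriv L \<phi> g" for \<phi> g
    proof -
      have "dual_series L (z s) \<phi> - dual_series L (z t) \<phi> = dual_series L (\<lambda>n. z s n - z t n) \<phi>"
        unfolding dual_series_def right_diff_distrib
        by (rule suminf_diff) (rule dual_series_bound(1)[OF L z[OF s] H], rule dual_series_bound(1)[OF L z[OF t] H])
      then show ?thesis using dual_series_bound(2)[OF L sm H] by (simp add: b_def)
    qed
    have b0: "0 \<le> b s" unfolding b_def using L sm by (intro mult_nonneg_nonneg real_sqrt_ge_zero suminf_nonneg) auto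
    show ?thesis using norm_Hm1_le[OF b0 le] by simp
  qed
  have "(b \<longlongrightarrow> sqrt (2 * L / pi\<^sup>2) * sqrt 0) (at t within {0..T})"
    unfolding b_def by (intro tendsto_intros lim t)
  then have b: "(b \<longlongrightarrow> 0) (at t within {0..T})" by simp
  show "((\<lambda>s. norm_Hm1 L (\<lambda>\<phi>. dual_series L (z s) \<phi> - dual_series L (z t) \<phi>)) \<longlongrightarrow> 0) (at t within {0..T})"
  proof (rule tendsto_sandwich[OF _ _ tendsto_const b])
    show "\<forall>\<^sub>F s in at t within {0..T}. 0 \<le> norm_Hm1 L (\<lambda>\<phi>. dual_series L (z s) \<phi> - dual_series L (z t) \<phi>)"
      unfolding eventually_at_filter using bd by (intro always_eventually) auto
    show "\<forall>\<^sub>F s in at t within {0..T}. norm_Hm1 L (\<lambda>\<phi>. dual_series L (z s) \<phi> - dual_series L (z t) \<phi>) \<le> b s"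
      unfolding eventually_at_filter using bd by (intro always_eventually) auto
  qed
qed

section \<open>Solutions by transposition\<close>

text \<open>Green's formula: with s the sine mode and r = n \<pi> / L, the expression \<phi>' s -
  \<phi> s' has derivative \<phi>'' s + r^2 \<phi> s and vanishes at both ends.\<close>

lemma sine_coeff_second_derivative:
  assumes L: "0 < L"
    and d1: "\<And>x. x \<in> {0..L} \<Longrightarrow> (\<phi> has_vector_derivative \<phi>1 x) (at x within {0..L})"
    and d2: "\<And>x. x \<in> {0..L} \<Longrightarrow> (\<phi>1 has_vector_derivative \<phi>2 x) (at x within {0..L})"
    and c2: "continuous_on {0..L} \<phi>2" and b: "\<phi> 0 = 0" "\<phi> L = 0"
  shows "integral {0..L} (\<lambda>x. \<phi>2 x * sin_mode L n x) =
    - (of_real ((real n * pi / L)\<^sup>2) * integral {0..L} (\<lambda>x. \<phi> x * sin_mode L n x))"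
proof -
  define r where "r = complex_of_real (real n * pi / L)"
  have c: "continuous_on {0..L} \<phi>" using d1 by (rule continuous_on_vector_derivative)
  have i2: "(\<lambda>x. \<phi>2 x * sin_mode L n x) integrable_on {0..L}"
    and i0: "(\<lambda>x. r\<^sup>2 * (\<phi> x * sin_mode L n x)) integrable_on {0..L}"
    by (intro integrable_continuous_real continuous_intros continuous_modes c c2)+
  have "((\<lambda>x. \<phi>2 x * sin_mode L n x + r\<^sup>2 * (\<phi> x * sin_mode L n x)) has_integral
     (\<phi>1 L * sin_mode L n L - \<phi> L * (r * cos_mode L n L)) - (\<phi>1 0 * sin_mode L n 0 - \<phi> 0 * (r * cos_mode L n 0))) {0..L}"
  proof (rule fundamental_theorem_of_calculus)
    fix x assume x: "x \<in> {0..L}"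
    have s: "(sin_mode L n has_vector_derivative r * cos_mode L n x) (at x within {0..L})"
      unfolding r_def by (rule mode_derivs(1)[OF L])
    have k: "((\<lambda>x. r * cos_mode L n x) has_vector_derivative r * - (r * sin_mode L n x)) (at x within {0..L})"
      unfolding r_def by (intro has_vector_derivative_mult_right mode_derivs(2)[OF L])
    have "((\<lambda>x. \<phi>1 x * sin_mode L n x - \<phi> x * (r * cos_mode L n x)) has_vector_derivative
      (\<phi>1 x * (r * cos_mode L n x) + \<phi>2 x * sin_mode L n x) - (\<phi> x * (r * - (r * sin_mode L n x)) + \<phi>1 x * (r * cos_mode L n x))) (at x within {0..L})"
      by (intro has_vector_derivative_diff has_vector_derivative_mult d1[OF x] d2[OF x] s k)
    then show "((\<lambda>x. \<phi>1 x * sin_mode L n x - \<phi> x * (r * cos_mode L n x)) has_vector_derivative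
      \<phi>2 x * sin_mode L n x + r\<^sup>2 * (\<phi> x * sin_mode L n x)) (at x within {0..L})"
      by (simp add: power2_eq_square algebra_simps)
  qed (use L in simp)
  then have "integral {0..L} (\<lambda>x. \<phi>2 x * sin_mode L n x + r\<^sup>2 * (\<phi> x * sin_mode L n x)) = 0"
    using b L by (simp add: integral_unique)
  then have "integral {0..L} (\<lambda>x. \<phi>2 x * sin_mode L n x) + r\<^sup>2 * integral {0..L} (\<lambda>x. \<phi> x * sin_mode L n x) = 0"
    using integral_add[OF i2 i0] by simp
  then show ?thesis by (simp add: r_def eq_neg_iff_add_eq_0)
qed

text \<open>Bessel for the second derivative puts n^2 c_n into l^2; pairing with 1 / n makes n c_n
  absolutely summable, so that the differentiated sine series converges uniformly.\<close>

lemma sine_coeff_summable: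
  assumes L: "0 < L"
    and d1: "\<And>x. x \<in> {0..L} \<Longrightarrow> (\<phi> has_vector_derivative \<phi>1 x) (at x within {0..L})"
    and d2: "\<And>x. x \<in> {0..L} \<Longrightarrow> (\<phi>1 has_vector_derivative \<phi>2 x) (at x within {0..L})"
    and c2: "continuous_on {0..L} \<phi>2" and b: "\<phi> 0 = 0" "\<phi> L = 0"
  shows "summable (\<lambda>n. real n * cmod (sine_coeff L \<phi> n))"
proof -
  let ?q = "\<lambda>n. (real n)\<^sup>2 * cmod (sine_coeff L \<phi> n)"
  let ?J = "\<lambda>n. cmod (LINT x|lebesgue_on {0<..<L}. \<phi>2 x * sin_mode L n x)"
  have q: "?q n = 2 * L / pi\<^sup>2 * ?J n" for n
  proof -
    have "(LINT x|lebesgue_on {0<..<L}. \<phi>2 x * sin_mode L n x) = integral {0..L} (\<lambda>x. \<phi>2 x * sin_mode L n x)"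
      by (intro continuous_integrable_open_interval continuous_intros c2 continuous_modes)
    also have "\<dots> = - (of_real ((real n * pi / L)\<^sup>2) * integral {0..L} (\<lambda>x. \<phi> x * sin_mode L n x))"
      by (rule sine_coeff_second_derivative[OF L d1 d2 c2 b])
    finally have J: "?J n = (real n * pi / L)\<^sup>2 * cmod (integral {0..L} (\<lambda>x. \<phi> x * sin_mode L n x))"
      by (simp only: norm_minus_cancel norm_mult norm_of_real abs_power2)
    have "cmod (sine_coeff L \<phi> n) = 2 / L * cmod (integral {0..L} (\<lambda>x. \<phi> x * sin_mode L n x))"
      using L by (simp add: sine_coeff_def norm_mult norm_divide)
    then show ?thesis unfolding J using L by (simp add: power2_eq_square)
  qed
  have bd: "(\<Sum>n\<in>F. (?q n)\<^sup>2) \<le> (2 * L / pi\<^sup>2)\<^sup>2 * (L/2 * (l2norm (lebesgue_on {0<..<L}) \<phi>2)\<^sup>2)" if F: "finite F" for F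
  proof -
    have "(\<Sum>n\<in>F. (?q n)\<^sup>2) = (\<Sum>n\<in>F - {0}. (?q n)\<^sup>2)"
      using F by (intro sum.mono_neutral_right) auto
    also have "\<dots> = (2 * L / pi\<^sup>2)\<^sup>2 * (\<Sum>n\<in>F - {0}. (?J n)\<^sup>2)"
      unfolding q power_mult_distrib sum_distrib_left ..
    also have "\<dots> \<le> (2 * L / pi\<^sup>2)\<^sup>2 * (L/2 * (l2norm (lebesgue_on {0<..<L}) \<phi>2)\<^sup>2)"
      using F by (intro mult_left_mono mode_bessel(2) L continuous_sq_int c2) auto
    finally show ?thesis .
  qed
  have s1: "summable (\<lambda>n. (?q n)\<^sup>2)"
    by (rule bounded_imp_summable[OF _ bd]) simp_all
  have s2: "summable (\<lambda>n. (1 / real n)\<^sup>2)"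
    using inverse_power_summable[of 2, where ?'a=real] by (simp add: power_divide inverse_eq_divide)
  have "summable (\<lambda>n. \<bar>?q n * (1 / real n)\<bar>)" by (rule l2_series_cauchy_schwarz(1)[OF s1 s2])
  also have "(\<lambda>n. \<bar>?q n * (1 / real n)\<bar>) = (\<lambda>n. real n * cmod (sine_coeff L \<phi> n))"
    by (auto simp: fun_eq_iff power2_eq_square abs_mult)
  finally show ?thesis .
qed

text \<open>The differentiated series converges uniformly to a continuous C and in the mean to a
  weak derivative of \<phi>. The two limits are at distance zero, so \<phi> is the primitive of C
  and its classical derivative at 0 is C(0).\<close>

lemma boundary_derivative_series:
  assumes L: "0 < L" and H: "H10_deriv L \<phi> g"
    and s: "summable (\<lambda>n. real n * cmod (sine_coeff L \<phi> n))"
    and D: "(\<phi> has_vector_derivative D) (at 0 within {0..L})"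
  shows "D = (\<Sum>n. of_real (real n * pi / L) * sine_coeff L \<phi> n)"
proof -
  let ?M = "lebesgue_on {0<..<L}"
  let ?c = "\<lambda>n. sine_coeff L \<phi> n"
  define S where "S = (\<lambda>N x. \<Sum>n<N. ?c n * (of_real (real n * pi / L) * cos_mode L n x))"
  define C where "C = (\<lambda>x. \<Sum>n. ?c n * (of_real (real n * pi / L) * cos_mode L n x))"
  obtain h where h: "H10_deriv L \<phi> h" and lim: "(\<lambda>N. l2norm ?M (\<lambda>x. S N x - h x)) \<longlonglongrightarrow> 0"
    using H10_cosine_series[OF L H] unfolding S_def by blast
  have ul: "uniform_limit {0..L} S C sequentially"
    unfolding S_def C_def
  proof (rule Weierstrass_m_test)
    show "norm (?c n * (of_real (real n * pi / L) * cos_mode L n x)) \<le> pi / L * (real n * cmod (?c n))" for n x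
    proof -
      have "norm (?c n * (of_real (real n * pi / L) * cos_mode L n x)) = pi / L * (real n * cmod (?c n)) * cmod (cos_mode L n x)"
        using L by (simp add: norm_mult norm_divide)
      also have "\<dots> \<le> pi / L * (real n * cmod (?c n)) * 1"
        using L by (intro mult_left_mono norm_modes) auto
      finally show ?thesis by simp
    qed
    show "summable (\<lambda>n. pi / L * (real n * cmod (?c n)))" by (rule summable_mult[OF s])
  qed
  have cS: "continuous_on A (S N)" for A N unfolding S_def by (intro continuous_intros continuous_modes)
  note cC = l2norm_uniform_limit(1)[OF cS L ul] and limC = l2norm_uniform_limit(2)[OF cS L ul]
  have sqS: "sq_int ?M (S N)" for N by (intro continuous_sq_int cS)
  have sqC: "sq_int ?M C" by (intro continuous_sq_int cC)
  note sqh = H10_derivD(1)[OF h]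
  have hC: "l2norm ?M (\<lambda>x. h x - C x) = 0"
  proof -
    have "l2norm ?M (\<lambda>x. h x - C x) \<le> l2norm ?M (\<lambda>x. S N x - h x) + l2norm ?M (\<lambda>x. S N x - C x)" for N
      using l2norm_triangle[OF sq_int_diff[OF sqh sqS] sq_int_diff[OF sqS sqC], of N N]
        l2norm_diff_commute[of ?M h "S N"] by simp
    moreover have "(\<lambda>N. l2norm ?M (\<lambda>x. S N x - h x) + l2norm ?M (\<lambda>x. S N x - C x)) \<longlonglongrightarrow> 0"
      using tendsto_add[OF lim limC] by simp
    ultimately have "l2norm ?M (\<lambda>x. h x - C x) \<le> 0" by (intro LIMSEQ_le_const) auto
    then show ?thesis using l2norm_nonneg[of ?M "\<lambda>x. h x - C x"] by linarith
  qed
  have \<phi>: "\<phi> x = integral {0..x} C" if x: "x \<in> {0..L}" for x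
  proof -
    have hi: "integrable (lebesgue_on {0<..<x}) h"
      using x by (intro lebesgue_on_subset[OF _ _ _ H10_derivD(2)[OF h]]) auto
    have ci: "integrable (lebesgue_on {0<..<x}) C"
      using x by (intro continuous_integrable_open_interval continuous_on_subset[OF cC]) auto
    have sub: "{0<..<x} \<subseteq> {0<..<L}" using x by auto
    note d = sq_int_subset[OF _ _ sub sq_int_diff[OF sqh sqC]]
    have "cmod (LINT s|lebesgue_on {0<..<x}. (h s - C s) * 1) \<le>
        l2norm (lebesgue_on {0<..<x}) (\<lambda>s. h s - C s) * l2norm (lebesgue_on {0<..<x}) (\<lambda>s. 1)"
      by (intro l2_cauchy_schwarz d continuous_sq_int continuous_intros) auto
    also have "\<dots> \<le> 0 * l2norm (lebesgue_on {0<..<x}) (\<lambda>s. 1)"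
      using d(2) hC by (intro mult_right_mono) auto
    finally have "(LINT s|lebesgue_on {0<..<x}. h s - C s) = 0" by simp
    then have "(LINT s|lebesgue_on {0<..<x}. h s) = (LINT s|lebesgue_on {0<..<x}. C s)"
      using Bochner_Integration.integral_diff[OF hi ci] by simp
    then show ?thesis
      using H10_derivD(3)[OF h x] open_interval_henstock(2)[OF ci] by simp
  qed
  have "((\<lambda>u. integral {0..u} C) has_vector_derivative C 0) (at 0 within {0..L})"
    using L by (intro integral_has_vector_derivative cC) auto
  then have "(\<phi> has_vector_derivative C 0) (at 0 within {0..L})"
    by (rule has_vector_derivative_transform[rotated 2]) (use L \<phi> in auto)
  then have "D = C 0"
    using vector_derivative_unique_within_closed_interval[of 0 L 0 \<phi> D "C 0"] D L by simp
  then show ?thesis by (simp add: C_def cos_mode_def mult.commute)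
qed

text \<open>The equation is diagonal in the sine modes: each coefficient I satisfies I' = i n^2
  \<omega> I. For classical solutions the boundary derivative becomes an absolutely convergent
  series of exponentials, which turns the transposition identity into a statement on moments of the
  control.\<close>

lemma adjoint_solution_modes:
  assumes L: "0 < L" and \<tau>: "0 < \<tau>" and adj: "adjoint_solution \<tau> L \<phi> \<phi>x"
  defines "\<omega> \<equiv> (pi / L)\<^sup>2"
  shows "t \<in> {0..\<tau>} \<Longrightarrow> H10_deriv L (\<phi> t) (\<phi>x t)"
    and "t \<in> {0..\<tau>} \<Longrightarrow> sine_coeff L (\<phi> t) n = sine_coeff L (\<phi> 0) n * cis ((real n)\<^sup>2 * \<omega> * t)"
    and "summable (\<lambda>n. real n * cmod (sine_coeff L (\<phi> 0) n))"
    and "t \<in> {0..\<tau>} \<Longrightarrow> \<phi>x t 0 = (\<Sum>n. of_real (real n * pi / L) * sine_coeff L (\<phi> 0) n * cis ((real n)\<^sup>2 * \<omega> * t))"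
proof -
  from adj obtain \<phi>t \<phi>xx where
    c: "\<And>f. f \<in> {\<phi>, \<phi>t, \<phi>x, \<phi>xx} \<Longrightarrow> continuous_on ({0..\<tau>} \<times> {0..L}) (\<lambda>(t, x). f t x)"
    and dt: "\<And>t x. t \<in> {0..\<tau>} \<Longrightarrow> x \<in> {0..L} \<Longrightarrow> ((\<lambda>s. \<phi> s x) has_vector_derivative \<phi>t t x) (at t within {0..\<tau>})"
    and dx: "\<And>t x. t \<in> {0..\<tau>} \<Longrightarrow> x \<in> {0..L} \<Longrightarrow> (\<phi> t has_vector_derivative \<phi>x t x) (at x within {0..L})"
    and dxx: "\<And>t x. t \<in> {0..\<tau>} \<Longrightarrow> x \<in> {0..L} \<Longrightarrow> (\<phi>x t has_vector_derivative \<phi>xx t x) (at x within {0..L})"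
    and eq: "\<And>t x. t \<in> {0..\<tau>} \<Longrightarrow> x \<in> {0..L} \<Longrightarrow> - \<i> * \<phi>t t x + \<phi>xx t x = 0"
    and b: "\<And>t. t \<in> {0..\<tau>} \<Longrightarrow> \<phi> t 0 = 0 \<and> \<phi> t L = 0"
    unfolding adjoint_solution_def by blast
  have slice: "continuous_on {0..L} (f t)" if "f \<in> {\<phi>, \<phi>t, \<phi>x, \<phi>xx}" "t \<in> {0..\<tau>}" for f t
  proof -
    have "continuous_on {0..L} (Pair t)" by (intro continuous_intros)
    moreover have "Pair t ` {0..L} \<subseteq> {0..\<tau>} \<times> {0..L}" using that(2) by auto
    ultimately have "continuous_on {0..L} (\<lambda>x. (\<lambda>(t, x). f t x) (t, x))"
      by (rule continuous_on_compose2[OF c[OF that(1)]])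
    then show ?thesis by simp
  qed
  show H: "H10_deriv L (\<phi> t) (\<phi>x t)" if t: "t \<in> {0..\<tau>}" for t
    using b[OF t] by (intro H10_deriv_classical[OF L dx[OF t]] slice t) auto
  have t0: "0 \<in> {0..\<tau>}" using \<tau> by simp
  show sm: "summable (\<lambda>n. real n * cmod (sine_coeff L (\<phi> 0) n))"
    using b[OF t0] by (intro sine_coeff_summable[OF L dx[OF t0] dxx[OF t0]] slice t0) auto
  show coeff: "sine_coeff L (\<phi> t) n = sine_coeff L (\<phi> 0) n * cis ((real n)\<^sup>2 * \<omega> * t)" if t: "t \<in> {0..\<tau>}" for t n
  proof -
    define r where "r = (real n)\<^sup>2 * \<omega>"
    define I where "I = (\<lambda>t. integral {0..L} (\<lambda>x. \<phi> t x * sin_mode L n x))"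
    have dI: "(I has_vector_derivative \<i> * of_real r * I t) (at t within {0..\<tau>})" if t: "t \<in> {0..\<tau>}" for t
    proof -
      have "((\<lambda>t. integral (cbox 0 L) (\<lambda>x. \<phi> t x * sin_mode L n x)) has_vector_derivative
          integral (cbox 0 L) (\<lambda>x. \<phi>t t x * sin_mode L n x)) (at t within {0..\<tau>})"
      proof (rule leibniz_rule_vector_derivative[where U="{0..\<tau>}" and fx="\<lambda>t x. \<phi>t t x * sin_mode L n x"])
        fix s x assume s: "s \<in> {0..\<tau>}" and x: "x \<in> cbox 0 L"
        show "((\<lambda>s. \<phi> s x * sin_mode L n x) has_vector_derivative \<phi>t s x * sin_mode L n x) (at s within {0..\<tau>})"
          using x by (intro has_vector_derivative_mult_left dt s) auto
      next
        fix s assume "s \<in> {0..\<tau>}"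
        then show "(\<lambda>x. \<phi> s x * sin_mode L n x) integrable_on cbox 0 L"
          unfolding cbox_interval
          by (intro integrable_continuous_real continuous_intros slice continuous_modes) auto
      next
        have "continuous_on ({0..\<tau>} \<times> {0..L}) (\<lambda>p. sin_mode L n (snd p))"
          by (rule continuous_on_compose2[OF continuous_modes(1)]) (auto intro!: continuous_intros)
        moreover have "continuous_on ({0..\<tau>} \<times> {0..L}) (\<lambda>p. \<phi>t (fst p) (snd p))"
          using c[of \<phi>t] by (simp add: split_def)
        ultimately show "continuous_on ({0..\<tau>} \<times> cbox 0 L) (\<lambda>(t, x). \<phi>t t x * sin_mode L n x)"
          unfolding split_def cbox_interval by (intro continuous_intros)
      qed (use t in auto)
      then have "(I has_vector_derivative integral {0..L} (\<lambda>x. \<phi>t t x * sin_mode L n x)) (at t within {0..\<tau>})"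
        by (simp add: I_def)
      moreover have "integral {0..L} (\<lambda>x. \<phi>t t x * sin_mode L n x) = integral {0..L} (\<lambda>x. - \<i> * (\<phi>xx t x * sin_mode L n x))"
      proof (rule integral_cong)
        fix x assume "x \<in> {0..L}"
        then have "\<phi>xx t x = \<i> * \<phi>t t x" using eq[OF t, of x] by (simp add: algebra_simps)
        then show "\<phi>t t x * sin_mode L n x = - \<i> * (\<phi>xx t x * sin_mode L n x)"
          by (simp add: mult.assoc)
      qed
      moreover have "integral {0..L} (\<lambda>x. \<phi>xx t x * sin_mode L n x) = - (of_real ((real n * pi / L)\<^sup>2) * I t)"
        unfolding I_def using b[OF t]
        by (intro sine_coeff_second_derivative[OF L dx[OF t] dxx[OF t]] slice t) auto
      moreover have "(real n * pi / L)\<^sup>2 = r" by (simp add: r_def \<omega>_def power_mult_distrib power_divide)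
      ultimately show ?thesis by (simp add: mult.assoc)
    qed
    \<comment> \<open>Integrating factor for the equation of the n-th coefficient.\<close>
    define G where "G = (\<lambda>t. I t * cis (- r * t))"
    have dG: "(G has_vector_derivative 0) (at t within {0..\<tau>})" if t: "t \<in> {0..\<tau>}" for t
    proof -
      have "((\<lambda>z. exp (- \<i> * of_real r * z)) has_field_derivative - \<i> * of_real r * exp (- \<i> * of_real r * of_real t)) (at (of_real t))"
        by (auto intro!: derivative_eq_intros)
      then have "((\<lambda>t. exp (- \<i> * of_real r * of_real t)) has_vector_derivative - \<i> * of_real r * exp (- \<i> * of_real r * of_real t)) (at t within {0..\<tau>})"
        by (rule has_vector_derivative_real_field)
      then have e: "((\<lambda>t. cis (- r * t)) has_vector_derivative - \<i> * of_real r * cis (- r * t)) (at t within {0..\<tau>})"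
        by (simp add: cis_conv_exp mult.assoc)
      have "(G has_vector_derivative I t * (- \<i> * of_real r * cis (- r * t)) + \<i> * of_real r * I t * cis (- r * t)) (at t within {0..\<tau>})"
        unfolding G_def by (rule has_vector_derivative_mult[OF dI[OF t] e])
      then show ?thesis by (simp add: algebra_simps)
    qed
    have "G t = G 0"
      using has_vector_derivative_zero_constant[OF convex_real_interval(5) dG] t t0 by metis
    then have "I t * cis (- r * t) = I 0" by (simp add: G_def)
    then have "I t * cis (- r * t) * cis (r * t) = I 0 * cis (r * t)" by simp
    then have "I t = I 0 * cis (r * t)" by (simp add: mult.assoc cis_mult)
    then show ?thesis by (simp add: sine_coeff_def I_def r_def mult.assoc)
  qed
  show "\<phi>x t 0 = (\<Sum>n. of_real (real n * pi / L) * sine_coeff L (\<phi> 0) n * cis ((real n)\<^sup>2 * \<omega> * t))" if t: "t \<in> {0..\<tau>}" for t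
  proof -
    have "summable (\<lambda>n. real n * cmod (sine_coeff L (\<phi> t) n))"
      using sm by (simp add: coeff[OF t] norm_mult)
    then have "\<phi>x t 0 = (\<Sum>n. of_real (real n * pi / L) * sine_coeff L (\<phi> t) n)"
      using dx[OF t, of 0] L by (intro boundary_derivative_series[OF L H[OF t]]) auto
    then show ?thesis by (simp add: coeff[OF t] mult.assoc)
  qed
qed

section \<open>From moments to null controls\<close>

lemma indefinite_integral_diff:
  fixes f :: "real \<Rightarrow> 'b::euclidean_space"
  assumes f: "integrable (lebesgue_on {0<..<T}) f" and st: "0 \<le> t" "t \<le> s" "s \<le> T"
  shows "(LINT x|lebesgue_on {0<..<s}. f x) - (LINT x|lebesgue_on {0<..<t}. f x) = (LINT x|lebesgue_on {t<..<s}. f x)"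
proof -
  have sub: "integrable (lebesgue_on {p<..<q}) f" if "0 \<le> p" "q \<le> T" for p q
    using that by (intro lebesgue_on_subset[OF _ _ _ f]) auto
  have "f integrable_on {0..s}" using st by (intro open_interval_henstock(1) sub) auto
  then have "integral {0..t} f + integral {t..s} f = integral {0..s} f"
    using st by (intro Henstock_Kurzweil_Integration.integral_combine) auto
  then show ?thesis
    using open_interval_henstock(2)[OF sub[of 0 s]] open_interval_henstock(2)[OF sub[of 0 t]]
      open_interval_henstock(2)[OF sub[of t s]] st by (simp add: algebra_simps)
qed

text \<open>Squares of distinct naturals are distinct integers and (p, q) lies within the period (0,
  P), so this is a sub-sum of the Bessel inequality for the exponentials.\<close>

lemma square_bessel:
  assumes \<omega>: "0 < \<omega>" and P: "P = 2 * pi / \<omega>" and pq: "0 \<le> p" "q \<le> P"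
    and u: "sq_int (lebesgue_on {p<..<q}) u"
  shows "summable (\<lambda>n. (cmod (LINT t|lebesgue_on {p<..<q}. u t * cis ((real n)\<^sup>2 * \<omega> * t)))\<^sup>2)"
    and "(\<Sum>n. (cmod (LINT t|lebesgue_on {p<..<q}. u t * cis ((real n)\<^sup>2 * \<omega> * t)))\<^sup>2)
      \<le> P * (l2norm (lebesgue_on {p<..<q}) u)\<^sup>2"
proof -
  let ?a = "\<lambda>n. (cmod (LINT t|lebesgue_on {p<..<q}. u t * cis ((real n)\<^sup>2 * \<omega> * t)))\<^sup>2"
  have bd: "(\<Sum>n\<in>F. ?a n) \<le> P * (l2norm (lebesgue_on {p<..<q}) u)\<^sup>2" if "finite F" for F
  proof -
    have inj: "inj_on (\<lambda>n. (int n)\<^sup>2) F" by (auto simp: inj_on_def power2_eq_iff_nonneg)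
    have "(\<Sum>n\<in>F. ?a n) = (\<Sum>k\<in>(\<lambda>n. (int n)\<^sup>2) ` F. (cmod (LINT t|lebesgue_on {p<..<q}. u t * cis (of_int k * \<omega> * t)))\<^sup>2)"
      unfolding sum.reindex[OF inj] by simp
    also have "\<dots> \<le> P * (l2norm (lebesgue_on {p<..<q}) u)\<^sup>2"
      using that pq by (intro trig_bessel[OF \<omega> P _ _ u, of _ 0]) auto
    finally show ?thesis .
  qed
  show s: "summable ?a" by (rule bounded_imp_summable[OF _ bd]) simp_all
  show "suminf ?a \<le> P * (l2norm (lebesgue_on {p<..<q}) u)\<^sup>2"
    by (rule suminf_le_const[OF s bd]) simp
qed

text \<open>The solution is given by Duhamel's formula: it takes at the n-th sine mode the value
  exp(-i n^2 \<omega> t) (y0_n + i (n \<pi> / L) d_n(t)), where y0_n is that of \<open>y0\<close>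
  and d_n(t) the moment of u over (0, t). The moment condition says that it vanishes at T. The bound
  on T reads T \<le> 2 \<pi> / \<omega>, which gives Bessel on all sub-intervals of (0, T).\<close>

theorem null_control_of_moments:
  assumes L: "0 < L" and T: "0 < T" "T \<le> 2 * L\<^sup>2 / pi" and y0: "y0 \<in> Hm1 L"
    and u: "sq_int (lebesgue_on {0<..<T}) u"
  defines "\<omega> \<equiv> (pi / L)\<^sup>2"
  assumes mom: "\<And>n. 1 \<le> n \<Longrightarrow> y0 (sin_mode L n) + \<i> * of_real (real n * pi / L) *
      (LINT t|lebesgue_on {0<..<T}. u t * cis ((real n)\<^sup>2 * \<omega> * t)) = 0"
  shows "null_control T L y0 u"
proof -
  define P where "P = 2 * pi / \<omega>"
  have \<omega>: "0 < \<omega>" using L by (simp add: \<omega>_def)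
  have TP: "T \<le> P" using T L by (simp add: P_def \<omega>_def power_divide power2_eq_square)
  have P0: "0 < P" using \<omega> by (simp add: P_def)
  define d where "d = (\<lambda>n t. LINT s|lebesgue_on {0<..<t}. u s * cis ((real n)\<^sup>2 * \<omega> * s))"
  \<comment> \<open>Values at the modes divided by n, as \<open>dual_series\<close> expects, and
    without their phases, which \<open>z\<close> restores. The entry at n = 0 is removed by the
    weight n of \<open>dual_series\<close>.\<close>
  define b where "b = (\<lambda>t n. y0 (sin_mode L n) / of_nat n + \<i> * of_real (pi / L) * d n t)"
  define e where "e = (\<lambda>t n. cis (- ((real n)\<^sup>2 * \<omega> * t)))"
  define z where "z = (\<lambda>t n. e t n * b t n)"
  define y where "y = (\<lambda>t. dual_series L (z t))"
  have usub: "sq_int (lebesgue_on {p<..<q}) u" if "0 \<le> p" "q \<le> T" for p q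
    using that by (intro sq_int_subset(1)[OF _ _ _ u]) auto
  have ui: "integrable (lebesgue_on {0<..<T}) (\<lambda>s. u s * cis ((real n)\<^sup>2 * \<omega> * s))" for n
    by (intro sq_int_mult_integrable u continuous_sq_int continuous_intros)
  have bs: "summable (\<lambda>n. (cmod (b t n))\<^sup>2)" if t: "t \<in> {0..T}" for t
  proof (rule summable_comparison_test')
    have "summable (\<lambda>n. (cmod (d n t))\<^sup>2)"
      unfolding d_def using t TP by (intro square_bessel(1)[OF \<omega> P_def] usub) auto
    then show "summable (\<lambda>n. 2 * (cmod (y0 (sin_mode L n)) / real n)\<^sup>2 + 2 * ((pi / L)\<^sup>2 * (cmod (d n t))\<^sup>2))"
      by (intro summable_add summable_mult Hm1_coeff_bound(1) L y0)
    fix n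
    have "(cmod (b t n))\<^sup>2 \<le> 2 * (cmod (y0 (sin_mode L n) / of_nat n))\<^sup>2 + 2 * (cmod (\<i> * of_real (pi / L) * d n t))\<^sup>2"
      unfolding b_def by (rule cmod_add_sq_le)
    also have "\<dots> = 2 * (cmod (y0 (sin_mode L n)) / real n)\<^sup>2 + 2 * ((pi / L)\<^sup>2 * (cmod (d n t))\<^sup>2)"
      using L by (simp add: norm_divide norm_mult power_mult_distrib power_divide)
    finally show "norm ((cmod (b t n))\<^sup>2) \<le> 2 * (cmod (y0 (sin_mode L n)) / real n)\<^sup>2 + 2 * ((pi / L)\<^sup>2 * (cmod (d n t))\<^sup>2)"
      by simp
  qed
  have ne: "cmod (e t n) = 1" for t n by (simp add: e_def)
  have zs: "summable (\<lambda>n. (cmod (z t n))\<^sup>2)" if "t \<in> {0..T}" for t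
    using bs[OF that] by (simp add: z_def norm_mult ne)
  define U where "U = (\<lambda>x. LINT s|lebesgue_on {0<..<x}. (cmod (u s))\<^sup>2)"
  have u2: "integrable (lebesgue_on {0<..<T}) (\<lambda>s. (cmod (u s))\<^sup>2)" using u by (simp add: sq_int_def)
  have cU: "continuous_on {0..T} U" unfolding U_def by (rule continuous_indefinite_integral[OF u2])
  \<comment> \<open>Increments of b are moments of u over (t, s), so Bessel bounds them by the
    integral of |u|^2 there, an increment of the continuous function \<open>U\<close>.\<close>
  have bd1: "summable (\<lambda>n. (cmod (b s n - b t n))\<^sup>2) \<and> (\<Sum>n. (cmod (b s n - b t n))\<^sup>2) \<le> (pi / L)\<^sup>2 * P * \<bar>U s - U t\<bar>"
    if ts: "t \<in> {0..T}" "s \<in> {0..T}" "t \<le> s" for s t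
  proof -
    let ?J = "\<lambda>n. (cmod (LINT x|lebesgue_on {t<..<s}. u x * cis ((real n)\<^sup>2 * \<omega> * x)))\<^sup>2"
    have "(cmod (b s n - b t n))\<^sup>2 = (pi / L)\<^sup>2 * ?J n" for n
    proof -
      have "b s n - b t n = \<i> * of_real (pi / L) * (d n s - d n t)"
        by (simp only: b_def right_diff_distrib add_diff_cancel_left)
      also have "d n s - d n t = (LINT x|lebesgue_on {t<..<s}. u x * cis ((real n)\<^sup>2 * \<omega> * x))"
        unfolding d_def using ts by (intro indefinite_integral_diff[OF ui]) auto
      finally show ?thesis
        by (simp only: norm_mult norm_ii norm_of_real power_mult_distrib power2_abs power_one mult_1)
    qed
    note eq = this
    have us: "sq_int (lebesgue_on {t<..<s}) u" using ts by (intro usub) auto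
    have tsP: "0 \<le> t" "s \<le> P" using ts TP by auto
    note bes = square_bessel[OF \<omega> P_def tsP us]
    have "(l2norm (lebesgue_on {t<..<s}) u)\<^sup>2 = U s - U t"
      unfolding l2norm_sq U_def using ts by (intro indefinite_integral_diff[symmetric, OF u2]) auto
    then have "(\<Sum>n. ?J n) \<le> P * \<bar>U s - U t\<bar>"
      using bes(2) P0 by (intro order_trans[OF bes(2)] mult_left_mono) auto
    then have "(pi / L)\<^sup>2 * (\<Sum>n. ?J n) \<le> (pi / L)\<^sup>2 * (P * \<bar>U s - U t\<bar>)" by (rule mult_left_mono) simp
    then show ?thesis unfolding eq suminf_mult[OF bes(1)] using summable_mult[OF bes(1)] by (simp add: mult.assoc)
  qed
  have bd: "summable (\<lambda>n. (cmod (b s n - b t n))\<^sup>2) \<and> (\<Sum>n. (cmod (b s n - b t n))\<^sup>2) \<le> (pi / L)\<^sup>2 * P * \<bar>U s - U t\<bar>"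
    if ts: "t \<in> {0..T}" "s \<in> {0..T}" for s t
  proof (cases "t \<le> s")
    case True then show ?thesis using bd1 ts by blast
  next
    case False
    then show ?thesis using bd1[of s t] ts by (simp add: norm_minus_commute[of "b s _"] abs_minus_commute)
  qed
  have cont: "continuous_Hm1 T L y"
    unfolding y_def
  proof (rule continuous_Hm1_dual_series[OF L zs])
    fix t assume t: "t \<in> {0..T}"
    \<comment> \<open>Contribution of the rotating phases with b frozen at time t. The phases are
      not equicontinuous in n, so continuity comes from the summable majorant 4 |b|^2.\<close>
    define K where "K = (\<lambda>s. \<Sum>n. (cmod (e s n - e t n))\<^sup>2 * (cmod (b t n))\<^sup>2)"
    have Kb: "norm ((cmod (e s n - e t n))\<^sup>2 * (cmod (b t n))\<^sup>2) \<le> 4 * (cmod (b t n))\<^sup>2" for s n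
    proof -
      have "cmod (e s n - e t n) \<le> 2" using norm_triangle_ineq4[of "e s n" "e t n"] by (simp add: ne)
      then have "(cmod (e s n - e t n))\<^sup>2 \<le> 2\<^sup>2" by (rule power_mono) simp
      then have "(cmod (e s n - e t n))\<^sup>2 * (cmod (b t n))\<^sup>2 \<le> 2\<^sup>2 * (cmod (b t n))\<^sup>2" by (rule mult_right_mono) simp
      then show ?thesis by simp
    qed
    have sm4: "summable (\<lambda>n. 4 * (cmod (b t n))\<^sup>2)" by (intro summable_mult bs t)
    have "uniform_limit UNIV (\<lambda>N s. \<Sum>n<N. (cmod (e s n - e t n))\<^sup>2 * (cmod (b t n))\<^sup>2) K sequentially"
      unfolding K_def by (rule Weierstrass_m_test[OF Kb sm4])
    then have "continuous_on UNIV K"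
      by (rule uniform_limit_theorem[rotated]) (auto simp: e_def intro!: always_eventually continuous_intros)
    then have "isCont K t" by (simp add: continuous_on_eq_continuous_at)
    then have "(K \<longlongrightarrow> K t) (at t within {0..T})"
      unfolding isCont_def by (rule tendsto_within_subset) simp
    moreover have "K t = 0" by (simp add: K_def)
    ultimately have K: "(K \<longlongrightarrow> 0) (at t within {0..T})" by simp
    have Ut: "(U \<longlongrightarrow> U t) (at t within {0..T})" using cU t by (simp add: continuous_on_def)
    have "((\<lambda>s. 2 * ((pi / L)\<^sup>2 * P * \<bar>U s - U t\<bar>) + 2 * K s) \<longlongrightarrow> 2 * ((pi / L)\<^sup>2 * P * \<bar>U t - U t\<bar>) + 2 * 0) (at t within {0..T})"
      by (intro tendsto_intros Ut K)
    then have maj: "((\<lambda>s. 2 * ((pi / L)\<^sup>2 * P * \<bar>U s - U t\<bar>) + 2 * K s) \<longlongrightarrow> 0) (at t within {0..T})" by simp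
    have le: "0 \<le> (\<Sum>n. (cmod (z s n - z t n))\<^sup>2) \<and> (\<Sum>n. (cmod (z s n - z t n))\<^sup>2) \<le> 2 * ((pi / L)\<^sup>2 * P * \<bar>U s - U t\<bar>) + 2 * K s"
      if s: "s \<in> {0..T}" for s
    proof -
      have sK: "summable (\<lambda>n. (cmod (e s n - e t n))\<^sup>2 * (cmod (b t n))\<^sup>2)"
        by (rule summable_comparison_test'[OF sm4 Kb])
      note sb = bd[OF t s]
      \<comment> \<open>The increment of z is split into the change of b, multiplied by phases of
        modulus 1, and the change of phase with b fixed.\<close>
      have pw: "(cmod (z s n - z t n))\<^sup>2 \<le> 2 * (cmod (b s n - b t n))\<^sup>2 + 2 * ((cmod (e s n - e t n))\<^sup>2 * (cmod (b t n))\<^sup>2)" for n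
      proof -
        have "z s n - z t n = e s n * (b s n - b t n) + (e s n - e t n) * b t n" by (simp add: z_def algebra_simps)
        then show ?thesis
          using cmod_add_sq_le[of "e s n * (b s n - b t n)" "(e s n - e t n) * b t n"]
          by (simp add: norm_mult ne power_mult_distrib)
      qed
      have s2: "summable (\<lambda>n. 2 * (cmod (b s n - b t n))\<^sup>2 + 2 * ((cmod (e s n - e t n))\<^sup>2 * (cmod (b t n))\<^sup>2))"
        using sb sK by (intro summable_add summable_mult) auto
      have s1: "summable (\<lambda>n. (cmod (z s n - z t n))\<^sup>2)"
        by (rule summable_comparison_test'[OF s2]) (use pw in simp)
      have "(\<Sum>n. (cmod (z s n - z t n))\<^sup>2) \<le> (\<Sum>n. 2 * (cmod (b s n - b t n))\<^sup>2 + 2 * ((cmod (e s n - e t n))\<^sup>2 * (cmod (b t n))\<^sup>2))"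
        by (rule suminf_le[OF pw s1 s2])
      also have "\<dots> = 2 * (\<Sum>n. (cmod (b s n - b t n))\<^sup>2) + 2 * K s"
        unfolding K_def using sb sK by (simp add: suminf_add[symmetric] suminf_mult summable_mult)
      finally show ?thesis using sb s1 by (auto intro: suminf_nonneg)
    qed
    show "((\<lambda>s. \<Sum>n. (cmod (z s n - z t n))\<^sup>2) \<longlongrightarrow> 0) (at t within {0..T})"
    proof (rule tendsto_sandwich[OF _ _ tendsto_const maj])
      show "\<forall>\<^sub>F s in at t within {0..T}. 0 \<le> (\<Sum>n. (cmod (z s n - z t n))\<^sup>2)"
        unfolding eventually_at_filter using le by (intro always_eventually) auto
      show "\<forall>\<^sub>F s in at t within {0..T}. (\<Sum>n. (cmod (z s n - z t n))\<^sup>2) \<le> 2 * ((pi / L)\<^sup>2 * P * \<bar>U s - U t\<bar>) + 2 * K s"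
        unfolding eventually_at_filter using le by (intro always_eventually) auto
    qed
  qed
  have nb: "of_nat n * b t n = y0 (sin_mode L n) + \<i> * of_real (real n * pi / L) * d n t" if "n \<noteq> 0" for n t
    using that by (simp add: b_def distrib_left)
  have expand: "(\<lambda>n. sine_coeff L \<phi> n * y0 (sin_mode L n)) sums y0 \<phi>" if "\<phi> \<in> H10 L" for \<phi>
    using that Hm1_expansion[OF L y0] by (auto simp: H10_def)
  have init: "y 0 \<phi> = y0 \<phi>" if "\<phi> \<in> H10 L" for \<phi>
  proof -
    have eq: "sine_coeff L \<phi> n * (of_nat n * z 0 n) = sine_coeff L \<phi> n * y0 (sin_mode L n)" for n
      using nb[of n 0] by (cases "n = 0") (auto simp: z_def e_def d_def)
    show ?thesis unfolding y_def dual_series_def eq using expand[OF that] by (simp add: sums_iff)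
  qed
  have final: "y T \<phi> = 0" for \<phi>
  proof -
    have "sine_coeff L \<phi> n * (of_nat n * z T n) = 0" for n
    proof (cases "n = 0")
      case False
      then have "of_nat n * b T n = 0" using nb[OF False, of T] mom[of n] by (simp add: d_def)
      then show ?thesis using False by (simp add: z_def)
    qed simp
    then show ?thesis unfolding y_def dual_series_def by (simp only: suminf_zero)
  qed
  \<comment> \<open>When the adjoint solution is expanded in modes, its phases at \<tau> cancel
    those of y, and by uniform convergence the boundary integral becomes the series of the moments
    over (0, \<tau>).\<close>
  have transposition: "\<i> * y \<tau> (\<phi> \<tau>) - \<i> * y0 (\<phi> 0) + (LINT t|lebesgue_on {0<..<\<tau>}. u t * \<phi>x t 0) = 0"
    if \<tau>: "0 < \<tau>" "\<tau> \<le> T" and adj: "adjoint_solution \<tau> L \<phi> \<phi>x" for \<tau> \<phi> \<phi>x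
  proof -
    note modes = adjoint_solution_modes[OF L \<tau>(1) adj, folded \<omega>_def]
    let ?c = "\<lambda>n. sine_coeff L (\<phi> 0) n"
    let ?f = "\<lambda>n t. of_real (real n * pi / L) * ?c n * cis ((real n)\<^sup>2 * \<omega> * t)"
    let ?M = "lebesgue_on {0<..<\<tau>}"
    have \<tau>in: "\<tau> \<in> {0..\<tau>}" "0 \<in> {0..\<tau>}" "\<tau> \<in> {0..T}" using \<tau> by auto
    have H0: "\<phi> 0 \<in> H10 L" using modes(1)[OF \<tau>in(2)] by (auto simp: H10_def)
    define X where "X = (\<lambda>t. \<Sum>n. ?f n t)"
    have sm: "summable (\<lambda>n. pi / L * (real n * cmod (?c n)))" by (rule summable_mult[OF modes(3)])
    have ul: "uniform_limit {0..\<tau>} (\<lambda>N t. \<Sum>n<N. ?f n t) X sequentially"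
      unfolding X_def
    proof (rule Weierstrass_m_test[OF _ sm])
      show "norm (?f n t) \<le> pi / L * (real n * cmod (?c n))" for n t
        using L by (simp add: norm_mult norm_divide mult_ac)
    qed
    have cN: "continuous_on A (\<lambda>t. \<Sum>n<N. ?f n t)" for A N by (intro continuous_intros)
    note cX = l2norm_uniform_limit(1)[OF cN \<tau>(1) ul] and lim = l2norm_uniform_limit(2)[OF cN \<tau>(1) ul]
    have sqN: "sq_int ?M (\<lambda>t. \<Sum>n<N. ?f n t)" for N by (intro continuous_sq_int cN)
    have sqX: "sq_int ?M X" by (intro continuous_sq_int cX)
    have squ: "sq_int ?M u" using \<tau> by (intro usub) auto
    have "(\<lambda>N. LINT t|?M. (\<Sum>n<N. ?f n t) * u t) \<longlonglongrightarrow> (LINT t|?M. X t * u t)"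
      by (rule l2_tendsto_integral[OF sqN sqX squ lim])
    moreover have "(LINT t|?M. (\<Sum>n<N. ?f n t) * u t) = (\<Sum>n<N. of_real (real n * pi / L) * ?c n * d n \<tau>)" for N
    proof -
      have i: "integrable ?M (\<lambda>t. u t * cis ((real n)\<^sup>2 * \<omega> * t))" for n
        using \<tau> by (intro lebesgue_on_subset[OF _ _ _ ui]) auto
      have "(LINT t|?M. (\<Sum>n<N. ?f n t) * u t) = (LINT t|?M. (\<Sum>n<N. (of_real (real n * pi / L) * ?c n) * (u t * cis ((real n)\<^sup>2 * \<omega> * t))))"
        unfolding sum_distrib_right
        by (intro Bochner_Integration.integral_cong sum.cong refl) (simp only: mult_ac)
      also have "\<dots> = (\<Sum>n<N. LINT t|?M. (of_real (real n * pi / L) * ?c n) * (u t * cis ((real n)\<^sup>2 * \<omega> * t)))"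
        by (intro Bochner_Integration.integral_sum integrable_mult_right i)
      finally show ?thesis by (simp only: integral_mult_right_zero d_def)
    qed
    ultimately have s1: "(\<lambda>n. of_real (real n * pi / L) * ?c n * d n \<tau>) sums (LINT t|?M. X t * u t)"
      by (simp add: sums_def)
    have "(LINT t|?M. X t * u t) = (LINT t|?M. u t * \<phi>x t 0)"
      by (rule Bochner_Integration.integral_cong) (auto simp: X_def modes(4))
    with s1 have s1: "(\<lambda>n. of_real (real n * pi / L) * ?c n * d n \<tau>) sums (LINT t|?M. u t * \<phi>x t 0)" by simp
    have summand: "sine_coeff L (\<phi> \<tau>) n * (of_nat n * z \<tau> n) =
        ?c n * y0 (sin_mode L n) + \<i> * (of_real (real n * pi / L) * ?c n * d n \<tau>)" for n
    proof (cases "n = 0")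
      case False
      have "cis ((real n)\<^sup>2 * \<omega> * \<tau>) * e \<tau> n = 1" by (simp add: e_def cis_mult)
      then have "sine_coeff L (\<phi> \<tau>) n * (of_nat n * z \<tau> n) = ?c n * (of_nat n * b \<tau> n)"
        unfolding modes(2)[OF \<tau>in(1)] z_def by (simp add: mult_ac)
      then show ?thesis unfolding nb[OF False] by (simp add: algebra_simps)
    qed simp
    have "(\<lambda>n. sine_coeff L (\<phi> \<tau>) n * (of_nat n * z \<tau> n)) sums (y0 (\<phi> 0) + \<i> * (LINT t|?M. u t * \<phi>x t 0))"
      unfolding summand by (intro sums_add sums_mult expand H0 s1)
    then have "y \<tau> (\<phi> \<tau>) = y0 (\<phi> 0) + \<i> * (LINT t|?M. u t * \<phi>x t 0)"
      unfolding y_def dual_series_def by (simp add: sums_iff)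
    then show ?thesis by (simp add: algebra_simps)
  qed
  have "schroedinger_solution T L y0 u y"
    unfolding schroedinger_solution_def using cont init transposition by blast
  then show ?thesis
    unfolding null_control_def space_L2_iff using u final by blast
qed

section \<open>The cost of fast controls\<close>

lemma lebesgue_on_affine:
  fixes f :: "real \<Rightarrow> 'b::euclidean_space"
  assumes \<omega>: "0 < \<omega>" and ab: "a = c + \<omega> * p" "b = c + \<omega> * q"
  shows "(LINT x|lebesgue_on {a<..<b}. f x) = \<omega> *\<^sub>R (LINT t|lebesgue_on {p<..<q}. f (c + \<omega> * t))"
    and "integrable (lebesgue_on {a<..<b}) f \<Longrightarrow> integrable (lebesgue_on {p<..<q}) (\<lambda>t. f (c + \<omega> * t))"
proof -
  have ind: "indicator {a<..<b} (c + \<omega> * t) = (indicator {p<..<q} t :: real)" for t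
    using \<omega> by (auto simp: ab indicator_def)
  have \<omega>0: "\<omega> \<noteq> 0" using \<omega> by simp
  show "(LINT x|lebesgue_on {a<..<b}. f x) = \<omega> *\<^sub>R (LINT t|lebesgue_on {p<..<q}. f (c + \<omega> * t))"
    using lebesgue_integral_real_affine[OF \<omega>0, of "\<lambda>x. indicator {a<..<b} x *\<^sub>R f x" c] \<omega>
    by (simp add: integral_restrict_space ind)
  show "integrable (lebesgue_on {p<..<q}) (\<lambda>t. f (c + \<omega> * t))" if "integrable (lebesgue_on {a<..<b}) f"
    using lebesgue_integrable_real_affine[OF _ \<omega>0, of "\<lambda>x. indicator {a<..<b} x *\<^sub>R f x" c] that
    by (simp add: integrable_restrict_space ind)
qed

text \<open>Measurability passes through the extension of v by 0 to the whole line, where an affine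
  substitution is available.\<close>

lemma sq_int_affine:
  fixes v :: "real \<Rightarrow> complex"
  assumes \<omega>: "0 < \<omega>" and ab: "a = c + \<omega> * p" "b = c + \<omega> * q"
    and v: "sq_int (lebesgue_on {a<..<b}) v"
  shows "sq_int (lebesgue_on {p<..<q}) (\<lambda>t. v (c + \<omega> * t))"
    and "(l2norm (lebesgue_on {a<..<b}) v)\<^sup>2 = \<omega> * (l2norm (lebesgue_on {p<..<q}) (\<lambda>t. v (c + \<omega> * t)))\<^sup>2"
proof -
  define w where "w = (\<lambda>x. if x \<in> {a<..<b} then v x else 0)"
  have "w \<in> borel_measurable lebesgue"
    unfolding w_def using v by (subst borel_measurable_if) (auto simp: sq_int_def)
  then have "(\<lambda>t. w (c + \<omega> *\<^sub>R t)) \<in> borel_measurable lebesgue"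
    using \<omega> by (intro borel_measurable_affine) auto
  then have "(\<lambda>t. w (c + \<omega> * t)) \<in> borel_measurable (lebesgue_on {p<..<q})"
    by (intro measurable_restrict_space1) simp
  moreover have "w (c + \<omega> * t) = v (c + \<omega> * t)" if "t \<in> space (lebesgue_on {p<..<q})" for t
    using that \<omega> by (auto simp: w_def ab)
  ultimately have "(\<lambda>t. v (c + \<omega> * t)) \<in> borel_measurable (lebesgue_on {p<..<q})"
    using measurable_cong[of "lebesgue_on {p<..<q}" "\<lambda>t. w (c + \<omega> * t)" "\<lambda>t. v (c + \<omega> * t)" borel] by blast
  moreover have "integrable (lebesgue_on {p<..<q}) (\<lambda>t. (cmod (v (c + \<omega> * t)))\<^sup>2)"
    using v by (intro lebesgue_on_affine(2)[OF \<omega> ab, of "\<lambda>x. (cmod (v x))\<^sup>2"]) (simp add: sq_int_def)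
  ultimately show "sq_int (lebesgue_on {p<..<q}) (\<lambda>t. v (c + \<omega> * t))" by (simp add: sq_int_def)
  show "(l2norm (lebesgue_on {a<..<b}) v)\<^sup>2 = \<omega> * (l2norm (lebesgue_on {p<..<q}) (\<lambda>t. v (c + \<omega> * t)))\<^sup>2"
    unfolding l2norm_sq using lebesgue_on_affine(1)[OF \<omega> ab, of "\<lambda>x. (cmod (v x))\<^sup>2"] by simp
qed

text \<open>The factor \<open>5 * biorth_bound \<tau>\<close> belongs to the moment problem; \<pi> /
  sqrt(2 L) converts the dual norm of the initial state into the l^2 norm of its weighted
  coefficients.\<close>

definition cost_bound :: "real \<Rightarrow> real \<Rightarrow> real" where
  "cost_bound L \<tau> = 5 * biorth_bound \<tau> * (pi / sqrt (2 * L))"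

text \<open>The substitution s = -\<tau> + \<omega> t maps (0, T) onto (-\<tau>, \<tau>) and the
  frequencies n^2 \<omega> to n^2. The factor \<omega> it produces in the squared norm cancels
  against the one in the sum of |c_n|^2.\<close>

lemma null_control_cost:
  assumes L: "0 < L" and \<tau>: "0 < \<tau>" "\<tau> \<le> 1" and nz: "osc_ft (mult_b \<tau>) 0 \<noteq> 0"
    and T: "T = 2 * \<tau> / (pi / L)\<^sup>2" and y0: "y0 \<in> Hm1 L"
  shows "\<exists>u. null_control T L y0 u \<and> norm_L2 0 T u \<le> cost_bound L \<tau> * norm_Hm1 L y0"
proof -
  define \<omega> where "\<omega> = (pi / L)\<^sup>2"
  have \<omega>: "0 < \<omega>" using L by (simp add: \<omega>_def)
  have T0: "0 < T" using \<tau> \<omega> by (simp add: T \<omega>_def)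
  \<comment> \<open>These moments are dictated by \<open>null_control_of_moments\<close>: the phase
    comes from centring the time interval, and the factor (\<pi> / L) / n is \<omega> divided by n
    \<pi> / L.\<close>
  define c where "c = (\<lambda>n. \<i> * of_real (pi / L) * (y0 (sin_mode L n) / of_nat n) * cis (- ((real n)\<^sup>2 * \<tau>)))"
  have nc: "(cmod (c n))\<^sup>2 = (pi / L)\<^sup>2 * (cmod (y0 (sin_mode L n)) / real n)\<^sup>2" for n
    by (simp add: c_def norm_mult norm_divide power_mult_distrib power_divide)
  note coef = Hm1_coeff_bound[OF L y0]
  have sc: "summable (\<lambda>n. (cmod (c n))\<^sup>2)" unfolding nc by (rule summable_mult[OF coef(1)])
  obtain v where v: "sq_int (lebesgue_on {-\<tau><..<\<tau>}) v"
    and mom: "\<And>n. 1 \<le> n \<Longrightarrow> (LINT t|lebesgue_on {-\<tau><..<\<tau>}. v t * cis ((real n)\<^sup>2 * t)) = c n"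
    and vn: "l2norm (lebesgue_on {-\<tau><..<\<tau>}) v \<le> 5 * biorth_bound \<tau> * sqrt (\<Sum>n. (cmod (c n))\<^sup>2)"
    using moment_problem[OF \<tau> nz sc] by blast
  have ab: "- \<tau> = - \<tau> + \<omega> * 0" "\<tau> = - \<tau> + \<omega> * T" using \<omega> by (auto simp: T \<omega>_def)
  define u where "u = (\<lambda>t. v (- \<tau> + \<omega> * t))"
  have u: "sq_int (lebesgue_on {0<..<T}) u"
    unfolding u_def by (rule sq_int_affine(1)[OF \<omega> ab v])
  have "null_control T L y0 u"
  proof (rule null_control_of_moments[OF L T0 _ y0 u])
    have "T = 2 * L\<^sup>2 / pi * (\<tau> / pi)" by (simp add: T power_divide power2_eq_square)
    also have "\<dots> \<le> 2 * L\<^sup>2 / pi * 1" using \<tau> pi_gt3 by (intro mult_left_mono) (auto simp: pos_divide_le_eq)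
    finally show "T \<le> 2 * L\<^sup>2 / pi" by simp
    fix n :: nat assume n: "1 \<le> n"
    have "c n = of_real \<omega> * (LINT t|lebesgue_on {0<..<T}. u t * cis ((real n)\<^sup>2 * (- \<tau> + \<omega> * t)))"
      unfolding mom[OF n, symmetric] u_def
      using lebesgue_on_affine(1)[OF \<omega> ab, of "\<lambda>t. v t * cis ((real n)\<^sup>2 * t)"]
      by (simp add: scaleR_conv_of_real)
    also have "(LINT t|lebesgue_on {0<..<T}. u t * cis ((real n)\<^sup>2 * (- \<tau> + \<omega> * t))) =
        (LINT t|lebesgue_on {0<..<T}. cis (- ((real n)\<^sup>2 * \<tau>)) * (u t * cis ((real n)\<^sup>2 * \<omega> * t)))"
    proof (rule Bochner_Integration.integral_cong[OF refl])
      fix t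
      have "cis ((real n)\<^sup>2 * (- \<tau> + \<omega> * t)) = cis (- ((real n)\<^sup>2 * \<tau>)) * cis ((real n)\<^sup>2 * \<omega> * t)"
        by (simp add: cis_mult algebra_simps)
      then show "u t * cis ((real n)\<^sup>2 * (- \<tau> + \<omega> * t)) = cis (- ((real n)\<^sup>2 * \<tau>)) * (u t * cis ((real n)\<^sup>2 * \<omega> * t))"
        by simp
    qed
    also have "\<dots> = cis (- ((real n)\<^sup>2 * \<tau>)) * (LINT t|lebesgue_on {0<..<T}. u t * cis ((real n)\<^sup>2 * \<omega> * t))"
      by simp
    finally have f1: "c n = cis (- ((real n)\<^sup>2 * \<tau>)) * (of_real \<omega> * (LINT t|lebesgue_on {0<..<T}. u t * cis ((real n)\<^sup>2 * \<omega> * t)))"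
      by simp
    have f2: "c n = cis (- ((real n)\<^sup>2 * \<tau>)) * (\<i> * of_real (pi / L) * (y0 (sin_mode L n) / of_nat n))"
      by (simp add: c_def)
    have "of_real \<omega> * (LINT t|lebesgue_on {0<..<T}. u t * cis ((real n)\<^sup>2 * \<omega> * t)) =
        \<i> * of_real (pi / L) * (y0 (sin_mode L n) / of_nat n)"
      using trans[OF f1[symmetric] f2] by (simp only: mult_left_cancel[OF cis_neq_zero])
    moreover define X where "X = (LINT t|lebesgue_on {0<..<T}. u t * cis ((real n)\<^sup>2 * \<omega> * t))"
    ultimately have "of_real \<omega> * X = \<i> * of_real (pi / L) * (y0 (sin_mode L n) / of_nat n)" by simp
    moreover have "complex_of_real \<omega> = of_real (pi / L) * of_real (pi / L)" by (simp add: \<omega>_def power2_eq_square)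
    ultimately have "of_real (pi / L) * (of_real (pi / L) * X) = of_real (pi / L) * (\<i> * (y0 (sin_mode L n) / of_nat n))"
      by (simp only: mult_ac)
    moreover have nz: "complex_of_real (pi / L) \<noteq> 0" using L by simp
    ultimately have "of_real (pi / L) * X = \<i> * (y0 (sin_mode L n) / of_nat n)"
      by (simp only: mult_left_cancel[OF nz])
    then have "y0 (sin_mode L n) + \<i> * (of_nat n * (of_real (pi / L) * X)) = 0" using n by simp
    then show "y0 (sin_mode L n) + \<i> * of_real (real n * pi / L) *
        (LINT t|lebesgue_on {0<..<T}. u t * cis ((real n)\<^sup>2 * (pi / L)\<^sup>2 * t)) = 0"
      unfolding \<omega>_def[symmetric] X_def[symmetric] by (simp add: mult_ac)
  qed
  moreover have "norm_L2 0 T u \<le> cost_bound L \<tau> * norm_Hm1 L y0"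
  proof -
    have B: "0 < biorth_bound \<tau>" by (rule biorth_bound_pos[OF \<tau> nz])
    have H: "0 \<le> norm_Hm1 L y0" by (rule norm_Hm1_bound(1)[OF y0])
    have "\<omega> * (norm_L2 0 T u)\<^sup>2 = (l2norm (lebesgue_on {-\<tau><..<\<tau>}) v)\<^sup>2"
      unfolding norm_L2_eq u_def using sq_int_affine(2)[OF \<omega> ab v] by simp
    also have "\<dots> \<le> (5 * biorth_bound \<tau> * sqrt (\<Sum>n. (cmod (c n))\<^sup>2))\<^sup>2"
      by (intro power_mono vn) simp
    also have "\<dots> = (5 * biorth_bound \<tau>)\<^sup>2 * (\<Sum>n. (cmod (c n))\<^sup>2)"
      using sc by (simp add: power_mult_distrib suminf_nonneg)
    also have "(\<Sum>n. (cmod (c n))\<^sup>2) = \<omega> * (\<Sum>n. (cmod (y0 (sin_mode L n)) / real n)\<^sup>2)"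
      unfolding nc \<omega>_def by (rule suminf_mult[OF coef(1)])
    also have "(5 * biorth_bound \<tau>)\<^sup>2 * \<dots> \<le> (5 * biorth_bound \<tau>)\<^sup>2 * (\<omega> * (pi\<^sup>2 / (2 * L) * (norm_Hm1 L y0)\<^sup>2))"
      using \<omega> by (intro mult_left_mono coef(2)) auto
    also have "\<dots> = \<omega> * (cost_bound L \<tau> * norm_Hm1 L y0)\<^sup>2"
      using L by (simp add: cost_bound_def power_mult_distrib power_divide)
    finally have "(norm_L2 0 T u)\<^sup>2 \<le> (cost_bound L \<tau> * norm_Hm1 L y0)\<^sup>2" using \<omega> by simp
    then show ?thesis
      by (rule power2_le_imp_le) (use B H L in \<open>simp add: cost_bound_def\<close>)
  qed
  ultimately show ?thesis by blast
qed

text \<open>\<tau> \<le> 1/10 makes \<open>mult_b \<tau>\<close> at least 10, as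
  \<open>osc_ft_0_lower\<close> requires; 4000000 is the product of 5, 80000 and 10. The maximum
  with 0 covers an infimum equal to 0, for which \<open>ln\<close> returns 0.\<close>

lemma ln_control_cost_le:
  assumes L: "0 < L" and \<tau>: "0 < \<tau>" "\<tau> \<le> 1/10" and T: "T = 2 * \<tau> / (pi / L)\<^sup>2"
  shows "ln (control_cost T L) \<le>
    max 0 (ln (4000000 * pi / sqrt (2 * L)) - 2 * ln \<tau> + 103/100 * mult_b \<tau>)"
proof -
  have "9 \<le> pi\<^sup>2" using power_mono[of 3 pi 2] pi_gt3 by simp
  then have "940 * \<tau> \<le> 25 * pi\<^sup>2" using \<tau> by linarith
  then have b: "10 \<le> mult_b \<tau>" using \<tau> by (simp add: mult_b_def pos_le_divide_eq)
  have low: "exp (- (103/100) * mult_b \<tau>) / 10 \<le> cmod (osc_ft (mult_b \<tau>) 0)" by (rule osc_ft_0_lower[OF b])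
  then have h0: "0 < cmod (osc_ft (mult_b \<tau>) 0)" by (rule less_le_trans[rotated]) simp
  then have nz: "osc_ft (mult_b \<tau>) 0 \<noteq> 0" by simp
  have \<tau>1: "\<tau> \<le> 1" using \<tau> by simp
  let ?S = "{C. 0 < C \<and> (\<forall>y0\<in>Hm1 L. \<exists>u. null_control T L y0 u \<and> norm_L2 0 T u \<le> C * norm_Hm1 L y0)}"
  have B: "0 < biorth_bound \<tau>" by (rule biorth_bound_pos[OF \<tau>(1) \<tau>1 nz])
  have S: "cost_bound L \<tau> \<in> ?S"
    using null_control_cost[OF L \<tau>(1) \<tau>1 nz T] B L by (auto simp: cost_bound_def)
  have le: "control_cost T L \<le> cost_bound L \<tau>"
    unfolding control_cost_def by (rule cInf_lower[OF S]) (auto intro: bdd_belowI[of _ 0])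
  have nonneg: "0 \<le> control_cost T L"
    unfolding control_cost_def using S by (intro cInf_greatest) auto
  define E where "E = 4000000 * pi / sqrt (2 * L) * (1 / \<tau>\<^sup>2) * exp (103/100 * mult_b \<tau>)"
  have "biorth_bound \<tau> \<le> 800000 / \<tau>\<^sup>2 * exp (103/100 * mult_b \<tau>)"
  proof -
    have "biorth_bound \<tau> = 80000 / (\<tau>\<^sup>2 * cmod (osc_ft (mult_b \<tau>) 0))" by (rule biorth_bound_def)
    also have "\<dots> \<le> 80000 / (\<tau>\<^sup>2 * (exp (- (103/100) * mult_b \<tau>) / 10))"
      using low \<tau> h0 by (intro divide_left_mono mult_left_mono mult_pos_pos) auto
    also have "exp (- (103/100) * mult_b \<tau>) = inverse (exp (103/100 * mult_b \<tau>))"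
      by (simp add: exp_minus)
    also have "80000 / (\<tau>\<^sup>2 * (inverse (exp (103/100 * mult_b \<tau>)) / 10)) = 800000 / \<tau>\<^sup>2 * exp (103/100 * mult_b \<tau>)"
      by (simp only: divide_inverse inverse_mult_distrib inverse_inverse_eq)
    finally show ?thesis .
  qed
  then have "cost_bound L \<tau> \<le> 5 * (800000 / \<tau>\<^sup>2 * exp (103/100 * mult_b \<tau>)) * (pi / sqrt (2 * L))"
    unfolding cost_bound_def using L by (intro mult_right_mono mult_left_mono) auto
  also have "\<dots> = E" by (simp add: E_def mult_ac)
  finally have "control_cost T L \<le> E" using le by simp
  have lnE: "ln E = ln (4000000 * pi / sqrt (2 * L)) - 2 * ln \<tau> + 103/100 * mult_b \<tau>"
  proof -
    have p: "0 < 4000000 * pi / sqrt (2 * L)" "0 < 1 / \<tau>\<^sup>2" using L \<tau> by simp_all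
    have "ln E = ln (4000000 * pi / sqrt (2 * L) * (1 / \<tau>\<^sup>2)) + ln (exp (103/100 * mult_b \<tau>))"
      unfolding E_def by (rule ln_mult_pos[OF mult_pos_pos[OF p] exp_gt_zero])
    also have "ln (4000000 * pi / sqrt (2 * L) * (1 / \<tau>\<^sup>2)) = ln (4000000 * pi / sqrt (2 * L)) + ln (1 / \<tau>\<^sup>2)"
      by (rule ln_mult_pos[OF p])
    also have "ln (1 / \<tau>\<^sup>2) = - 2 * ln \<tau>" using \<tau> by (simp add: ln_div ln_realpow)
    finally show ?thesis by simp
  qed
  show ?thesis
  proof (cases "control_cost T L = 0")
    case True then show ?thesis by simp
  next
    case False
    then have "0 < control_cost T L" using nonneg by simp
    then have "ln (control_cost T L) \<le> ln E" using \<open>control_cost T L \<le> E\<close> by simp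
    then show ?thesis unfolding lnE by simp
  qed
qed

text \<open>Comparison of fourth powers. 2.27950708 is four times the decimal constant of the
  theorem, and 2.2 exceeds four times 515/940.\<close>

lemma root_4_27_bounds: "22/10 < root 4 27" "root 4 27 < 2.27950708"
proof -
  have "root 4 ((22/10)^4) < root 4 27" by (rule real_root_less_mono) (simp_all add: power_divide)
  then show "22/10 < root 4 27" by (simp add: real_root_power_cancel)
  have "root 4 27 < root 4 (2.27950708^4)" by (rule real_root_less_mono) (simp_all add: power_divide)
  then show "root 4 27 < 2.27950708" by (simp add: real_root_power_cancel)
qed

theorem theorem3p1:
  fixes L :: real
  assumes "0 < L"
  shows "beta_plus L \<le> ereal (root 4 27 / 4 * L\<^sup>2) \<and>
         root 4 27 / 4 * L\<^sup>2 < 0.56987677 * L\<^sup>2"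
proof
  have L2: "0 < L\<^sup>2" using assms by simp
  show "root 4 27 / 4 * L\<^sup>2 < 0.56987677 * L\<^sup>2"
    using root_4_27_bounds(2) L2 by (intro mult_strict_right_mono) auto
  define A where "A = ln (4000000 * pi / sqrt (2 * L))"
  define \<omega> where "\<omega> = (pi / L)\<^sup>2"
  have \<omega>: "0 < \<omega>" using assms by (simp add: \<omega>_def)
  \<comment> \<open>The limit value T * 103/100 * \<open>mult_b \<tau>\<close> at \<tau> = \<omega>
    T / 2; since \<pi>^2 / \<omega> = L^2, it is 103/100 * 50/94 L^2.\<close>
  define k where "k = 515/940 * L\<^sup>2"
  \<comment> \<open>The prefactor of the exponential in the cost is a power of T up to a constant,
    so it contributes only multiples of T and T ln T, which vanish in the limit.\<close>
  define G where "G = (\<lambda>T. T * (A - 2 * ln (\<omega> / 2) - 2 * ln T) + k)"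
  have "(G \<longlongrightarrow> k) (at_right 0)" unfolding G_def by real_asymp
  moreover have kless: "k < root 4 27 / 4 * L\<^sup>2"
    unfolding k_def using root_4_27_bounds(1) L2 by (intro mult_strict_right_mono) auto
  ultimately have ev: "eventually (\<lambda>T. G T < root 4 27 / 4 * L\<^sup>2) (at_right 0)" by (rule order_tendstoD)
  \<comment> \<open>T < 1 / (5 \<omega>) keeps \<tau> = \<omega> T / 2 below 1/10.\<close>
  have "eventually (\<lambda>T. T \<in> {0<..<1 / (5 * \<omega>)}) (at_right 0)"
    using \<omega> by (intro eventually_at_right_real) simp
  with ev have "eventually (\<lambda>T. ereal (T * ln (control_cost T L)) \<le> ereal (root 4 27 / 4 * L\<^sup>2)) (at_right 0)"
  proof eventually_elim
    case (elim T)
    define \<tau> where "\<tau> = \<omega> * T / 2"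
    have T: "0 < T" "T < 1 / (5 * \<omega>)" using elim by auto
    have \<tau>: "0 < \<tau>" "\<tau> \<le> 1/10" using T \<omega> by (auto simp: \<tau>_def field_simps)
    have T\<tau>: "T = 2 * \<tau> / (pi / L)\<^sup>2" unfolding \<omega>_def[symmetric] using \<omega> by (simp add: \<tau>_def)
    have "T * ln (control_cost T L) \<le> T * max 0 (A - 2 * ln \<tau> + 103/100 * mult_b \<tau>)"
      unfolding A_def using T by (intro mult_left_mono ln_control_cost_le assms \<tau> T\<tau>) auto
    also have "\<dots> = max 0 (T * (A - 2 * ln \<tau> + 103/100 * mult_b \<tau>))"
      using T by (simp add: max_def mult_le_0_iff zero_le_mult_iff) 
    also have "T * (A - 2 * ln \<tau> + 103/100 * mult_b \<tau>) = G T"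
    proof -
      have "ln \<tau> = ln (\<omega> / 2) + ln T" unfolding \<tau>_def using \<omega> T ln_mult_pos[of "\<omega>/2" T] by simp
      moreover have "T * (103/100 * mult_b \<tau>) = k"
      proof -
        have "pi\<^sup>2 = \<omega> * L\<^sup>2" using assms by (simp add: \<omega>_def power_divide)
        then show ?thesis using \<omega> T by (simp add: mult_b_def \<tau>_def k_def)
      qed
      ultimately show ?thesis by (simp add: G_def algebra_simps)
    qed
    finally have "T * ln (control_cost T L) \<le> max 0 (G T)" .
    also have "max 0 (G T) \<le> root 4 27 / 4 * L\<^sup>2"
      using elim(1) by (intro max.boundedI less_imp_le[of "G T"]) auto
    finally show ?case by (simp only: ereal_less_eq)
  qed
  then show "beta_plus L \<le> ereal (root 4 27 / 4 * L\<^sup>2)"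
    unfolding beta_plus_def by (rule Limsup_bounded)
qed

end
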